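(* Let $\Phi:\mathcal{M}(\mathbb{T}^d)\to\mathcal{H}$ be the operator $\Phi\mu=\int_{\mathbb{T}^d}\varphi(x)\,\mathrm{d}\mu(x)$ with kernel $\varphi\in\mathcal{C}^{j}(\mathbb{T}^d;\mathcal{H})$, where $j\ge\lfloor d/2\rfloor+1$. Let $y\in\mathcal{H}$ and $\lambda>0$. For each $f_c\in\mathbb{N}$, let $\Phi_{c}$ be the spectral approximation operator of $\Phi$ with cutoff frequency $f_c$, and let $\mu_{f_c}$ be a minimizer over $\mathcal{M}(\mathbb{T}^d)$ of $$\mathcal{E}_{f_c}(\mu)=\frac{1}{2\lambda}\|\Phi_c\mu-y\|_{\mathcal{H}}^2+|\mu|(\mathbb{T}^d).$$ Then the sequence $(\mu_{f_c})_{f_c\in\mathbb{N}}$ has accumulation points in the weak-* topology of $\mathcal{M}(\mathbb{T}^d)$, and each of them is a solution to $$\min_{\mu\in\mathcal{M}(\mathbb{T}^d)}\ \frac{1}{2\lambda}\|\Phi\mu-y\|_{\mathcal{H}}^2+|\mu|(\mathbb{T}^d).$$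
   Context: $\mathbb{T}^d=(\mathbb{R}/\mathbb{Z})^d$. $\mathcal{M}(\mathbb{T}^d)$ is the space of bounded complex Radon measures on $\mathbb{T}^d$, the topological dual of the space of continuous functions $\mathcal{C}(\mathbb{T}^d)$, endowed with the weak-* topology. $|\mu|(\mathbb{T}^d)=\sup\{\mathrm{Re}\int_{\mathbb{T}^d}\overline{\eta}\,\mathrm{d}\mu:\eta\in\mathcal{C}(\mathbb{T}^d),\ \|\eta\|_\infty\le1\}$ is the total variation norm. $\mathcal{H}$ is a separable (complex) Hilbert space. For $k\in\mathbb{Z}^d$ the ($\mathcal{H}$-valued) Fourier coefficient of $\varphi$ is $c_k(\varphi)=\int_{\mathbb{T}^d}e^{-2i\pi\langle k,x\rangle}\varphi(x)\,\mathrm{d}x\in\mathcal{H}$. For $f_c\in\mathbb{N}$, put $\Omega_c=\{-f_c,\dots,f_c\}^d$. The spectral approximation operator $\Phi_c$ of $\Phi$ with cutoff frequency $f_c$ is the operator $\Phi_c\mu=\int_{\mathbb{T}^d}\varphi_c(x)\,\mathrm{d}\mu(x)$ whose kernel satisfies $c_k(\varphi_c)=c_k(\varphi)$ for $k\in\Omega_c$ and $c_k(\varphi_c)=0$ for $k\in\mathbb{Z}^d\setminus\Omega_c$, i.e. $\varphi_c(x)=\sum_{k\in\Omega_c}c_k(\varphi)e^{2i\pi\langle k,x\rangle}$. *)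

theory Defs
  imports "HOL-Analysis.Analysis"
begin

section \<open>Separable complex Hilbert spaces\<close>

text \<open>The inner product is linear in its first argument. Positive definiteness is contained in
  the axiom that relates it to the norm.\<close>

class complex_hilbert = real_normed_vector + complete_space +
  fixes scaleC :: "complex \<Rightarrow> 'a \<Rightarrow> 'a"  (infixr \<open>*\<^sub>C\<close> 75)
    and cinner :: "'a \<Rightarrow> 'a \<Rightarrow> complex"
  assumes scaleC_add_right: "a *\<^sub>C (x + y) = a *\<^sub>C x + a *\<^sub>C y"
    and scaleC_add_left: "(a + b) *\<^sub>C x = a *\<^sub>C x + b *\<^sub>C x"
    and scaleC_scaleC: "a *\<^sub>C b *\<^sub>C x = (a * b) *\<^sub>C x"
    and scaleR_scaleC: "r *\<^sub>R x = complex_of_real r *\<^sub>C x"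
    and cinner_commute: "cinner x y = cnj (cinner y x)"
    and cinner_add_left: "cinner (x + y) z = cinner x z + cinner y z"
    and cinner_scaleC_left: "cinner (a *\<^sub>C x) y = a * cinner x y"
    and cinner_self: "cinner x x = complex_of_real ((norm x)\<^sup>2)"

class separable_complex_hilbert = complex_hilbert +
  assumes separable: "\<exists>D::'a set. countable D \<and> (\<forall>U. open U \<and> U \<noteq> {} \<longrightarrow> (\<exists>d\<in>D. d \<in> U))"

text \<open>Bochner integration in the library is available for second countable Banach spaces.\<close>

instance complex_hilbert \<subseteq> banach ..

instance separable_complex_hilbert \<subseteq> second_countable_topology
proof
  obtain D :: "'a set" where D: "countable D"
      "\<And>U. open U \<Longrightarrow> U \<noteq> {} \<Longrightarrow> \<exists>d\<in>D. d \<in> U"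
    using separable by blast
  define B where "B = (\<lambda>(x::'a, n::nat). ball x (inverse (real (Suc n)))) ` (D \<times> UNIV)"
  have "countable B"
    unfolding B_def using D(1) by auto
  moreover have "topological_basis B"
  proof (rule topological_basisI)
    show "open S" if "S \<in> B" for S
      using that unfolding B_def by auto
    fix U :: "'a set" and x assume "open U" "x \<in> U"
    then obtain e where e: "e > 0" "ball x e \<subseteq> U"
      using open_contains_ball by blast
    obtain n where n: "inverse (real (Suc n)) < e / 2"
      using reals_Archimedean[of "e / 2"] e(1) by auto
    have "ball x (inverse (real (Suc n))) \<noteq> {}"
      by simp
    from D(2)[OF open_ball this] obtain z where z: "z \<in> D" "dist z x < inverse (real (Suc n))"
      by (auto simp: dist_commute)
    have "ball z (inverse (real (Suc n))) \<subseteq> U"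
    proof
      fix w assume "w \<in> ball z (inverse (real (Suc n)))"
      then have "dist x w < e"
        using z(2) n dist_triangle[of x w z] by (simp add: dist_commute)
      then show "w \<in> U"
        using e(2) by auto
    qed
    moreover have "ball z (inverse (real (Suc n))) \<in> B"
      unfolding B_def using z(1) by (auto intro!: image_eqI[of _ _ "(z, n)"])
    moreover have "x \<in> ball z (inverse (real (Suc n)))"
      using z(2) by simp
    ultimately show "\<exists>S\<in>B. x \<in> S \<and> S \<subseteq> U"
      by blast
  qed
  ultimately show "\<exists>B::'a set set. countable B \<and> open = generate_topology B"
    by (intro exI[of _ B] conjI topological_basis_imp_subbasis)
qed

instantiation complex :: separable_complex_hilbert
begin

definition scaleC_complex :: "complex \<Rightarrow> complex \<Rightarrow> complex"
  where "scaleC_complex a x = a * x"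

definition cinner_complex :: "complex \<Rightarrow> complex \<Rightarrow> complex"
  where "cinner_complex x y = x * cnj y"

instance
proof
  show "\<exists>D::complex set. countable D \<and> (\<forall>U. open U \<and> U \<noteq> {} \<longrightarrow> (\<exists>d\<in>D. d \<in> U))"
    using countable_dense_exists[where 'a = complex] by blast
qed (simp_all add: scaleC_complex_def cinner_complex_def ring_distribs scaleR_conv_of_real
       complex_norm_square del: of_real_power)

end


section \<open>The torus\<close>

quotient_type circle = real / "\<lambda>x y. x - y \<in> \<int>"
proof (rule equivpI)
  show "reflp (\<lambda>x y::real. x - y \<in> \<int>)"
    by (simp add: reflp_def)
  show "symp (\<lambda>x y::real. x - y \<in> \<int>)"
    by (rule sympI) (drule Ints_minus, simp)
  show "transp (\<lambda>x y::real. x - y \<in> \<int>)"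
  proof (rule transpI)
    fix x y z :: real assume "x - y \<in> \<int>" "y - z \<in> \<int>"
    then have "(x - y) + (y - z) \<in> \<int>"
      by (rule Ints_add)
    then show "x - z \<in> \<int>"
      by simp
  qed
qed

instantiation circle :: topological_space
begin

definition open_circle :: "circle set \<Rightarrow> bool"
  where "open_circle U \<longleftrightarrow> open (abs_circle -` U)"

instance
  by standard (auto simp: open_circle_def vimage_Union)

end

text \<open>The representative in the interval \<open>[0, 1)\<close>.\<close>

lift_definition circle_coord :: "circle \<Rightarrow> real" is frac
proof -
  fix x y :: real assume "x - y \<in> \<int>"
  then obtain n where "x = y + of_int n"
    by (auto simp: Ints_def algebra_simps)
  then show "frac x = frac y"
    by (simp add: frac_def)
qed

type_synonym 'd torus = "(circle, 'd) vec"

definition torus_proj :: "(real, 'd::finite) vec \<Rightarrow> 'd torus"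
  where "torus_proj x = (\<chi> i. abs_circle (x $ i))"

definition torus_lebesgue :: "'d::finite torus measure"
  where "torus_lebesgue =
    distr (restrict_space lborel {x. \<forall>i. 0 \<le> x $ i \<and> x $ i < 1}) borel torus_proj"

text \<open>This pairing depends on the chosen representative of \<open>x\<close>, but only up to an integer, so that
  the exponentials \<open>exp (\<plusminus>2 \<i> \<pi> (torus_pairing k x))\<close> do not.\<close>

definition torus_pairing :: "(int, 'd) vec \<Rightarrow> 'd::finite torus \<Rightarrow> real"
  where "torus_pairing k x = (\<Sum>i\<in>UNIV. of_int (k $ i) * circle_coord (x $ i))"


section \<open>Functions of class \<open>C\<^sup>j\<close>\<close>

primrec C_class :: "nat \<Rightarrow> ((real, 'd::finite) vec \<Rightarrow> 'h::real_normed_vector) \<Rightarrow> bool"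
  where
    "C_class 0 f \<longleftrightarrow> continuous_on UNIV f"
  | "C_class (Suc j) f \<longleftrightarrow> (\<forall>x. f differentiable (at x)) \<and>
       (\<forall>i. C_class j (\<lambda>x. frechet_derivative f (at x) (axis i 1)))"

definition torus_C_class :: "nat \<Rightarrow> ('d::finite torus \<Rightarrow> 'h::real_normed_vector) \<Rightarrow> bool"
  where "torus_C_class j f \<longleftrightarrow> C_class j (f \<circ> torus_proj)"


section \<open>Complex measures\<close>

text \<open>A complex measure is a countably additive complex function on the Borel sets (extended by 0
  to the other sets). It is automatically bounded, and on a compact metrizable space such as the
  torus it is automatically a Radon measure.\<close>

typedef (overloaded) 'a cmeasure =
  "{\<mu> :: 'a::topological_space set \<Rightarrow> complex.
      (\<forall>A. A \<notin> sets borel \<longrightarrow> \<mu> A = 0) \<and>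
      (\<forall>F::nat \<Rightarrow> 'a set. range F \<subseteq> sets borel \<longrightarrow> disjoint_family F \<longrightarrow>
         (\<lambda>n. \<mu> (F n)) sums \<mu> (\<Union>n. F n))}"
  morphisms cm_value Abs_cmeasure
  by (rule exI[of _ "\<lambda>_. 0"]) simp

text \<open>The positive part of the Jordan decomposition of a finite signed measure \<open>\<nu>\<close>,
  \<open>\<nu>\<^sup>+(A) = sup {\<nu>(B) | B \<subseteq> A}\<close>. Negative values of \<open>\<nu>\<close> are truncated by \<^const>\<open>ennreal\<close>, which does
  not change the supremum because \<open>B\<close> may be empty. The negative part of \<open>\<nu>\<close> is the positive part
  of \<open>-\<nu>\<close>.\<close>

definition jordan_pos :: "('a::topological_space set \<Rightarrow> real) \<Rightarrow> 'a measure"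
  where "jordan_pos \<nu> =
    measure_of UNIV (sets borel) (\<lambda>A. SUP B\<in>{B \<in> sets borel. B \<subseteq> A}. ennreal (\<nu> B))"

definition cm_integral ::
    "'a::topological_space cmeasure \<Rightarrow> ('a \<Rightarrow> 'h::separable_complex_hilbert) \<Rightarrow> 'h"
  where "cm_integral \<mu> f =
    ((\<integral>x. f x \<partial>jordan_pos (\<lambda>A. Re (cm_value \<mu> A)))
      - (\<integral>x. f x \<partial>jordan_pos (\<lambda>A. - Re (cm_value \<mu> A))))
    + \<i> *\<^sub>C ((\<integral>x. f x \<partial>jordan_pos (\<lambda>A. Im (cm_value \<mu> A)))
      - (\<integral>x. f x \<partial>jordan_pos (\<lambda>A. - Im (cm_value \<mu> A))))"

definition total_variation :: "'a::topological_space cmeasure \<Rightarrow> real"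
  where "total_variation \<mu> =
    (SUP \<eta>\<in>{\<eta>. continuous_on UNIV \<eta> \<and> (\<forall>x. norm (\<eta> x) \<le> 1)}.
       Re (cm_integral \<mu> (\<lambda>x. cnj (\<eta> x))))"

text \<open>The coarsest topology for which \<open>\<mu> \<mapsto> \<integral> \<eta> d\<mu>\<close> is continuous for all continuous \<open>\<eta>\<close>.\<close>

definition weak_star :: "'a::topological_space cmeasure topology"
  where "weak_star = topology_generated_by
    {{\<mu>. cm_integral \<mu> \<eta> \<in> U} |\<eta> U. continuous_on UNIV \<eta> \<and> open (U :: complex set)}"

definition accumulation_point :: "'b topology \<Rightarrow> (nat \<Rightarrow> 'b) \<Rightarrow> 'b \<Rightarrow> bool"
  where "accumulation_point T s l \<longleftrightarrow>
    l \<in> topspace T \<and> (\<forall>U. openin T U \<and> l \<in> U \<longrightarrow> infinite {n. s n \<in> U})"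


section \<open>The operators and the functional\<close>

definition kernel_operator ::
    "('d::finite torus \<Rightarrow> 'h::separable_complex_hilbert) \<Rightarrow> 'd torus cmeasure \<Rightarrow> 'h"
  where "kernel_operator \<phi> \<mu> = cm_integral \<mu> \<phi>"

definition fourier_coeff ::
    "('d::finite torus \<Rightarrow> 'h::separable_complex_hilbert) \<Rightarrow> (int, 'd) vec \<Rightarrow> 'h"
  where "fourier_coeff \<phi> k =
    (\<integral>x. exp (- 2 * \<i> * of_real pi * of_real (torus_pairing k x)) *\<^sub>C \<phi> x \<partial>torus_lebesgue)"

definition freq_cube :: "nat \<Rightarrow> (int, 'd::finite) vec set"
  where "freq_cube fc = {k. \<forall>i. k $ i \<in> {- int fc..int fc}}"

definition spectral_kernel ::
    "nat \<Rightarrow> ('d::finite torus \<Rightarrow> 'h::separable_complex_hilbert) \<Rightarrow> 'd torus \<Rightarrow> 'h"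
  where "spectral_kernel fc \<phi> x =
    (\<Sum>k\<in>freq_cube fc.
       exp (2 * \<i> * of_real pi * of_real (torus_pairing k x)) *\<^sub>C fourier_coeff \<phi> k)"

definition blasso_energy ::
    "real \<Rightarrow> 'h::separable_complex_hilbert \<Rightarrow> ('d::finite torus cmeasure \<Rightarrow> 'h) \<Rightarrow>
     'd torus cmeasure \<Rightarrow> real"
  where "blasso_energy lam y \<Phi> \<mu> = 1 / (2 * lam) * (norm (\<Phi> \<mu> - y))\<^sup>2 + total_variation \<mu>"

end

theory Submission
  imports Defs "HOL-Probability.Helly_Selection" "HOL-Probability.Giry_Monad"
begin

text \<open>
  Minimality passes to weak-* limits because the approximate functionals \<open>\<E>\<^sub>n\<close> converge to the
  limit functional \<open>\<E>\<close> pointwise, and along a bounded sequence of measures that accumulates at \<open>\<mu>\<close>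
  their values come, infinitely often, arbitrarily close to \<open>\<E>(\<mu>)\<close> or exceed it. For a competitor \<open>\<nu>\<close> one has
  \<open>\<E>\<^sub>n(\<mu>\<^sub>n) \<le> \<E>\<^sub>n(\<nu>) \<rightarrow> \<E>(\<nu>)\<close>; with \<open>\<nu> = \<mu>\<^sub>0\<close> this bounds the total variations of
  the minimizers \<open>\<mu>\<^sub>n\<close>. The total variation is a supremum of weak-* continuous functions. The
  quadratic term lies above its tangent at \<open>v = \<Phi>\<mu> - y\<close>, which involves \<open>\<mu>\<^sub>n\<close> only through
  \<open>\<integral>\<langle>\<phi>, v\<rangle> d\<mu>\<^sub>n\<close>, up to an error that is at most \<open>\<parallel>\<phi>\<^sub>n - \<phi>\<parallel>\<^sub>\<infinity> |\<mu>\<^sub>n|\<close> times a constant.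
  So the lower bound at an accumulation point uses only two continuous test functions. Two
  ingredients carry the argument.

  The first is uniform convergence \<open>\<phi>\<^sub>n \<rightarrow> \<phi>\<close> of the truncated Fourier series
  (\<open>spectral_kernel_uniform_limit\<close>). Pairing with vectors of \<open>\<H>\<close> reduces it to scalar functions,
  provided that the scalar rate depends only on a bound for the derivatives. Bessel's inequality for
  the pure derivatives of order \<open>s = \<lfloor>d/2\<rfloor> + 1\<close> bounds \<open>\<Sum>\<^sub>k w\<^sub>k |c\<^sub>k|\<^sup>2\<close> with
  \<open>w\<^sub>k = \<Sum>\<^sub>i |2\<pi>k\<^sub>i|\<^sup>2\<^sup>s\<close>. Since \<open>2 s > d\<close>, the sum of \<open>1/w\<^sub>k\<close> over \<open>k \<noteq> 0\<close>
  converges, and the Cauchy--Schwarz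
  inequality estimates the tails of the Fourier series (\<open>scalar_fourier_uniform\<close>). The sum of the
  series is the given function because a continuous function without nonzero Fourier coefficients
  vanishes, by the Stone--Weierstrass theorem (\<open>fourier_coeff_unique\<close>).

  The second is sequential weak-* compactness of bounded sets of measures on the torus
  (\<open>weak_star_accumulation_point_exists\<close>). It is transported from the real line, where it is Helly's
  selection theorem: a space-filling curve maps \<open>[0, 1]\<close> continuously onto the torus and has a Borel
  section, so that measures can be pulled back to the line, a subsequence extracted there, and the
  limit pushed forward. This is done for the four Jordan parts of the complex measures. Their masses
  are bounded by the total variation, which is defined by duality, since indicators of Borel sets can
  be approximated in mean by continuous functions (\<open>jordan_mass_le_total_variation\<close>).
\<close>

section \<open>Inner products\<close>

lemma cinner_0_left [simp]: "cinner 0 (y::'h::complex_hilbert) = 0"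
  using cinner_add_left[of 0 0 y] by simp

lemma cinner_minus_left: "cinner (- x) (y::'h::complex_hilbert) = - cinner x y"
  using cinner_add_left[of x "- x" y] by (simp add: eq_neg_iff_add_eq_0 add.commute)

lemma cinner_diff_left: "cinner (x - y) (z::'h::complex_hilbert) = cinner x z - cinner y z"
  using cinner_add_left[of x "- y" z] by (simp add: cinner_minus_left)

lemma cinner_scaleR_left: "cinner (r *\<^sub>R x) (y::'h::complex_hilbert) = of_real r * cinner x y"
  by (simp add: scaleR_scaleC cinner_scaleC_left)

lemma norm_diff_cinner:
  "(norm (x - y))\<^sup>2 = (norm x)\<^sup>2 + (norm y)\<^sup>2 - 2 * Re (cinner x (y::'h::complex_hilbert))"
proof -
  have "complex_of_real ((norm (x - y))\<^sup>2) = cinner (x - y) (x - y)"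
    by (rule cinner_self[symmetric])
  also have "\<dots> = cnj (cinner (x - y) x) - cnj (cinner (x - y) y)"
    by (subst cinner_diff_left) (simp add: cinner_commute[of _ "x - y"])
  also have "\<dots> = of_real ((norm x)\<^sup>2) + of_real ((norm y)\<^sup>2) - (cinner x y + cnj (cinner x y))"
    by (simp add: cinner_diff_left cinner_self cinner_commute[of y x])
  also have "\<dots> = of_real ((norm x)\<^sup>2 + (norm y)\<^sup>2 - 2 * Re (cinner x y))"
    by (simp add: complex_eq_iff)
  finally show ?thesis
    using of_real_eq_iff by blast
qed

lemma norm_scaleC: "norm (c *\<^sub>C (x::'h::complex_hilbert)) = cmod c * norm x"
proof -
  have "complex_of_real ((norm (c *\<^sub>C x))\<^sup>2) = cinner (c *\<^sub>C x) (c *\<^sub>C x)"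
    by (rule cinner_self[symmetric])
  also have "\<dots> = c * cnj (c * cinner x x)"
    by (metis cinner_commute cinner_scaleC_left)
  also have "\<dots> = (c * cnj c) * of_real ((norm x)\<^sup>2)"
    by (simp add: cinner_self)
  also have "\<dots> = of_real ((cmod c * norm x)\<^sup>2)"
    by (simp add: complex_norm_square[symmetric] power_mult_distrib)
  finally have "(norm (c *\<^sub>C x))\<^sup>2 = (cmod c * norm x)\<^sup>2"
    using of_real_eq_iff by blast
  then show ?thesis
    by (simp add: power2_eq_iff_nonneg)
qed

text \<open>Cauchy--Schwarz, from the positivity of the squared norm of
  \<open>\<parallel>y\<parallel>\<^sup>2 x - \<langle>x, y\<rangle> y\<close>.\<close>

lemma cinner_Cauchy_Schwarz: "cmod (cinner x y) \<le> norm x * norm (y::'h::complex_hilbert)"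
proof (cases "y = 0")
  case True
  then show ?thesis
    using cinner_commute[of x y] by simp
next
  case False
  define c where "c = cinner x y"
  have Re: "Re (cinner ((norm y)\<^sup>2 *\<^sub>R x) (c *\<^sub>C y)) = (norm y)\<^sup>2 * (cmod c)\<^sup>2"
  proof -
    have "cinner x (c *\<^sub>C y) = cnj c * c"
      by (metis c_def cinner_commute cinner_scaleC_left complex_cnj_mult)
    also have "\<dots> = of_real ((cmod c)\<^sup>2)"
      by (metis complex_norm_square mult.commute)
    finally show ?thesis
      by (simp add: cinner_scaleR_left)
  qed
  have "0 \<le> (norm ((norm y)\<^sup>2 *\<^sub>R x - c *\<^sub>C y))\<^sup>2"
    by simp
  also have "\<dots> = (norm y)\<^sup>2 * ((norm x * norm y)\<^sup>2 - (cmod c)\<^sup>2)"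
    unfolding norm_diff_cinner Re by (simp add: norm_scaleC algebra_simps power2_eq_square)
  finally have "(cmod c)\<^sup>2 \<le> (norm x * norm y)\<^sup>2"
    using False by (simp add: zero_le_mult_iff)
  then show ?thesis
    unfolding c_def by (simp add: power2_le_iff_abs_le)
qed

lemma bounded_linear_cinner_left: "bounded_linear (\<lambda>x. cinner x (v::'h::complex_hilbert))"
proof (rule bounded_linear_intro)
  show "norm (cinner x v) \<le> norm x * norm v" for x
    by (rule cinner_Cauchy_Schwarz)
qed (simp_all add: cinner_add_left cinner_scaleR_left scaleR_conv_of_real)

lemma bounded_linear_scaleC_right: "bounded_linear (\<lambda>x. c *\<^sub>C (x::'h::complex_hilbert))"
proof (rule bounded_linear_intro)
  show "c *\<^sub>C (r *\<^sub>R x) = r *\<^sub>R c *\<^sub>C (x::'h)" for r x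
    by (simp add: scaleR_scaleC scaleC_scaleC mult.commute)
  show "norm (c *\<^sub>C x) \<le> norm x * cmod c" for x :: 'h
    by (simp add: norm_scaleC)
qed (rule scaleC_add_right)

lemma bounded_bilinear_scaleC: "bounded_bilinear (\<lambda>c (x::'h::complex_hilbert). c *\<^sub>C x)"
proof
  show "\<exists>K. \<forall>c (x::'h). norm (c *\<^sub>C x) \<le> norm c * norm x * K"
    by (intro exI[of _ 1]) (simp add: norm_scaleC)
qed (simp_all add: scaleC_add_left scaleC_add_right scaleR_scaleC[where 'a = 'h] scaleC_scaleC
    scaleR_conv_of_real mult.commute)

lemma bounded_linear_scaleC_left: "bounded_linear (\<lambda>c. c *\<^sub>C (x::'h::complex_hilbert))"
proof (rule bounded_linear_intro)
  show "(r *\<^sub>R c) *\<^sub>C x = r *\<^sub>R c *\<^sub>C (x::'h)" for r c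
    by (simp add: scaleR_scaleC[where 'a = 'h] scaleC_scaleC scaleR_conv_of_real)
  show "norm (c *\<^sub>C x) \<le> norm c * norm x" for c
    by (simp add: norm_scaleC)
qed (rule scaleC_add_left)

text \<open>In a Hilbert space a vector is as small as its products with unit vectors, so that a
  vector valued estimate follows from scalar ones.\<close>

lemma norm_le_of_cinner:
  assumes "0 \<le> B" "\<And>v::'h::complex_hilbert. cmod (cinner x v) \<le> B * norm v"
  shows "norm x \<le> B"
proof (cases "x = 0")
  case True
  then show ?thesis
    using assms(1) by simp
next
  case False
  have "(norm x)\<^sup>2 \<le> B * norm x"
    using assms(2)[of x] by (simp add: cinner_self norm_power)
  then show ?thesis
    using False by (simp add: power2_eq_square)
qed

section \<open>The metric of the torus\<close>

definition dist_nearest_int :: "real \<Rightarrow> real"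
  where "dist_nearest_int t = \<bar>t - of_int (round t)\<bar>"

lemma dist_nearest_int_le: "dist_nearest_int t \<le> \<bar>t - of_int n\<bar>"
  unfolding dist_nearest_int_def by (rule round_diff_minimal)

lemma dist_nearest_int_triangle: "dist_nearest_int (s + t) \<le> dist_nearest_int s + dist_nearest_int t"
  using dist_nearest_int_le[of "s + t" "round s + round t"] unfolding dist_nearest_int_def by simp

lemma dist_nearest_int_eq_0_iff: "dist_nearest_int t = 0 \<longleftrightarrow> t \<in> \<int>"
proof
  show "t \<in> \<int> \<Longrightarrow> dist_nearest_int t = 0"
    by (auto simp: dist_nearest_int_def elim: Ints_cases)
  assume "dist_nearest_int t = 0"
  then have "t = of_int (round t)"
    by (simp add: dist_nearest_int_def)
  then show "t \<in> \<int>"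
    by (metis Ints_of_int)
qed

lemma dist_nearest_int_cong: "s - t \<in> \<int> \<Longrightarrow> dist_nearest_int s = dist_nearest_int t"
  using dist_nearest_int_triangle[of t "s - t"] dist_nearest_int_triangle[of s "t - s"]
    dist_nearest_int_eq_0_iff[of "s - t"] dist_nearest_int_eq_0_iff[of "t - s"] Ints_minus[of "s - t"]
  by simp

lemma dist_nearest_int_minus: "dist_nearest_int (- t) = dist_nearest_int t"
  using dist_nearest_int_le[of "- t" "- round t"] dist_nearest_int_le[of t "- round (- t)"]
  unfolding dist_nearest_int_def by simp

text \<open>The distance of differences to the nearest integer metrizes the quotient topology of the circle. The
  torus then carries a product metric that induces its product topology.\<close>

instantiation circle :: metric_space
begin

lift_definition dist_circle :: "circle \<Rightarrow> circle \<Rightarrow> real" is "\<lambda>x y. dist_nearest_int (x - y)"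
proof (rule dist_nearest_int_cong)
  fix a b c d :: real assume "a - b \<in> \<int>" "c - d \<in> \<int>"
  then have "(a - b) - (c - d) \<in> \<int>"
    by (rule Ints_diff)
  then show "a - c - (b - d) \<in> \<int>"
    by (simp add: algebra_simps)
qed

definition uniformity_circle :: "(circle \<times> circle) filter"
  where "uniformity_circle = (INF e\<in>{0<..}. principal {(x, y). dist x y < e})"

lemma dist_abs_circle: "dist (abs_circle x) (abs_circle y) = dist_nearest_int (x - y)"
  by (rule dist_circle.abs_eq)

lemma abs_circle_eq_iff: "abs_circle x = abs_circle y \<longleftrightarrow> x - y \<in> \<int>"
  by (rule circle.abs_eq_iff)

lemma abs_circle_exhaust: "\<exists>x. c = abs_circle x"
  by (metis Quotient3_abs_rep Quotient3_circle)

text \<open>The infimum over representatives in the quotient metric is attained, even when one of the two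
  representatives is prescribed.\<close>

lemma dist_abs_circle_representative: "\<exists>y. c = abs_circle y \<and> \<bar>x - y\<bar> = dist (abs_circle x) c"
proof -
  obtain z where z: "c = abs_circle z"
    using abs_circle_exhaust by blast
  have "\<bar>x - (z + of_int (round (x - z)))\<bar> = dist (abs_circle x) c"
    unfolding z dist_abs_circle dist_nearest_int_def by (simp add: algebra_simps)
  moreover have "c = abs_circle (z + of_int (round (x - z)))"
    by (simp add: z abs_circle_eq_iff)
  ultimately show ?thesis
    by blast
qed

instance
proof
  show "uniformity = (INF e\<in>{0<..}. principal {(x::circle, y). dist x y < e})"
    by (rule uniformity_circle_def)
  show "open U \<longleftrightarrow> (\<forall>x\<in>U. \<forall>\<^sub>F (x', y) in uniformity. x' = x \<longrightarrow> y \<in> U)" for U :: "circle set"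
  proof -
    have "open U \<longleftrightarrow> (\<forall>c\<in>U. \<exists>e>0. \<forall>c'. dist c c' < e \<longrightarrow> c' \<in> U)"
    proof
      assume U: "open U"
      show "\<forall>c\<in>U. \<exists>e>0. \<forall>c'. dist c c' < e \<longrightarrow> c' \<in> U"
      proof
        fix c assume "c \<in> U"
        obtain x where x: "c = abs_circle x"
          using abs_circle_exhaust by blast
        then have "x \<in> abs_circle -` U"
          using \<open>c \<in> U\<close> by simp
        then obtain e where e: "e > 0" "\<And>y. dist y x < e \<Longrightarrow> y \<in> abs_circle -` U"
          using U unfolding open_circle_def open_dist by meson
        have "c' \<in> U" if "dist c c' < e" for c'
        proof -
          obtain y where y: "c' = abs_circle y" "\<bar>x - y\<bar> = dist c c'"
            using dist_abs_circle_representative[of c' x] unfolding x by blast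
          then have "y \<in> abs_circle -` U"
            using that by (intro e(2)) (simp add: dist_real_def abs_minus_commute)
          then show ?thesis
            by (simp add: y(1))
        qed
        then show "\<exists>e>0. \<forall>c'. dist c c' < e \<longrightarrow> c' \<in> U"
          using e(1) by blast
      qed
    next
      assume U: "\<forall>c\<in>U. \<exists>e>0. \<forall>c'. dist c c' < e \<longrightarrow> c' \<in> U"
      show "open U"
        unfolding open_circle_def open_dist
      proof
        fix x assume "x \<in> abs_circle -` U"
        then have "abs_circle x \<in> U"
          by simp
        then obtain e where e: "e > 0" "\<And>c'. dist (abs_circle x) c' < e \<Longrightarrow> c' \<in> U"
          using U by meson
        have "y \<in> abs_circle -` U" if "dist y x < e" for y
          using that dist_nearest_int_le[of "x - y" 0] e(2)[of "abs_circle y"]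
          by (simp add: dist_abs_circle dist_real_def)
        then show "\<exists>e>0. \<forall>y. dist y x < e \<longrightarrow> y \<in> abs_circle -` U"
          using e(1) by blast
      qed
    qed
    moreover have "eventually P uniformity \<longleftrightarrow> (\<exists>e>0. \<forall>x y. dist x y < e \<longrightarrow> P (x, y))"
      for P :: "circle \<times> circle \<Rightarrow> bool"
      unfolding uniformity_circle_def
      by (subst eventually_INF_base)
        (auto simp: eventually_principal Bex_def subset_eq intro: exI[of _ "min _ _"])
    ultimately show ?thesis
      by simp
  qed
  show "dist x y = 0 \<longleftrightarrow> x = y" for x y :: circle
    by transfer (rule dist_nearest_int_eq_0_iff)
  show "dist x y \<le> dist x z + dist y z" for x y z :: circle
  proof transfer
    show "dist_nearest_int (x - y) \<le> dist_nearest_int (x - z) + dist_nearest_int (y - z)" for x y z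
      using dist_nearest_int_triangle[of "x - z" "z - y"] dist_nearest_int_minus[of "y - z"] by simp
  qed
qed

end

lemma dist_abs_circle_le: "dist (abs_circle x) (abs_circle y) \<le> \<bar>x - y\<bar>"
  using dist_nearest_int_le[of "x - y" 0] by (simp add: dist_abs_circle)

lemma continuous_on_abs_circle: "continuous_on UNIV abs_circle"
  unfolding continuous_on_iff
  by (metis dist_abs_circle_le dist_real_def order_le_less_trans)

lemma continuous_on_torus_proj: "continuous_on UNIV (torus_proj :: (real, 'd::finite) vec \<Rightarrow> 'd torus)"
  unfolding torus_proj_def
  by (intro continuous_on_vec_lambda continuous_on_compose2[OF continuous_on_abs_circle]
      continuous_intros) auto

text \<open>A discontinuous section of \<^const>\<open>torus_proj\<close> with values in the half-open unit cube.\<close>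

definition torus_rep :: "'d::finite torus \<Rightarrow> (real, 'd) vec"
  where "torus_rep x = (\<chi> i. circle_coord (x $ i))"

lemma abs_circle_coord [simp]: "abs_circle (circle_coord c) = c"
proof -
  obtain x where "c = abs_circle x"
    using abs_circle_exhaust by blast
  then show ?thesis
    by (simp add: circle_coord.abs_eq abs_circle_eq_iff frac_def)
qed

lemma torus_proj_rep [simp]: "torus_proj (torus_rep x) = x"
  by (simp add: torus_proj_def torus_rep_def vec_eq_iff)

lemma circle_coord_bounds: "0 \<le> circle_coord c" "circle_coord c < 1"
  by (transfer; simp add: frac_lt_1)+

lemma compact_UNIV_torus: "compact (UNIV :: 'd::finite torus set)"
proof -
  have "torus_proj ` cbox 0 1 = (UNIV :: 'd torus set)"
  proof -
    have "torus_rep x \<in> cbox 0 1" for x :: "'d torus"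
      using circle_coord_bounds less_imp_le by (auto simp: mem_box_cart torus_rep_def)
    then show ?thesis
      by (metis UNIV_eq_I image_eqI torus_proj_rep)
  qed
  then show ?thesis
    using compact_continuous_image[OF continuous_on_subset[OF continuous_on_torus_proj] compact_cbox]
    by (metis subset_UNIV)
qed

text \<open>Because close points of the torus have close representatives, continuity on the torus is
  continuity of the periodic lift.\<close>

lemma continuous_on_torus_iff:
  fixes f :: "'d::finite torus \<Rightarrow> 'a::metric_space"
  shows "continuous_on UNIV f \<longleftrightarrow> continuous_on UNIV (f \<circ> torus_proj)"
proof
  assume "continuous_on UNIV f"
  then show "continuous_on UNIV (f \<circ> torus_proj)"
    by (intro continuous_on_compose continuous_on_torus_proj) (auto intro: continuous_on_subset)
next
  assume c: "continuous_on UNIV (f \<circ> torus_proj)"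
  show "continuous_on UNIV f"
    unfolding continuous_on_iff
  proof (intro ballI allI impI)
    fix x :: "'d torus" and e :: real assume "e > 0"
    then obtain d where d: "d > 0"
      "\<And>r. dist r (torus_rep x) < d \<Longrightarrow> dist (f (torus_proj r)) (f (torus_proj (torus_rep x))) < e"
      using c unfolding continuous_on_iff by (metis UNIV_I comp_apply)
    have "dist (f y) (f x) < e" if "dist y x < d" for y
    proof -
      have "\<exists>r. y $ i = abs_circle r \<and> \<bar>torus_rep x $ i - r\<bar> = dist (x $ i) (y $ i)" for i
        using dist_abs_circle_representative[of "y $ i" "torus_rep x $ i"]
        by (simp add: torus_rep_def)
      then obtain r where r: "\<And>i. y $ i = abs_circle (r i)"
          "\<And>i. \<bar>torus_rep x $ i - r i\<bar> = dist (x $ i) (y $ i)"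
        by metis
      have "dist (\<chi> i. r i) (torus_rep x) = dist y x"
        by (simp add: dist_vec_def r(2)[symmetric] dist_commute[of "y $ _"] dist_real_def abs_minus_commute)
      then have "dist (f (torus_proj (\<chi> i. r i))) (f x) < e"
        using d(2)[of "\<chi> i. r i"] that by simp
      then show ?thesis
        by (simp add: torus_proj_def r(1)[symmetric])
    qed
    then show "\<exists>d>0. \<forall>x'\<in>UNIV. dist x' x < d \<longrightarrow> dist (f x') (f x) < e"
      using d(1) by blast
  qed
qed

section \<open>Jordan decomposition\<close>

definition signed_additive :: "('a::topological_space set \<Rightarrow> real) \<Rightarrow> bool"
  where "signed_additive \<nu> \<longleftrightarrow> (\<forall>F::nat \<Rightarrow> 'a set. range F \<subseteq> sets borel \<longrightarrow> disjoint_family F \<longrightarrow>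
         (\<lambda>n. \<nu> (F n)) sums \<nu> (\<Union>n. F n))"

lemma signed_additiveD:
  "signed_additive \<nu> \<Longrightarrow> (\<And>n. F n \<in> sets borel) \<Longrightarrow> disjoint_family F \<Longrightarrow>
    (\<lambda>n::nat. \<nu> (F n)) sums \<nu> (\<Union>n. F n)"
  unfolding signed_additive_def by blast

lemma signed_additive_uminus: "signed_additive \<nu> \<Longrightarrow> signed_additive (\<lambda>A. - \<nu> A)"
  unfolding signed_additive_def by (auto intro: sums_minus)

lemma signed_empty:
  assumes "signed_additive \<nu>"
  shows "\<nu> {} = 0"
proof -
  have "(\<lambda>n::nat. \<nu> {}) sums \<nu> (\<Union>n::nat. {})"
    using assms by (intro signed_additiveD) (auto simp: disjoint_family_on_def)
  then show ?thesis
    using sums_summable summable_const_iff by blast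
qed

lemma signed_Un:
  assumes "signed_additive \<nu>" "A \<in> sets borel" "B \<in> sets borel" "A \<inter> B = {}"
  shows "\<nu> (A \<union> B) = \<nu> A + \<nu> B"
proof -
  have "(\<lambda>n. \<nu> (binaryset A B n)) sums \<nu> (\<Union>n. binaryset A B n)"
    using assms by (intro signed_additiveD) (auto simp: disjoint_family_on_def binaryset_def)
  moreover have "(\<lambda>n. \<nu> (binaryset A B n)) sums (\<nu> A + \<nu> B)"
    using binaryset_sums[of \<nu> A B] signed_empty[OF assms(1)] by simp
  ultimately show ?thesis
    by (metis UN_binaryset_eq sums_unique2)
qed

lemma signed_Diff:
  assumes "signed_additive \<nu>" "A \<in> sets borel" "B \<in> sets borel" "B \<subseteq> A"
  shows "\<nu> (A - B) = \<nu> A - \<nu> B"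
  using signed_Un[of \<nu> "A - B" B] assms by (simp add: Un_absorb2 Diff_Int_distrib2)

text \<open>If \<open>\<nu>\<close> were unbounded, one could split off sets of value at least 1 in modulus again and again,
  always keeping a set on whose subsets the values are unbounded. The series over the sets that were
  split off would diverge.\<close>

lemma signed_bounded:
  fixes \<nu> :: "'a::topological_space set \<Rightarrow> real"
  assumes \<nu>: "signed_additive \<nu>"
  shows "\<exists>C. \<forall>B\<in>sets borel. \<bar>\<nu> B\<bar> \<le> C"
proof (rule ccontr)
  define bad where "bad A \<longleftrightarrow> A \<in> sets borel \<and> (\<forall>C. \<exists>B\<in>sets borel. B \<subseteq> A \<and> \<bar>\<nu> B\<bar> > C)" for A
  assume "\<not> ?thesis"
  then have bad_UNIV: "bad UNIV"
    by (auto simp: bad_def not_le)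
  have step: "\<exists>A'. bad A' \<and> A' \<subseteq> A \<and> 1 \<le> \<bar>\<nu> (A - A')\<bar>" if A: "bad A" for A
  proof -
    obtain B where B: "B \<in> sets borel" "B \<subseteq> A" "\<bar>\<nu> B\<bar> > \<bar>\<nu> A\<bar> + 1"
      using A unfolding bad_def by blast
    have A_borel: "A \<in> sets borel"
      using A unfolding bad_def by blast
    have diff: "\<nu> (A - B) = \<nu> A - \<nu> B"
      using signed_Diff[OF \<nu> A_borel B(1,2)] .
    show ?thesis
    proof (cases "bad B")
      case True
      then show ?thesis
        using B diff by (intro exI[of _ B]) auto
    next
      case False
      then obtain C where C: "\<And>D. D \<in> sets borel \<Longrightarrow> D \<subseteq> B \<Longrightarrow> \<bar>\<nu> D\<bar> \<le> C"
        using B(1) unfolding bad_def by (meson not_le)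
      have "\<exists>D\<in>sets borel. D \<subseteq> A - B \<and> \<bar>\<nu> D\<bar> > C'" for C'
      proof -
        obtain D where D: "D \<in> sets borel" "D \<subseteq> A" "\<bar>\<nu> D\<bar> > C + C'"
          using A unfolding bad_def by blast
        have "\<nu> (D - B) = \<nu> D - \<nu> (D \<inter> B)"
          using signed_Diff[OF \<nu> D(1), of "D \<inter> B"] D(1) B(1) by (simp add: Diff_Int)
        moreover have "\<bar>\<nu> (D \<inter> B)\<bar> \<le> C"
          using C[of "D \<inter> B"] D(1) B(1) by auto
        ultimately show ?thesis
          using D B(1) by (intro bexI[of _ "D - B"]) auto
      qed
      then have "bad (A - B)"
        using A_borel B(1) unfolding bad_def by blast
      moreover have "A - (A - B) = B"
        using B(2) by blast
      ultimately show ?thesis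
        using B(3) by (intro exI[of _ "A - B"]) auto
    qed
  qed
  obtain A :: "nat \<Rightarrow> 'a set"
    where A: "\<And>n. bad (A n) \<and> A (Suc n) \<subseteq> A n \<and> 1 \<le> \<bar>\<nu> (A n - A (Suc n))\<bar>"
    using dependent_nat_choice[of "\<lambda>_. bad" "\<lambda>_ A A'. A' \<subseteq> A \<and> 1 \<le> \<bar>\<nu> (A - A')\<bar>"] bad_UNIV step
    by metis
  have dec: "A m \<subseteq> A n" if "n \<le> m" for n m
    using lift_Suc_antimono_le[of A n m] A that by blast
  have "disjoint_family (\<lambda>n. A n - A (Suc n))"
    unfolding disjoint_family_on_def
  proof (intro ballI impI)
    fix m n :: nat assume "m \<noteq> n"
    then show "(A m - A (Suc m)) \<inter> (A n - A (Suc n)) = {}"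
      using dec[of "Suc m" n] dec[of "Suc n" m] by (cases m n rule: linorder_cases) auto
  qed
  then have "(\<lambda>n. \<nu> (A n - A (Suc n))) sums \<nu> (\<Union>n. A n - A (Suc n))"
    using A by (intro signed_additiveD[OF \<nu>]) (auto simp: bad_def)
  then have "(\<lambda>n. \<nu> (A n - A (Suc n))) \<longlonglongrightarrow> 0"
    using summable_LIMSEQ_zero sums_summable by blast
  then obtain n where "\<bar>\<nu> (A n - A (Suc n))\<bar> < 1"
    using LIMSEQ_D[of _ 0 1] by fastforce
  then show False
    using A[of n] by simp
qed

text \<open>The supremum in \<^const>\<open>jordan_pos\<close>, taken in the reals, where the estimates can use
  subtraction. It is a genuine supremum by boundedness.\<close>

definition upper_variation :: "('a::topological_space set \<Rightarrow> real) \<Rightarrow> 'a set \<Rightarrow> real"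
  where "upper_variation \<nu> A = (SUP B\<in>{B \<in> sets borel. B \<subseteq> A}. \<nu> B)"

lemma bdd_above_signed: "signed_additive \<nu> \<Longrightarrow> bdd_above (\<nu> ` {B \<in> sets borel. B \<subseteq> A})"
  using signed_bounded[of \<nu>] by (fastforce simp: bdd_above_def dest: abs_le_D1)

lemma upper_variation_upper:
  "signed_additive \<nu> \<Longrightarrow> B \<in> sets borel \<Longrightarrow> B \<subseteq> A \<Longrightarrow> \<nu> B \<le> upper_variation \<nu> A"
  unfolding upper_variation_def by (rule cSUP_upper[OF _ bdd_above_signed]) auto

lemma upper_variation_least:
  "(\<And>B. B \<in> sets borel \<Longrightarrow> B \<subseteq> A \<Longrightarrow> \<nu> B \<le> c) \<Longrightarrow> upper_variation \<nu> A \<le> c"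
  unfolding upper_variation_def by (rule cSUP_least) auto

lemma upper_variation_nonneg: "signed_additive \<nu> \<Longrightarrow> 0 \<le> upper_variation \<nu> A"
  using upper_variation_upper[of \<nu> "{}" A] signed_empty[of \<nu>] by simp

lemma upper_variation_empty: "signed_additive \<nu> \<Longrightarrow> upper_variation \<nu> {} = 0"
  by (simp add: upper_variation_def signed_empty cong: conj_cong)

lemma upper_variation_Un_ge:
  assumes "signed_additive \<nu>" "A \<inter> B = {}"
  shows "upper_variation \<nu> A + upper_variation \<nu> B \<le> upper_variation \<nu> (A \<union> B)"
proof -
  have "upper_variation \<nu> A \<le> upper_variation \<nu> (A \<union> B) - \<nu> B'"
    if B': "B' \<in> sets borel" "B' \<subseteq> B" for B'
  proof (rule upper_variation_least)
    fix A' assume "A' \<in> sets borel" "A' \<subseteq> A"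
    then have "\<nu> A' + \<nu> B' = \<nu> (A' \<union> B')" "\<nu> (A' \<union> B') \<le> upper_variation \<nu> (A \<union> B)"
      using assms B' by (auto intro!: signed_Un[symmetric] upper_variation_upper)
    then show "\<nu> A' \<le> upper_variation \<nu> (A \<union> B) - \<nu> B'"
      by simp
  qed
  then have "upper_variation \<nu> B \<le> upper_variation \<nu> (A \<union> B) - upper_variation \<nu> A"
    by (intro upper_variation_least) (simp add: le_diff_eq add.commute)
  then show ?thesis
    by simp
qed

lemma upper_variation_mono:
  "signed_additive \<nu> \<Longrightarrow> A \<subseteq> B \<Longrightarrow> upper_variation \<nu> A \<le> upper_variation \<nu> B"
  by (rule upper_variation_least) (auto intro: upper_variation_upper)

text \<open>One inequality follows from superadditivity on finite unions; for the other, cut a subset of the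
  union into its parts in the sets \<open>F n\<close> and use countable additivity of \<open>\<nu>\<close>.\<close>

lemma upper_variation_sums:
  fixes F :: "nat \<Rightarrow> 'a::topological_space set"
  assumes \<nu>: "signed_additive \<nu>" and F: "\<And>n. F n \<in> sets borel" "disjoint_family F"
  shows "(\<lambda>n. upper_variation \<nu> (F n)) sums upper_variation \<nu> (\<Union>n. F n)"
proof -
  have le: "(\<Sum>n<N. upper_variation \<nu> (F n)) \<le> upper_variation \<nu> (\<Union>n<N. F n)" for N
  proof (induction N)
    case (Suc N)
    have "F n \<inter> F N = {}" if "n < N" for n
      using F(2) that by (intro disjoint_family_onD[of F UNIV]) auto
    then have "(\<Union>n<N. F n) \<inter> F N = {}"
      by blast
    from upper_variation_Un_ge[OF \<nu> this] Suc
    have "(\<Sum>n<Suc N. upper_variation \<nu> (F n)) \<le> upper_variation \<nu> ((\<Union>n<N. F n) \<union> F N)"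
      by simp
    then show ?case
      by (simp add: lessThan_Suc Un_commute)
  qed (simp add: upper_variation_empty[OF \<nu>])
  have le': "(\<Sum>n<N. upper_variation \<nu> (F n)) \<le> upper_variation \<nu> (\<Union>n. F n)" for N
    by (rule order_trans[OF le upper_variation_mono[OF \<nu>]]) auto
  have sm: "summable (\<lambda>n. upper_variation \<nu> (F n))"
    by (rule summableI_nonneg_bounded[OF upper_variation_nonneg[OF \<nu>] le'])
  have "upper_variation \<nu> (\<Union>n. F n) \<le> (\<Sum>n. upper_variation \<nu> (F n))"
  proof (rule upper_variation_least)
    fix B assume B: "B \<in> sets borel" "B \<subseteq> (\<Union>n. F n)"
    have "(\<lambda>n. \<nu> (B \<inter> F n)) sums \<nu> (\<Union>n. B \<inter> F n)"
      using F B by (intro signed_additiveD[OF \<nu>]) (auto simp: disjoint_family_on_def)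
    moreover have "(\<Union>n. B \<inter> F n) = B"
      using B(2) by blast
    ultimately have s: "(\<lambda>n. \<nu> (B \<inter> F n)) sums \<nu> B"
      by simp
    show "\<nu> B \<le> (\<Sum>n. upper_variation \<nu> (F n))"
      using F B by (intro sums_le[OF _ s summable_sums[OF sm]] upper_variation_upper[OF \<nu>]) auto
  qed
  moreover have "(\<Sum>n. upper_variation \<nu> (F n)) \<le> upper_variation \<nu> (\<Union>n. F n)"
    by (rule suminf_le_const[OF sm le'])
  ultimately show ?thesis
    using sm by (simp add: sums_iff)
qed

lemma SUP_ennreal_signed:
  assumes "signed_additive \<nu>"
  shows "(SUP B\<in>{B \<in> sets borel. B \<subseteq> A}. ennreal (\<nu> B)) = ennreal (upper_variation \<nu> A)"
proof (rule antisym)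
  show "(SUP B\<in>{B \<in> sets borel. B \<subseteq> A}. ennreal (\<nu> B)) \<le> ennreal (upper_variation \<nu> A)"
    by (rule SUP_least) (auto intro!: ennreal_leI upper_variation_upper[OF assms])
  then obtain r where r: "(SUP B\<in>{B \<in> sets borel. B \<subseteq> A}. ennreal (\<nu> B)) = ennreal r" "0 \<le> r"
    by (cases "SUP B\<in>{B \<in> sets borel. B \<subseteq> A}. ennreal (\<nu> B)" rule: ennreal_cases)
      (auto simp: top_unique)
  have "\<nu> B \<le> r" if "B \<in> sets borel" "B \<subseteq> A" for B
  proof -
    have "ennreal (\<nu> B) \<le> (SUP B\<in>{B \<in> sets borel. B \<subseteq> A}. ennreal (\<nu> B))"
      using SUP_upper[of B "{B \<in> sets borel. B \<subseteq> A}" "\<lambda>B. ennreal (\<nu> B)"] that by blast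
    then have "ennreal (\<nu> B) \<le> ennreal r"
      by (simp only: r(1))
    then show ?thesis
      by (simp only: ennreal_le_iff[OF r(2)])
  qed
  then show "ennreal (upper_variation \<nu> A) \<le> (SUP B\<in>{B \<in> sets borel. B \<subseteq> A}. ennreal (\<nu> B))"
    unfolding r(1) by (intro ennreal_leI upper_variation_least)
qed

lemma space_jordan_pos [simp]: "space (jordan_pos \<nu>) = UNIV"
  unfolding jordan_pos_def by (rule space_measure_of) simp

lemma sets_jordan_pos [simp, measurable_cong]: "sets (jordan_pos \<nu>) = sets borel"
  using sets.sets_measure_of_eq[of borel] unfolding jordan_pos_def by (simp add: space_borel)

lemma emeasure_jordan_pos:
  assumes \<nu>: "signed_additive \<nu>" and "A \<in> sets borel"
  shows "emeasure (jordan_pos \<nu>) A = ennreal (upper_variation \<nu> A)"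
proof -
  have "emeasure (jordan_pos \<nu>) A = (SUP B\<in>{B \<in> sets borel. B \<subseteq> A}. ennreal (\<nu> B))"
  proof (rule emeasure_measure_of)
    show "jordan_pos \<nu> = measure_of UNIV (sets borel) (\<lambda>A. SUP B\<in>{B \<in> sets borel. B \<subseteq> A}. ennreal (\<nu> B))"
      by (rule jordan_pos_def)
    show "positive (sets (jordan_pos \<nu>)) (\<lambda>A. SUP B\<in>{B \<in> sets borel. B \<subseteq> A}. ennreal (\<nu> B))"
      by (simp add: positive_def SUP_ennreal_signed[OF \<nu>] upper_variation_empty[OF \<nu>])
    show "countably_additive (sets (jordan_pos \<nu>)) (\<lambda>A. SUP B\<in>{B \<in> sets borel. B \<subseteq> A}. ennreal (\<nu> B))"
      unfolding countably_additive_def SUP_ennreal_signed[OF \<nu>]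
    proof (intro allI impI)
      fix F :: "nat \<Rightarrow> 'a set"
      assume "range F \<subseteq> sets (jordan_pos \<nu>)" "disjoint_family F"
      then have "(\<lambda>n. upper_variation \<nu> (F n)) sums upper_variation \<nu> (\<Union>n. F n)"
        by (intro upper_variation_sums[OF \<nu>]) auto
      then show "(\<Sum>n. ennreal (upper_variation \<nu> (F n))) = ennreal (upper_variation \<nu> (\<Union> (range F)))"
        by (simp add: suminf_ennreal2 upper_variation_nonneg[OF \<nu>] sums_iff)
    qed
  qed (use assms(2) in auto)
  then show ?thesis
    by (simp add: SUP_ennreal_signed[OF \<nu>])
qed

lemma finite_measure_jordan_pos: "signed_additive \<nu> \<Longrightarrow> finite_measure (jordan_pos \<nu>)"
  by (rule finite_measureI) (simp add: emeasure_jordan_pos)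

lemma measure_jordan_pos:
  "signed_additive \<nu> \<Longrightarrow> A \<in> sets borel \<Longrightarrow> measure (jordan_pos \<nu>) A = upper_variation \<nu> A"
  by (simp add: measure_def emeasure_jordan_pos upper_variation_nonneg)

text \<open>The Jordan decomposition: passing from \<open>B \<subseteq> A\<close> to its complement \<open>A - B\<close> exchanges the
  two variations, up to the constant \<open>\<nu> A\<close>.\<close>

lemma jordan_decomposition:
  assumes \<nu>: "signed_additive \<nu>" and A: "A \<in> sets borel"
  shows "measure (jordan_pos \<nu>) A - measure (jordan_pos (\<lambda>A. - \<nu> A)) A = \<nu> A"
proof -
  have le: "upper_variation \<nu> A \<le> \<nu> A + upper_variation (\<lambda>A. - \<nu> A) A" if \<nu>: "signed_additive \<nu>" for \<nu>
  proof (rule upper_variation_least)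
    fix B assume B: "B \<in> sets borel" "B \<subseteq> A"
    have "- \<nu> (A - B) \<le> upper_variation (\<lambda>A. - \<nu> A) A"
      using B A by (intro upper_variation_upper signed_additive_uminus \<nu>) auto
    then show "\<nu> B \<le> \<nu> A + upper_variation (\<lambda>A. - \<nu> A) A"
      using signed_Diff[OF \<nu> A B] by simp
  qed
  from le[OF \<nu>] le[OF signed_additive_uminus[OF \<nu>]] show ?thesis
    using measure_jordan_pos[OF \<nu> A] measure_jordan_pos[OF signed_additive_uminus[OF \<nu>] A] by simp
qed

section \<open>Integrals\<close>

text \<open>The equality of two differences of measures is written with sums, because extended nonnegative
  numbers do not admit cancellation.\<close>

lemma nn_integral_add_measures_cong:
  fixes f :: "'a::topological_space \<Rightarrow> ennreal"
  assumes sets: "sets A = sets borel" "sets B = sets borel" "sets C = sets borel" "sets D = sets borel"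
    and eq: "\<And>S. S \<in> sets borel \<Longrightarrow> emeasure A S + emeasure B S = emeasure C S + emeasure D S"
    and f: "f \<in> borel_measurable borel"
  shows "nn_integral A f + nn_integral B f = nn_integral C f + nn_integral D f"
proof -
  note [measurable_cong] = sets
  show ?thesis
    using f
  proof (induction f rule: borel_measurable_induct)
    case (cong f g)
    then show ?case by (metis UNIV_I space_borel ext)
  next
    case (set S)
    then show ?case
      using eq[of S] sets by simp
  next
    case (mult u c)
    note [measurable] = mult(2)
    show ?case
      using mult(4) by (simp add: nn_integral_cmult flip: distrib_left)
  next
    case (add u v)
    note [measurable] = add(1,3)
    show ?case
      using add by (simp add: nn_integral_add) (metis add.assoc add.commute)
  next
    case (seq U)
    note [measurable] = seq(1)
    have inc: "incseq (\<lambda>i. nn_integral M (U i))" if "sets M = sets borel" for M :: "'a measure"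
      using seq(3) by (auto simp: incseq_def le_fun_def intro!: nn_integral_mono)
    have "nn_integral M (SUP i. U i) = (SUP i. nn_integral M (U i))" if "sets M = sets borel" for M
    proof -
      note [measurable_cong] = that
      show ?thesis
        unfolding SUP_apply[abs_def] by (rule nn_integral_monotone_convergence_SUP[OF seq(3)]) measurable
    qed
    then have sup: "nn_integral M (SUP i. U i) = (SUP i. nn_integral M (U i))"
      if "M \<in> {A, B, C, D}" for M
      using that sets by blast
    have "(SUP i. nn_integral A (U i)) + (SUP i. nn_integral B (U i))
        = (SUP i. nn_integral C (U i)) + (SUP i. nn_integral D (U i))"
      using seq.IH sets by (simp add: inc flip: ennreal_SUP_add)
    then show ?case
      by (simp only: sup insert_iff simp_thms)
  qed
qed

text \<open>Adding the constant \<open>K\<close> makes the integrand nonnegative. The lemma is for weak limits of Jordan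
  parts, whose difference is in general not a Jordan decomposition of the limit.\<close>

lemma integral_diff_measures_cong:
  fixes f :: "'a::topological_space \<Rightarrow> real"
  assumes fin: "finite_measure A" "finite_measure B" "finite_measure C" "finite_measure D"
    and sets: "sets A = sets borel" "sets B = sets borel" "sets C = sets borel" "sets D = sets borel"
    and eq: "\<And>S. S \<in> sets borel \<Longrightarrow> measure A S - measure B S = measure C S - measure D S"
    and f: "f \<in> borel_measurable borel" "\<And>x. \<bar>f x\<bar> \<le> K"
  shows "integral\<^sup>L A f - integral\<^sup>L B f = integral\<^sup>L C f - integral\<^sup>L D f"
proof -
  have eq': "emeasure A S + emeasure D S = emeasure C S + emeasure B S" if "S \<in> sets borel" for S
    using eq[OF that] fin
    by (simp add: finite_measure.emeasure_eq_measure flip: ennreal_plus)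
  have int: "integrable M f \<and> ennreal (integral\<^sup>L M f + K * measure M (space M)) = nn_integral M (\<lambda>x. ennreal (f x + K))
      \<and> 0 \<le> integral\<^sup>L M f + K * measure M (space M)"
    if M: "finite_measure M" "sets M = sets borel" for M
  proof -
    note [measurable_cong] = M(2)
    note [measurable] = f(1)
    interpret finite_measure M by fact
    have i: "integrable M f"
      using f(2) by (intro integrable_const_bound[of _ K]) auto
    have nn: "0 \<le> f x + K" for x
      using f(2)[of x] by simp
    have "nn_integral M (\<lambda>x. ennreal (f x + K)) = ennreal (integral\<^sup>L M (\<lambda>x. f x + K))"
      using i nn by (intro nn_integral_eq_integral) auto
    moreover have "integral\<^sup>L M (\<lambda>x. f x + K) = integral\<^sup>L M f + K * measure M (space M)"
      using i by simp
    moreover have "0 \<le> integral\<^sup>L M (\<lambda>x. f x + K)"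
      by (rule Bochner_Integration.integral_nonneg) (rule nn)
    ultimately show ?thesis
      using i by (simp add: mult.commute)
  qed
  have meas: "(\<lambda>x. ennreal (f x + K)) \<in> borel_measurable borel"
    using f(1) by measurable
  note I = int[OF fin(1) sets(1)] int[OF fin(2) sets(2)] int[OF fin(3) sets(3)] int[OF fin(4) sets(4)]
  have sp: "space A = UNIV" "space B = UNIV" "space C = UNIV" "space D = UNIV"
    using sets[THEN sets_eq_imp_space_eq] by simp_all
  have "ennreal ((integral\<^sup>L A f + K * measure A UNIV) + (integral\<^sup>L D f + K * measure D UNIV))
      = ennreal ((integral\<^sup>L C f + K * measure C UNIV) + (integral\<^sup>L B f + K * measure B UNIV))"
    using nn_integral_add_measures_cong[OF sets(1,4,3,2) eq' meas] I unfolding sp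
    by (simp del: ennreal_inj)
  then have "(integral\<^sup>L A f + K * measure A UNIV) + (integral\<^sup>L D f + K * measure D UNIV)
      = (integral\<^sup>L C f + K * measure C UNIV) + (integral\<^sup>L B f + K * measure B UNIV)"
    using I unfolding sp by (subst (asm) ennreal_inj) auto
  moreover have "K * measure A UNIV - K * measure B UNIV = K * measure C UNIV - K * measure D UNIV"
    using eq[of UNIV] by (simp flip: right_diff_distrib)
  ultimately show ?thesis
    by linarith
qed

section \<open>Total variation\<close>

text \<open>These functions are integrable against every finite Borel measure, which is all the
  integrability that the pairings require.\<close>

definition bounded_borel :: "('a::topological_space \<Rightarrow> 'b::real_normed_vector) \<Rightarrow> bool"
  where "bounded_borel f \<longleftrightarrow> f \<in> borel_measurable borel \<and> bounded (range f)"

lemma bounded_borelI: "continuous_on UNIV f \<Longrightarrow> (\<And>x. norm (f x) \<le> B) \<Longrightarrow> bounded_borel f"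
  unfolding bounded_borel_def
  by (auto intro!: borel_measurable_continuous_onI boundedI)

lemma bounded_borel_bounded_linear:
  "bounded_linear L \<Longrightarrow> bounded_borel f \<Longrightarrow> bounded_borel (\<lambda>x. L (f x))"
  unfolding bounded_borel_def
  using bounded_linear_image[of "range f" L]
  by (auto simp: image_image intro: borel_measurable_continuous_on[OF linear_continuous_on])

lemma integrable_bounded_borel:
  fixes f :: "'a::topological_space \<Rightarrow> 'b::{banach, second_countable_topology}"
  assumes "finite_measure M" "sets M = sets borel" "bounded_borel f"
  shows "integrable M f"
proof -
  note [measurable_cong] = assms(2)
  obtain B where "\<And>x. norm (f x) \<le> B"
    using assms(3) unfolding bounded_borel_def bounded_iff by auto
  moreover have [measurable]: "f \<in> borel_measurable borel"
    using assms(3) unfolding bounded_borel_def by blast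
  ultimately show ?thesis
    by (intro finite_measure.integrable_const_bound[OF assms(1), of _ B]) auto
qed

lemma norm_integral_le_measure:
  fixes f :: "'a::topological_space \<Rightarrow> 'b::{banach, second_countable_topology}"
  assumes "finite_measure M" "sets M = sets borel" "f \<in> borel_measurable borel" "\<And>x. norm (f x) \<le> B"
  shows "norm (integral\<^sup>L M f) \<le> B * measure M UNIV"
proof -
  have sp: "space M = UNIV"
    using sets_eq_imp_space_eq[OF assms(2)] by simp
  have "bounded_borel f"
    using assms(3,4) unfolding bounded_borel_def by (auto intro!: boundedI)
  then have i: "integrable M (\<lambda>x. norm (f x))"
    by (intro integrable_norm integrable_bounded_borel[OF assms(1,2)])
  have c: "integrable M (\<lambda>x. B)"
    by (simp add: finite_measure.integrable_const[OF assms(1)])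
  have "norm (integral\<^sup>L M f) \<le> (\<integral>x. norm (f x) \<partial>M)"
    by (rule integral_norm_bound)
  also have "\<dots> \<le> (\<integral>x. B \<partial>M)"
    by (rule integral_mono[OF i c]) (rule assms(4))
  also have "\<dots> = B * measure M UNIV"
    by (simp add: sp)
  finally show ?thesis .
qed

lemma signed_additive_cmeasure:
  "signed_additive (\<lambda>A. Re (cm_value \<mu> A))" "signed_additive (\<lambda>A. - Re (cm_value \<mu> A))"
  "signed_additive (\<lambda>A. Im (cm_value \<mu> A))" "signed_additive (\<lambda>A. - Im (cm_value \<mu> A))"
proof -
  have "signed_additive (\<lambda>A. Re (cm_value \<mu> A))" "signed_additive (\<lambda>A. Im (cm_value \<mu> A))"
    using cm_value[of \<mu>] unfolding signed_additive_def by (auto simp: sums_complex_iff)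
  then show "signed_additive (\<lambda>A. Re (cm_value \<mu> A))" "signed_additive (\<lambda>A. - Re (cm_value \<mu> A))"
    "signed_additive (\<lambda>A. Im (cm_value \<mu> A))" "signed_additive (\<lambda>A. - Im (cm_value \<mu> A))"
    by (auto intro: signed_additive_uminus)
qed

lemma integrable_jordan_pos:
  fixes f :: "'a::topological_space \<Rightarrow> 'b::{banach, second_countable_topology}"
  assumes "signed_additive \<nu>" "bounded_borel f"
  shows "integrable (jordan_pos \<nu>) f"
  by (intro integrable_bounded_borel finite_measure_jordan_pos assms sets_jordan_pos)

lemma cm_integral_bounded_linear:
  fixes f :: "'a::topological_space \<Rightarrow> 'h::separable_complex_hilbert"
    and L :: "'h \<Rightarrow> 'k::separable_complex_hilbert"
  assumes L: "bounded_linear L" "\<And>x. L (\<i> *\<^sub>C x) = \<i> *\<^sub>C L x" and f: "bounded_borel f"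
  shows "cm_integral \<mu> (\<lambda>x. L (f x)) = L (cm_integral \<mu> f)"
proof -
  interpret bounded_linear L by fact
  have "(\<integral>x. L (f x) \<partial>jordan_pos \<nu>) = L (\<integral>x. f x \<partial>jordan_pos \<nu>)" if "signed_additive \<nu>" for \<nu>
    by (rule integral_bounded_linear[OF L(1) integrable_jordan_pos[OF that f]])
  note I = signed_additive_cmeasure[of \<mu>, THEN this]
  show ?thesis
    unfolding cm_integral_def I by (simp add: add diff L(2))
qed

lemma cm_integral_cinner:
  fixes f :: "'a::topological_space \<Rightarrow> 'h::separable_complex_hilbert"
  assumes "bounded_borel f"
  shows "cm_integral \<mu> (\<lambda>x. cinner (f x) v) = cinner (cm_integral \<mu> f) v"
  by (rule cm_integral_bounded_linear[OF bounded_linear_cinner_left _ assms])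
    (simp add: cinner_scaleC_left scaleC_complex_def)

lemma cm_integral_cmult:
  fixes f :: "'a::topological_space \<Rightarrow> complex"
  assumes "bounded_borel f"
  shows "cm_integral \<mu> (\<lambda>x. c * f x) = c * cm_integral \<mu> f"
  by (rule cm_integral_bounded_linear[OF bounded_linear_mult_right _ assms])
    (simp add: scaleC_complex_def)

lemma cm_integral_diff:
  fixes f g :: "'a::topological_space \<Rightarrow> 'h::separable_complex_hilbert"
  assumes f: "bounded_borel f" and g: "bounded_borel g"
  shows "cm_integral \<mu> (\<lambda>x. f x - g x) = cm_integral \<mu> f - cm_integral \<mu> g"
proof -
  have "(\<integral>x. f x - g x \<partial>jordan_pos \<nu>) = (\<integral>x. f x \<partial>jordan_pos \<nu>) - (\<integral>x. g x \<partial>jordan_pos \<nu>)"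
    if "signed_additive \<nu>" for \<nu>
    using integrable_jordan_pos[OF that f] integrable_jordan_pos[OF that g] by simp
  note I = signed_additive_cmeasure[of \<mu>, THEN this]
  interpret bounded_linear "\<lambda>x::'h. \<i> *\<^sub>C x"
    by (rule bounded_linear_scaleC_right)
  show ?thesis
    unfolding cm_integral_def I by (simp add: diff scaleC_add_right algebra_simps)
qed

definition jordan_mass :: "'a::topological_space cmeasure \<Rightarrow> real"
  where "jordan_mass \<mu> =
    measure (jordan_pos (\<lambda>A. Re (cm_value \<mu> A))) UNIV + measure (jordan_pos (\<lambda>A. - Re (cm_value \<mu> A))) UNIV
    + measure (jordan_pos (\<lambda>A. Im (cm_value \<mu> A))) UNIV + measure (jordan_pos (\<lambda>A. - Im (cm_value \<mu> A))) UNIV"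

lemma norm_cm_integral_le_jordan_mass:
  fixes f :: "'a::topological_space \<Rightarrow> 'h::separable_complex_hilbert"
  assumes f: "f \<in> borel_measurable borel" "\<And>x. norm (f x) \<le> B"
  shows "norm (cm_integral \<mu> f) \<le> B * jordan_mass \<mu>"
proof -
  have "norm (integral\<^sup>L (jordan_pos \<nu>) f) \<le> B * measure (jordan_pos \<nu>) UNIV" if "signed_additive \<nu>" for \<nu>
    by (intro norm_integral_le_measure finite_measure_jordan_pos that sets_jordan_pos f)
  note I = signed_additive_cmeasure[of \<mu>, THEN this]
  have t: "norm ((a - b) + \<i> *\<^sub>C (c - d)) \<le> norm a + norm b + norm c + norm d" for a b c d :: 'h
    using norm_triangle_ineq[of "a - b" "\<i> *\<^sub>C (c - d)"] norm_triangle_ineq4[of a b]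
      norm_triangle_ineq4[of c d] by (simp add: norm_scaleC)
  show ?thesis
    unfolding cm_integral_def jordan_mass_def distrib_left
    by (rule order_trans[OF t]) (intro add_mono I)
qed

text \<open>Real suprema are meaningful for bounded sets only; here the bound comes from the finiteness of
  the Jordan parts.\<close>

lemma bdd_above_total_variation:
  "bdd_above ((\<lambda>\<eta>. Re (cm_integral \<mu> (\<lambda>x. cnj (\<eta> x)))) `
     {\<eta>. continuous_on UNIV \<eta> \<and> (\<forall>x. norm (\<eta> x) \<le> 1)})"
proof (rule bdd_aboveI2)
  fix \<eta> :: "'a \<Rightarrow> complex" assume "\<eta> \<in> {\<eta>. continuous_on UNIV \<eta> \<and> (\<forall>x. norm (\<eta> x) \<le> 1)}"
  then have "norm (cm_integral \<mu> (\<lambda>x. cnj (\<eta> x))) \<le> 1 * jordan_mass \<mu>"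
    by (intro norm_cm_integral_le_jordan_mass)
      (auto intro!: borel_measurable_continuous_onI continuous_intros)
  then show "Re (cm_integral \<mu> (\<lambda>x. cnj (\<eta> x))) \<le> jordan_mass \<mu>"
    using complex_Re_le_cmod order_trans by fastforce
qed

lemma Re_cm_integral_le_total_variation:
  assumes "continuous_on UNIV \<eta>" "\<And>x. norm (\<eta> x) \<le> 1"
  shows "Re (cm_integral \<mu> \<eta>) \<le> total_variation \<mu>"
proof -
  have "Re (cm_integral \<mu> (\<lambda>x. cnj (cnj (\<eta> x)))) \<le> total_variation \<mu>"
    unfolding total_variation_def
    by (rule cSUP_upper[OF _ bdd_above_total_variation]) (auto intro!: continuous_intros assms)
  then show ?thesis
    by simp
qed

lemma total_variation_approx:
  fixes \<mu> :: "'a::topological_space cmeasure"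
  assumes "e > 0"
  obtains \<eta> where "continuous_on UNIV \<eta>" "\<And>x. norm (\<eta> x) \<le> 1"
    "total_variation \<mu> - e < Re (cm_integral \<mu> \<eta>)"
proof -
  let ?S = "{\<eta>::'a \<Rightarrow> complex. continuous_on UNIV \<eta> \<and> (\<forall>x. norm (\<eta> x) \<le> 1)}"
  have "(\<lambda>_. 0) \<in> ?S"
    by simp
  then have "?S \<noteq> {}"
    by blast
  moreover have "total_variation \<mu> - e < (SUP \<eta>\<in>?S. Re (cm_integral \<mu> (\<lambda>x. cnj (\<eta> x))))"
    using assms unfolding total_variation_def by simp
  ultimately obtain \<eta> where "\<eta> \<in> ?S" "total_variation \<mu> - e < Re (cm_integral \<mu> (\<lambda>x. cnj (\<eta> x)))"
    using less_cSUP_iff[OF _ bdd_above_total_variation] by blast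
  then show thesis
    by (intro that[of "\<lambda>x. cnj (\<eta> x)"]) (auto intro!: continuous_intros)
qed

text \<open>Multiplying \<open>\<eta>\<close> by a unimodular constant makes the integral real and nonnegative, so that it is
  bounded by the supremum of the real parts.\<close>

lemma norm_cm_integral_le_scalar:
  fixes \<eta> :: "'a::topological_space \<Rightarrow> complex"
  assumes \<eta>: "continuous_on UNIV \<eta>" "\<And>x. norm (\<eta> x) \<le> B" and B: "B > 0"
  shows "norm (cm_integral \<mu> \<eta>) \<le> B * total_variation \<mu>"
proof -
  define c where "c = cm_integral \<mu> \<eta>"
  define u where "u = cnj (sgn c) / of_real B"
  have "norm (sgn c) \<le> 1"
    by (simp add: norm_sgn)
  then have "norm u * norm (\<eta> x) \<le> (1 / B) * B" for x
    using B \<eta>(2)[of x] unfolding u_def by (intro mult_mono) (auto simp: norm_divide divide_right_mono)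
  then have "Re (cm_integral \<mu> (\<lambda>x. u * \<eta> x)) \<le> total_variation \<mu>"
    using B by (intro Re_cm_integral_le_total_variation) (auto intro!: continuous_intros \<eta> simp: norm_mult)
  moreover have "cm_integral \<mu> (\<lambda>x. u * \<eta> x) = u * c"
    unfolding c_def by (rule cm_integral_cmult[OF bounded_borelI[OF \<eta>]])
  moreover have "u * c = of_real (norm c / B)"
  proof (cases "c = 0")
    case False
    have "cnj (sgn c) * sgn c = 1"
      using complex_norm_square[of "sgn c"] False by (simp add: norm_sgn mult.commute)
    then have "cnj (sgn c) * (of_real (norm c) * sgn c) = of_real (norm c)"
      by (simp add: mult.left_commute)
    moreover have "of_real (norm c) * sgn c = c"
      unfolding sgn_div_norm scaleR_conv_of_real using False by simp
    ultimately have "cnj (sgn c) * c = of_real (norm c)"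
      by (simp only:)
    then show ?thesis
      unfolding u_def times_divide_eq_left by simp
  qed simp
  ultimately have "norm c / B \<le> total_variation \<mu>"
    by simp
  then show ?thesis
    using B by (simp add: c_def field_simps)
qed

lemma total_variation_nonneg: "0 \<le> total_variation \<mu>"
proof -
  have "norm (cm_integral \<mu> (\<lambda>_. 0 :: complex)) \<le> 1 * total_variation \<mu>"
    by (rule norm_cm_integral_le_scalar) auto
  from order_trans[OF norm_ge_zero this] show ?thesis
    by simp
qed

text \<open>For vector valued integrands the sharp constant 1 is obtained by pairing with vectors, without
  any polar decomposition of \<open>\<mu>\<close>.\<close>

lemma norm_cm_integral_le:
  fixes \<psi> :: "'a::topological_space \<Rightarrow> 'h::separable_complex_hilbert"
  assumes \<psi>: "continuous_on UNIV \<psi>" "\<And>x. norm (\<psi> x) \<le> B" and B: "B > 0"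
  shows "norm (cm_integral \<mu> \<psi>) \<le> B * total_variation \<mu>"
proof (rule norm_le_of_cinner)
  show "0 \<le> B * total_variation \<mu>"
    using B total_variation_nonneg[of \<mu>] by simp
  fix v :: 'h
  show "cmod (cinner (cm_integral \<mu> \<psi>) v) \<le> B * total_variation \<mu> * norm v"
  proof (cases "v = 0")
    case True
    then show ?thesis
      using cinner_Cauchy_Schwarz[of "cm_integral \<mu> \<psi>" v] by simp
  next
    case False
    have "norm (cinner (\<psi> x) v) \<le> B * norm v" for x
      by (rule order_trans[OF cinner_Cauchy_Schwarz mult_right_mono[OF \<psi>(2) norm_ge_zero]])
    moreover have "continuous_on UNIV (\<lambda>x. cinner (\<psi> x) v)"
      by (rule bounded_linear.continuous_on[OF bounded_linear_cinner_left \<psi>(1)])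
    ultimately have "norm (cm_integral \<mu> (\<lambda>x. cinner (\<psi> x) v)) \<le> (B * norm v) * total_variation \<mu>"
      using B False by (intro norm_cm_integral_le_scalar) auto
    then show ?thesis
      using cm_integral_cinner[OF bounded_borelI[OF \<psi>], of \<mu> v] by (simp add: mult.assoc mult.left_commute mult.commute)
  qed
qed

section \<open>Total variation controls the Jordan parts\<close>

text \<open>The class of sets whose indicator is approximable contains the closed sets, because of the
  functions \<open>1 / (1 + n dist(x, C))\<close>, and it is a sigma-algebra: complements correspond to \<open>1 - g\<close>
  and finite unions to maxima, and countable unions are limits in mean of finite ones.\<close>

lemma continuous_approx_indicator:
  fixes B :: "'a::metric_space set"
  assumes \<M>: "finite \<M>" "\<And>M. M \<in> \<M> \<Longrightarrow> finite_measure M" "\<And>M. M \<in> \<M> \<Longrightarrow> sets M = sets borel"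
    and B: "B \<in> sets borel" and e: "e > 0"
  shows "\<exists>g::'a \<Rightarrow> real. continuous_on UNIV g \<and> (\<forall>x. 0 \<le> g x \<and> g x \<le> 1) \<and>
    (\<forall>M\<in>\<M>. (\<integral>x. \<bar>g x - indicator B x\<bar> \<partial>M) < e)"
proof -
  define ok where "ok S e g \<longleftrightarrow> continuous_on UNIV g \<and> (\<forall>x. 0 \<le> g x \<and> g x \<le> 1) \<and>
    (\<forall>M\<in>\<M>. (\<integral>x. \<bar>g x - indicator S x\<bar> \<partial>M) < e)" for S e and g :: "'a \<Rightarrow> real"
  define P where "P S \<longleftrightarrow> S \<in> sets borel \<and> (\<forall>e>0. \<exists>g. ok S e g)" for S
  have int: "integrable M (\<lambda>x. \<bar>g x - h x\<bar>)"
    if "M \<in> \<M>" "g \<in> borel_measurable borel" "h \<in> borel_measurable borel"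
      "\<And>x. 0 \<le> g x \<and> g x \<le> 1" "\<And>x. 0 \<le> h x \<and> h x \<le> 1" for M and g h :: "'a \<Rightarrow> real"
  proof (intro integrable_bounded_borel \<M> that(1))
    have "\<bar>g x - h x\<bar> \<le> 1" for x
      using that(4)[of x] that(5)[of x] by linarith
    then show "bounded_borel (\<lambda>x. \<bar>g x - h x\<bar>)"
      using that(2,3) unfolding bounded_borel_def by (auto intro!: boundedI[of _ 1])
  qed
  have ok_meas: "g \<in> borel_measurable borel" "0 \<le> g x \<and> g x \<le> 1" if "ok S e g" for S e g x
    using that unfolding ok_def by (auto intro: borel_measurable_continuous_onI)
  have ind: "(indicator S :: 'a \<Rightarrow> real) \<in> borel_measurable borel" if "S \<in> sets borel" for S
    using that by simp
  have sp: "space M = UNIV" if "M \<in> \<M>" for M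
    using sets_eq_imp_space_eq[OF \<M>(3)[OF that]] by simp
  have closed: "P C" if C: "closed C" for C
  proof (cases "C = {}")
    case True
    have "ok C e (\<lambda>_. 0)" if "e > 0" for e
      using that unfolding ok_def True by simp
    then show ?thesis
      unfolding P_def True by blast
  next
    case False
    define g where "g n x = 1 / (1 + real n * infdist x C)" for n x
    have nn: "0 \<le> real n * infdist x C" for n x
      by (simp add: infdist_nonneg)
    have cont: "continuous_on UNIV (g n)" for n
      unfolding g_def using nn[of n] by (intro continuous_intros) (metis add_nonneg_eq_0_iff zero_le_one zero_neq_one)
    have bd: "0 \<le> g n x \<and> g n x \<le> 1" for n x
      using nn[of n x] by (simp add: g_def)
    have lim: "(\<lambda>n. g n x) \<longlonglongrightarrow> indicator C x" for x
    proof (cases "x \<in> C")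
      case True
      then show ?thesis
        by (simp add: g_def)
    next
      case False
      then have "infdist x C > 0"
        using C \<open>C \<noteq> {}\<close> by (simp add: infdist_pos_not_in_closed)
      then have "(\<lambda>n. g n x) \<longlonglongrightarrow> 0"
        unfolding g_def by real_asymp
      then show ?thesis
        using False by simp
    qed
    have "\<forall>\<^sub>F n in sequentially. (\<integral>x. \<bar>g n x - indicator C x\<bar> \<partial>M) < e" if "M \<in> \<M>" "e > 0" for M e
    proof -
      note [measurable_cong] = \<M>(3)[OF that(1)]
      have [measurable]: "g n \<in> borel_measurable borel" for n
        by (rule borel_measurable_continuous_onI[OF cont])
      have [measurable]: "C \<in> sets borel"
        using C by simp
      have "(\<lambda>n. \<integral>x. \<bar>g n x - indicator C x\<bar> \<partial>M) \<longlonglongrightarrow> (\<integral>x. 0 \<partial>M)"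
      proof (rule integral_dominated_convergence[where w = "\<lambda>_. 1"])
        show "integrable M (\<lambda>_. 1 :: real)"
          by (simp add: finite_measure.integrable_const \<M>(2) that(1))
        show "AE x in M. (\<lambda>n. \<bar>g n x - indicator C x\<bar>) \<longlonglongrightarrow> 0"
          using lim by (intro always_eventually allI tendsto_rabs_zero) (simp add: LIM_zero_iff)
        show "AE x in M. norm \<bar>g n x - indicator C x\<bar> \<le> 1" for n
        proof (intro always_eventually allI)
          show "norm \<bar>g n x - indicator C x\<bar> \<le> 1" for x
            using bd[of n x] by (cases "x \<in> C") auto
        qed
      qed measurable
      then show ?thesis
        using that(2) by (simp add: order_tendstoD)
    qed
    then have "\<exists>n. \<forall>M\<in>\<M>. (\<integral>x. \<bar>g n x - indicator C x\<bar> \<partial>M) < e" if "e > 0" for e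
      using that by (intro eventually_happens'[OF sequentially_bot] eventually_ball_finite \<M>(1)) auto
    then have "\<exists>n. ok C e (g n)" if "e > 0" for e
      using that cont bd unfolding ok_def by simp
    then show ?thesis
      unfolding P_def using borel_closed[OF C] by blast
  qed
  have compl: "P (UNIV - S)" if "P S" for S
  proof -
    have "ok (UNIV - S) e (\<lambda>x. 1 - g x)" if "ok S e g" for e g
    proof -
      have "\<bar>1 - g x - indicator (UNIV - S) x\<bar> = \<bar>g x - indicator S x\<bar>" for x
        by (auto simp: indicator_def)
      then show ?thesis
        using that unfolding ok_def by (auto intro!: continuous_intros)
    qed
    then show ?thesis
      using that unfolding P_def by (metis Compl_eq_Diff_UNIV borel_comp)
  qed
  have union: "P (S \<union> T)" if "P S" "P T" for S T
  proof -
    have "\<exists>g. ok (S \<union> T) e g" if "e > 0" for e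
    proof -
      obtain g h where g: "ok S (e/2) g" and h: "ok T (e/2) h"
        using \<open>P S\<close> \<open>P T\<close> \<open>e > 0\<close> unfolding P_def by (meson half_gt_zero)
      have "(\<integral>x. \<bar>max (g x) (h x) - indicator (S \<union> T) x\<bar> \<partial>M) < e" if M: "M \<in> \<M>" for M
      proof -
        have S: "S \<in> sets borel" and T: "T \<in> sets borel"
          using \<open>P S\<close> \<open>P T\<close> unfolding P_def by auto
        have iS: "integrable M (\<lambda>x. \<bar>g x - indicator S x\<bar>)" and iT: "integrable M (\<lambda>x. \<bar>h x - indicator T x\<bar>)"
          using ok_meas[OF g] ok_meas[OF h] ind[OF S] ind[OF T] by (auto intro!: int M)
        have "(\<integral>x. \<bar>max (g x) (h x) - indicator (S \<union> T) x\<bar> \<partial>M)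
            \<le> (\<integral>x. \<bar>g x - indicator S x\<bar> + \<bar>h x - indicator T x\<bar> \<partial>M)"
        proof (rule integral_mono)
          show "integrable M (\<lambda>x. \<bar>max (g x) (h x) - indicator (S \<union> T) x\<bar>)"
            using ok_meas[OF g] ok_meas[OF h] ind[of "S \<union> T"] S T
            by (intro int M) (auto intro: le_max_iff_disj[THEN iffD2])
          show "\<bar>max (g x) (h x) - indicator (S \<union> T) x\<bar> \<le> \<bar>g x - indicator S x\<bar> + \<bar>h x - indicator T x\<bar>" for x
            using ok_meas(2)[OF g, of x] ok_meas(2)[OF h, of x] by (auto simp: indicator_def max_def)
        qed (use iS iT in auto)
        also have "\<dots> = (\<integral>x. \<bar>g x - indicator S x\<bar> \<partial>M) + (\<integral>x. \<bar>h x - indicator T x\<bar> \<partial>M)"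
          using iS iT by simp
        also have "\<dots> < e/2 + e/2"
          using g h M unfolding ok_def by (intro add_strict_mono) auto
        finally show ?thesis by simp
      qed
      then have "ok (S \<union> T) e (\<lambda>x. max (g x) (h x))"
        using g h unfolding ok_def by (auto intro!: continuous_intros simp: le_max_iff_disj)
      then show ?thesis by blast
    qed
    then show ?thesis
      using that unfolding P_def by auto
  qed
  have Union: "P (\<Union>n. F n)" if F: "\<And>n. P (F n)" for F :: "nat \<Rightarrow> 'a set"
  proof -
    define U where "U n = (\<Union>i<n. F i)" for n
    have U: "P (U n)" for n
    proof (induction n)
      case 0
      then show ?case
        using closed[of "{}"] by (simp add: U_def)
    next
      case (Suc n)
      have "U (Suc n) = U n \<union> F n"
        by (auto simp: U_def lessThan_Suc)
      then show ?case
        using union[OF Suc F] by simp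
    qed
    have UU: "(\<Union>n. U n) = (\<Union>n. F n)"
      unfolding U_def by auto
    have Ub: "U n \<in> sets borel" for n
      using U unfolding P_def by blast
    have FU: "(\<Union>n. F n) \<in> sets borel"
      using F unfolding P_def by blast
    have "\<exists>g. ok (\<Union>n. F n) e g" if "e > 0" for e
    proof -
      have "\<forall>\<^sub>F n in sequentially. measure M (\<Union>n. F n) - e/2 < measure M (U n)" if "M \<in> \<M>" for M
      proof -
        have "(\<lambda>n. measure M (U n)) \<longlonglongrightarrow> measure M (\<Union>n. U n)"
          using Ub \<M>(3)[OF that]
          by (intro finite_measure.finite_Lim_measure_incseq[OF \<M>(2)[OF that]])
            (auto simp: incseq_def U_def intro: less_le_trans)
        then show ?thesis
          using \<open>e > 0\<close> unfolding UU by (intro order_tendstoD(1)) auto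
      qed
      then have "\<exists>n. \<forall>M\<in>\<M>. measure M (\<Union>n. F n) - e/2 < measure M (U n)"
        by (intro eventually_happens'[OF sequentially_bot] eventually_ball_finite \<M>(1)) auto
      then obtain n where n: "\<And>M. M \<in> \<M> \<Longrightarrow> measure M (\<Union>n. F n) - e/2 < measure M (U n)"
        by blast
      obtain g where g: "ok (U n) (e/2) g"
        using U[of n] \<open>e > 0\<close> unfolding P_def by (meson half_gt_zero)
      have "(\<integral>x. \<bar>g x - indicator (\<Union>n. F n) x\<bar> \<partial>M) < e" if M: "M \<in> \<M>" for M
      proof -
        have i1: "integrable M (\<lambda>x. \<bar>g x - indicator (U n) x\<bar>)"
          using ok_meas[OF g] ind[OF Ub] by (auto intro!: int M)
        interpret finite_measure M
          by (rule \<M>(2)[OF M])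
        have sub: "U n \<subseteq> (\<Union>n. F n)"
          unfolding U_def by auto
        have D: "(\<Union>n. F n) - U n \<in> sets M"
          using FU Ub \<M>(3)[OF M] by auto
        have i2: "integrable M (indicator ((\<Union>n. F n) - U n) :: 'a \<Rightarrow> real)"
          using D by (simp add: emeasure_eq_measure)
        have "(\<integral>x. \<bar>g x - indicator (\<Union>n. F n) x\<bar> \<partial>M)
            \<le> (\<integral>x. \<bar>g x - indicator (U n) x\<bar> + indicator ((\<Union>n. F n) - U n) x \<partial>M)"
        proof (rule integral_mono)
          show "integrable M (\<lambda>x. \<bar>g x - indicator (\<Union>n. F n) x\<bar>)"
            using ok_meas[OF g] ind[OF FU] by (intro int M) auto
          show "\<bar>g x - indicator (\<Union>n. F n) x\<bar> \<le> \<bar>g x - indicator (U n) x\<bar> + indicator ((\<Union>n. F n) - U n) x" for x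
            using sub by (auto simp: indicator_def)
        qed (use i1 i2 in auto)
        also have "\<dots> = (\<integral>x. \<bar>g x - indicator (U n) x\<bar> \<partial>M) + measure M ((\<Union>n. F n) - U n)"
          using i1 i2 D by simp
        also have "measure M ((\<Union>n. F n) - U n) = measure M (\<Union>n. F n) - measure M (U n)"
          using FU Ub \<M>(3)[OF M] sub by (intro finite_measure_Diff) auto
        also have "(\<integral>x. \<bar>g x - indicator (U n) x\<bar> \<partial>M) + (measure M (\<Union>n. F n) - measure M (U n)) < e/2 + e/2"
          using g M n[OF M] unfolding ok_def by (intro add_strict_mono) auto
        finally show ?thesis by simp
      qed
      then have "ok (\<Union>n. F n) e g"
        using g unfolding ok_def by auto
      then show ?thesis by blast
    qed
    then show ?thesis
      using FU unfolding P_def by auto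
  qed
  have "B \<in> sigma_sets UNIV (Collect closed)"
    using B by (simp add: borel_eq_closed)
  then have "P B"
  proof induction
    case (Basic C)
    then show ?case
      using closed by simp
  next
    case Empty
    then show ?case
      using closed[of "{}"] by simp
  qed (use compl Union in auto)
  then show ?thesis
    using e unfolding P_def ok_def by blast
qed

text \<open>A positive part of large mass has a Borel set \<open>B\<close> of large value \<open>\<nu> B\<close>, and a continuous function
  close to the indicator of \<open>B\<close> for both parts has nearly the same integral.\<close>

lemma measure_jordan_pos_le:
  fixes \<nu> :: "'a::metric_space set \<Rightarrow> real"
  assumes \<nu>: "signed_additive \<nu>"
    and c: "\<And>g. continuous_on UNIV g \<Longrightarrow> (\<And>x. 0 \<le> g x \<and> g x \<le> 1) \<Longrightarrow>
      (\<integral>x. g x \<partial>jordan_pos \<nu>) - (\<integral>x. g x \<partial>jordan_pos (\<lambda>A. - \<nu> A)) \<le> c"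
  shows "measure (jordan_pos \<nu>) UNIV \<le> c"
proof -
  let ?P = "jordan_pos \<nu>" and ?N = "jordan_pos (\<lambda>A. - \<nu> A)"
  have "\<nu> B \<le> c" if B: "B \<in> sets borel" for B
  proof (rule field_le_epsilon)
    fix e :: real assume e: "e > 0"
    obtain g where g: "continuous_on UNIV g" "\<And>x. 0 \<le> g x \<and> g x \<le> 1"
      "\<And>M. M \<in> {?P, ?N} \<Longrightarrow> (\<integral>x. \<bar>g x - indicator B x\<bar> \<partial>M) < e/2"
    proof -
      have "\<exists>g. continuous_on UNIV g \<and> (\<forall>x. 0 \<le> g x \<and> g x \<le> 1) \<and>
        (\<forall>M\<in>{?P, ?N}. (\<integral>x. \<bar>g x - indicator B x\<bar> \<partial>M) < e/2)"
        using finite_measure_jordan_pos[OF \<nu>] finite_measure_jordan_pos[OF signed_additive_uminus[OF \<nu>]] e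
        by (intro continuous_approx_indicator B) auto
      then show thesis
        using that by blast
    qed
    have approx: "\<bar>(\<integral>x. g x \<partial>M) - measure M B\<bar> < e/2" if M: "M \<in> {?P, ?N}" for M
    proof -
      have fin: "finite_measure M" and sets: "sets M = sets borel"
        using M finite_measure_jordan_pos[OF \<nu>] finite_measure_jordan_pos[OF signed_additive_uminus[OF \<nu>]]
        by auto
      have ig: "integrable M g"
        using g(1,2) by (intro integrable_bounded_borel fin sets bounded_borelI[of _ 1]) auto
      have iB: "integrable M (indicator B :: 'a \<Rightarrow> real)"
        using B sets finite_measure.emeasure_eq_measure[OF fin] by simp
      have "(\<integral>x. g x \<partial>M) - measure M B = (\<integral>x. g x - indicator B x \<partial>M)"
        using ig iB B sets by simp
      also have "\<bar>\<dots>\<bar> \<le> (\<integral>x. \<bar>g x - indicator B x\<bar> \<partial>M)"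
        by (rule integral_abs_bound)
      finally show ?thesis
        using g(3)[OF M] by simp
    qed
    have "\<nu> B = measure ?P B - measure ?N B"
      by (rule jordan_decomposition[OF \<nu> B, symmetric])
    also have "\<dots> \<le> (\<integral>x. g x \<partial>?P) - (\<integral>x. g x \<partial>?N) + e"
      using approx[of ?P] approx[of ?N] unfolding abs_less_iff by simp
    finally show "\<nu> B \<le> c + e"
      using c[OF g(1,2)] by simp
  qed
  then show ?thesis
    by (simp add: measure_jordan_pos[OF \<nu>] upper_variation_least)
qed

lemma cm_integral_of_real:
  fixes \<mu> :: "'a::topological_space cmeasure"
  shows "cm_integral \<mu> (\<lambda>x. complex_of_real (g x)) =
    Complex ((\<integral>x. g x \<partial>jordan_pos (\<lambda>A. Re (cm_value \<mu> A))) - (\<integral>x. g x \<partial>jordan_pos (\<lambda>A. - Re (cm_value \<mu> A))))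
     ((\<integral>x. g x \<partial>jordan_pos (\<lambda>A. Im (cm_value \<mu> A))) - (\<integral>x. g x \<partial>jordan_pos (\<lambda>A. - Im (cm_value \<mu> A))))"
  unfolding cm_integral_def by (simp add: complex_eq_iff scaleC_complex_def)

text \<open>Each of the four parts is detected by real test functions multiplied by one of \<open>1\<close>, \<open>-1\<close>, \<open>\<i>\<close>
  and \<open>- \<i>\<close>.\<close>

lemma jordan_mass_le_total_variation:
  fixes \<mu> :: "'a::metric_space cmeasure"
  shows "jordan_mass \<mu> \<le> 4 * total_variation \<mu>"
proof -
  have bound: "Re (c * cm_integral \<mu> (\<lambda>x. complex_of_real (g x))) \<le> total_variation \<mu>"
    if "continuous_on UNIV g" "\<And>x. 0 \<le> g x \<and> g x \<le> 1" "norm c = 1" for g c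
  proof -
    have "bounded_borel (\<lambda>x. complex_of_real (g x))"
      using that by (intro bounded_borelI[of _ 1] continuous_intros) auto
    then have "Re (c * cm_integral \<mu> (\<lambda>x. complex_of_real (g x)))
        = Re (cm_integral \<mu> (\<lambda>x. c * complex_of_real (g x)))"
      by (simp only: cm_integral_cmult)
    also have "\<dots> \<le> total_variation \<mu>"
      using that by (intro Re_cm_integral_le_total_variation continuous_on_mult_left continuous_on_of_real)
        (auto simp: norm_mult)
    finally show ?thesis .
  qed
  have "measure (jordan_pos (\<lambda>A. Re (cm_value \<mu> A))) UNIV \<le> total_variation \<mu>"
    using bound[of _ 1]
    by (intro measure_jordan_pos_le signed_additive_cmeasure) (simp add: cm_integral_of_real)
  moreover have "measure (jordan_pos (\<lambda>A. - Re (cm_value \<mu> A))) UNIV \<le> total_variation \<mu>"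
    using bound[of _ "-1"]
    by (intro measure_jordan_pos_le signed_additive_cmeasure) (simp add: cm_integral_of_real)
  moreover have "measure (jordan_pos (\<lambda>A. Im (cm_value \<mu> A))) UNIV \<le> total_variation \<mu>"
    using bound[of _ "- \<i>"]
    by (intro measure_jordan_pos_le signed_additive_cmeasure) (simp add: cm_integral_of_real)
  moreover have "measure (jordan_pos (\<lambda>A. - Im (cm_value \<mu> A))) UNIV \<le> total_variation \<mu>"
    using bound[of _ \<i>]
    by (intro measure_jordan_pos_le signed_additive_cmeasure) (simp add: cm_integral_of_real)
  ultimately show ?thesis
    unfolding jordan_mass_def by simp
qed

text \<open>The measures \<open>N i\<close> need not be the Jordan parts of the complex measure that they define. Its
  integrals can nevertheless be computed from them, by the independence of the decomposition.\<close>

lemma cmeasure_of_measures: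
  fixes N :: "nat \<Rightarrow> 'a::topological_space measure"
  assumes N: "\<And>i. finite_measure (N i)" "\<And>i. sets (N i) = sets borel"
  shows "\<exists>\<mu>::'a cmeasure. \<forall>\<eta>::'a \<Rightarrow> complex. bounded_borel \<eta> \<longrightarrow>
    cm_integral \<mu> \<eta> = ((\<integral>x. \<eta> x \<partial>N 0) - (\<integral>x. \<eta> x \<partial>N 1)) + \<i> * ((\<integral>x. \<eta> x \<partial>N 2) - (\<integral>x. \<eta> x \<partial>N 3))"
proof -
  define v where "v A = (if A \<in> sets borel then Complex (measure (N 0) A - measure (N 1) A)
    (measure (N 2) A - measure (N 3) A) else 0)" for A
  have sums: "(\<lambda>n. measure (N i) (F n)) sums measure (N i) (\<Union>n. F n)"
    if "range F \<subseteq> sets borel" "disjoint_family F" for i and F :: "nat \<Rightarrow> 'a set"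
    using that N by (intro finite_measure.finite_measure_UNION) auto
  define \<mu> where "\<mu> = Abs_cmeasure v"
  have \<mu>: "cm_value \<mu> = v"
    unfolding \<mu>_def
  proof (rule Abs_cmeasure_inverse, safe)
    fix F :: "nat \<Rightarrow> 'a set" assume F: "range F \<subseteq> sets borel" "disjoint_family F"
    then have "(\<Union>n. F n) \<in> sets borel" "\<And>n. F n \<in> sets borel"
      by auto
    then show "(\<lambda>n. v (F n)) sums v (\<Union>n. F n)"
      unfolding v_def by (auto simp: sums_complex_iff intro!: sums_diff sums F)
  qed (simp add: v_def)
  have cplx: "(\<integral>x. \<eta> x \<partial>jordan_pos \<nu>) - (\<integral>x. \<eta> x \<partial>jordan_pos (\<lambda>A. - \<nu> A)) = (\<integral>x. \<eta> x \<partial>N i) - (\<integral>x. \<eta> x \<partial>N j)"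
    if \<eta>: "bounded_borel \<eta>" and \<nu>: "signed_additive \<nu>"
      and eq: "\<And>A. A \<in> sets borel \<Longrightarrow> \<nu> A = measure (N i) A - measure (N j) A"
    for \<eta> :: "'a \<Rightarrow> complex" and \<nu> i j
  proof -
    obtain K where K: "\<And>x. cmod (\<eta> x) \<le> K"
      using \<eta> unfolding bounded_borel_def bounded_iff by auto
    have part: "L ((\<integral>x. \<eta> x \<partial>jordan_pos \<nu>) - (\<integral>x. \<eta> x \<partial>jordan_pos (\<lambda>A. - \<nu> A))) = L ((\<integral>x. \<eta> x \<partial>N i) - (\<integral>x. \<eta> x \<partial>N j))"
      if L: "bounded_linear L" "\<And>z. \<bar>L z\<bar> \<le> cmod z" for L :: "complex \<Rightarrow> real"
    proof -
      interpret bounded_linear L by fact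
      have I: "L (\<integral>x. \<eta> x \<partial>M) = (\<integral>x. L (\<eta> x) \<partial>M)" if "finite_measure M" "sets M = sets borel" for M
        by (rule integral_bounded_linear[OF L(1) integrable_bounded_borel[OF that \<eta>], symmetric])
      note fin = finite_measure_jordan_pos[OF \<nu>] finite_measure_jordan_pos[OF signed_additive_uminus[OF \<nu>]]
      have "(\<integral>x. L (\<eta> x) \<partial>jordan_pos \<nu>) - (\<integral>x. L (\<eta> x) \<partial>jordan_pos (\<lambda>A. - \<nu> A))
          = (\<integral>x. L (\<eta> x) \<partial>N i) - (\<integral>x. L (\<eta> x) \<partial>N j)"
      proof (rule integral_diff_measures_cong)
        show "\<bar>L (\<eta> x)\<bar> \<le> K" for x
          using L(2)[of "\<eta> x"] K[of x] by simp
        show "(\<lambda>x. L (\<eta> x)) \<in> borel_measurable borel"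
          using bounded_borel_bounded_linear[OF L(1) \<eta>] unfolding bounded_borel_def by blast
      qed (use fin N in \<open>simp_all add: jordan_decomposition[OF \<nu>] eq\<close>)
      then show ?thesis
        using fin N by (simp add: diff I)
    qed
    from part[OF bounded_linear_Re abs_Re_le_cmod] part[OF bounded_linear_Im abs_Im_le_cmod]
    show ?thesis
      by (simp add: complex_eq_iff)
  qed
  have "cm_integral \<mu> \<eta> = ((\<integral>x. \<eta> x \<partial>N 0) - (\<integral>x. \<eta> x \<partial>N 1)) + \<i> * ((\<integral>x. \<eta> x \<partial>N 2) - (\<integral>x. \<eta> x \<partial>N 3))"
    if \<eta>: "bounded_borel \<eta>" for \<eta>
  proof -
    have "Re (cm_value \<mu> A) = measure (N 0) A - measure (N 1) A"
      "Im (cm_value \<mu> A) = measure (N 2) A - measure (N 3) A" if "A \<in> sets borel" for A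
      using that by (simp_all add: \<mu> v_def)
    then show ?thesis
      unfolding cm_integral_def scaleC_complex_def
      using cplx[OF \<eta> signed_additive_cmeasure(1)[of \<mu>], of 0 1] cplx[OF \<eta> signed_additive_cmeasure(3)[of \<mu>], of 2 3]
      by simp
  qed
  then show ?thesis
    by blast
qed

section \<open>A space-filling curve\<close>

text \<open>A continuous function of period 2 that is 0 on \<open>[0, 1/3]\<close> and 1 on \<open>[2/3, 1]\<close>: it reads off the
  first ternary digit of a number in \<open>[0, 1]\<close> with digits 0 and 2, and ignores even integers.\<close>

definition schoenberg_wave :: "real \<Rightarrow> real"
  where "schoenberg_wave u = max 0 (min 1 (1/2 - cos (pi * u)))"

lemma schoenberg_wave_bounds: "0 \<le> schoenberg_wave u" "schoenberg_wave u \<le> 1"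
  by (simp_all add: schoenberg_wave_def)

lemma continuous_on_schoenberg_wave: "continuous_on A schoenberg_wave"
  unfolding schoenberg_wave_def by (intro continuous_intros)

lemma schoenberg_wave_digit:
  assumes a: "a \<in> {0, 1::nat}" and r: "0 \<le> r" "r \<le> 1/3"
  shows "schoenberg_wave (2 * of_nat m + (2 * of_nat a / 3 + r)) = of_nat a"
proof -
  have "cos (pi * (2 * of_nat m + (2 * of_nat a / 3 + r))) = cos (pi * (2 * of_nat a / 3 + r))"
    using cos.plus_of_nat[of "pi * (2 * of_nat a / 3 + r)" m] by (simp add: algebra_simps)
  moreover have "cos (pi * r) \<ge> 1/2" if "a = 0"
    using cos_monotone_0_pi_le[of "pi * r" "pi / 3"] r by (simp add: cos_60)
  moreover have "cos (pi * (2 / 3 + r)) \<le> - 1/2" if "a = 1"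
  proof -
    have "pi * (2 / 3 + r) \<le> pi * 1"
      using r by (intro mult_left_mono) auto
    moreover have "pi * (2 / 3) \<le> pi * (2 / 3 + r)"
      using r by (intro mult_left_mono) auto
    ultimately have "cos (pi * (2 / 3 + r)) \<le> cos (pi * (2 / 3))"
      by (intro cos_monotone_0_pi_le) auto
    also have "pi * (2 / 3) = pi - pi / 3"
      by (simp add: field_simps)
    also have "cos (pi - pi / 3) = - 1/2"
      using cos_minus_pi[of "pi / 3"] by (simp add: cos_60 cos_diff)
    finally show ?thesis .
  qed
  ultimately show ?thesis
    using a by (auto simp: schoenberg_wave_def)
qed

text \<open>Multiplication by \<open>3 ^ N\<close> shifts the ternary expansion. The integer part that appears is even, as
  all digits are, and the tail after the digit in question is at most \<open>1/3\<close>.\<close>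

lemma schoenberg_wave_ternary:
  assumes a: "\<And>n::nat. a n \<in> {0, 1::nat}"
  defines "t \<equiv> (\<Sum>n. 2 * real (a n) / 3 ^ Suc n)"
  shows "schoenberg_wave (3 ^ N * t) = of_nat (a N)" "0 \<le> t" "t \<le> 1"
proof -
  define f where "f n = 2 * real (a n) / 3 ^ Suc n" for n
  have a1: "real (a n) \<le> 1" for n
    using a[of n] by auto
  have le: "f n \<le> 2 / 3 * (1 / 3) ^ n" for n
    using a1[of n] by (simp add: f_def field_simps)
  have nn: "0 \<le> f n" for n
    by (simp add: f_def)
  have geo: "summable (\<lambda>n. 2 / 3 * (1 / 3 :: real) ^ n)"
    by (intro summable_mult summable_geometric) simp
  have sf: "summable f"
    by (rule summable_comparison_test_ev[OF _ geo]) (use le nn in auto)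
  have sf': "summable (\<lambda>n. f (n + k))" for k
    using sf summable_iff_shift by blast
  have t: "t = suminf f"
    unfolding t_def f_def ..
  have tail: "(\<Sum>n. f (n + k)) \<le> (1 / 3) ^ k" for k
  proof -
    have "(\<Sum>n. f (n + k)) \<le> (\<Sum>n. 2 / 3 * (1 / 3) ^ (n + k))"
      using geo summable_iff_shift[of "\<lambda>n. 2 / 3 * (1 / 3 :: real) ^ n" k]
      by (intro suminf_le le sf') blast
    also have "\<dots> = (\<Sum>n. (1 / 3) ^ k * 2 / 3 * (1 / 3) ^ n)"
      by (simp add: power_add mult_ac)
    also have "\<dots> = (1 / 3) ^ k * 2 / 3 * (\<Sum>n. (1 / 3) ^ n)"
      by (rule suminf_mult) (simp add: summable_geometric)
    also have "\<dots> = (1 / 3) ^ k"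
      by (simp add: suminf_geometric)
    finally show ?thesis .
  qed
  show "0 \<le> t"
    unfolding t by (rule suminf_nonneg[OF sf nn])
  show "t \<le> 1"
    using tail[of 0] by (simp add: t)
  define m where "m = (\<Sum>n<N. a n * 3 ^ (N - Suc n))"
  define r where "r = 3 ^ N * (\<Sum>n. f (n + Suc N))"
  have "3 ^ N * (\<Sum>n<N. f n) = 2 * of_nat m"
  proof -
    have "3 ^ N * f n = 2 * of_nat (a n * 3 ^ (N - Suc n))" if "n < N" for n
    proof -
      have "(3::real) ^ N = 3 ^ (N - Suc n) * 3 ^ Suc n"
        using that by (metis Suc_leI le_add_diff_inverse2 power_add)
      then show ?thesis
        by (simp add: f_def)
    qed
    then show ?thesis
      by (simp add: m_def sum_distrib_left)
  qed
  moreover have "t = (\<Sum>n<N. f n) + (f N + (\<Sum>n. f (n + Suc N)))"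
    unfolding t using suminf_split_initial_segment[OF sf, of N] suminf_split_head[OF sf'[of N]]
    by simp
  moreover have "3 ^ N * f N = 2 * of_nat (a N) / 3"
    by (simp add: f_def)
  ultimately have "3 ^ N * t = 2 * of_nat m + (2 * of_nat (a N) / 3 + r)"
    by (simp add: r_def distrib_left)
  moreover have "0 \<le> r"
    unfolding r_def by (intro mult_nonneg_nonneg suminf_nonneg sf' nn) simp
  moreover have "r \<le> 3 ^ N * (1 / 3) ^ Suc N"
    unfolding r_def by (rule mult_left_mono[OF tail]) simp
  ultimately show "schoenberg_wave (3 ^ N * t) = of_nat (a N)"
    using schoenberg_wave_digit[OF a, of r m N] by (simp add: power_one_over)
qed

text \<open>The digit \<open>b k\<close> is \<open>\<lfloor>2\<^sup>k\<^sup>+\<^sup>1 x\<rfloor> - 2 \<lfloor>2\<^sup>k x\<rfloor>\<close>, so that the partial sums telescope to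
  \<open>\<lfloor>2\<^sup>n x\<rfloor> / 2\<^sup>n\<close>.\<close>

lemma binary_expansion:
  assumes x: "0 \<le> x" "x < (1::real)"
  shows "\<exists>b. (\<forall>k. b k \<in> {0, 1::nat}) \<and> (\<lambda>k. real (b k) / 2 ^ Suc k) sums x"
proof -
  define b where "b k = nat (\<lfloor>2 ^ Suc k * x\<rfloor> - 2 * \<lfloor>2 ^ k * x\<rfloor>)" for k
  have fl: "\<lfloor>2 ^ Suc k * x\<rfloor> - 2 * \<lfloor>2 ^ k * x\<rfloor> \<in> {0, 1}" for k
  proof -
    have "\<lfloor>2 * y\<rfloor> - 2 * \<lfloor>y\<rfloor> \<in> {0, 1}" for y :: real
      by simp linarith
    from this[of "2 ^ k * x"] show ?thesis
      by (simp add: mult.assoc)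
  qed
  have b: "real (b k) = of_int \<lfloor>2 ^ Suc k * x\<rfloor> - 2 * of_int \<lfloor>2 ^ k * x\<rfloor>" for k
    using fl[of k] unfolding b_def by auto
  have part: "(\<Sum>k<n. real (b k) / 2 ^ Suc k) = of_int \<lfloor>2 ^ n * x\<rfloor> / 2 ^ n" for n
  proof (induction n)
    case 0
    have "\<lfloor>x\<rfloor> = 0"
      using x by linarith
    then show ?case by simp
  next
    case (Suc n)
    then show ?case
      by (simp only: sum.lessThan_Suc b) (simp add: field_simps)
  qed
  have "(\<lambda>n. of_int \<lfloor>2 ^ n * x\<rfloor> / 2 ^ n) \<longlonglongrightarrow> x"
  proof (rule tendsto_sandwich)
    show "\<forall>\<^sub>F n in sequentially. x - (1/2) ^ n \<le> of_int \<lfloor>2 ^ n * x\<rfloor> / 2 ^ n"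
    proof (intro always_eventually allI)
      fix n
      have "2 ^ n * x - 1 \<le> of_int \<lfloor>2 ^ n * x\<rfloor>"
        by linarith
      then have "(2 ^ n * x - 1) / 2 ^ n \<le> of_int \<lfloor>2 ^ n * x\<rfloor> / 2 ^ n"
        by (rule divide_right_mono) simp
      then show "x - (1/2) ^ n \<le> of_int \<lfloor>2 ^ n * x\<rfloor> / 2 ^ n"
        by (simp add: diff_divide_distrib power_one_over inverse_eq_divide)
    qed
    show "\<forall>\<^sub>F n in sequentially. of_int \<lfloor>2 ^ n * x\<rfloor> / 2 ^ n \<le> x"
    proof (intro always_eventually allI)
      fix n
      have "of_int \<lfloor>2 ^ n * x\<rfloor> / 2 ^ n \<le> 2 ^ n * x / 2 ^ n"
        by (rule divide_right_mono) auto
      then show "of_int \<lfloor>2 ^ n * x\<rfloor> / 2 ^ n \<le> x"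
        by simp
    qed
    have "(\<lambda>n. (1/2 :: real) ^ n) \<longlonglongrightarrow> 0"
      by (rule LIMSEQ_realpow_zero) auto
    then show "(\<lambda>n. x - (1/2) ^ n) \<longlonglongrightarrow> x"
      using tendsto_diff[OF tendsto_const, of _ 0 sequentially x] by simp
  qed auto
  then have "(\<lambda>k. real (b k) / 2 ^ Suc k) sums x"
    unfolding sums_def part .
  moreover have "b k \<in> {0, 1}" for k
    using fl[of k] unfolding b_def by auto
  ultimately show ?thesis
    by blast
qed

text \<open>Schoenberg's curve: the ternary digits of the parameter are dealt out to the coordinates,
  where they become binary digits.\<close>

lemma space_filling_curve:
  "\<exists>P :: real \<Rightarrow> (real, 'd::finite) vec. continuous_on UNIV P \<and>
    (\<forall>x. (\<forall>i. 0 \<le> x $ i \<and> x $ i < 1) \<longrightarrow> (\<exists>t\<in>{0..1}. P t = x))"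
proof -
  define d where "d = CARD('d)"
  have "finite (UNIV :: 'd set)"
    by simp
  then obtain idx :: "'d \<Rightarrow> nat" where idx: "bij_betw idx UNIV {0..<d}"
    using ex_bij_betw_finite_nat unfolding d_def by blast
  define w where "w i k t = schoenberg_wave (3 ^ (d * k + idx i) * t) / 2 ^ Suc k" for i k t
  define P where "P t = (\<chi> i. \<Sum>k. w i k t)" for t
  have "continuous_on UNIV (\<lambda>t. \<Sum>k. w i k t)" for i
  proof (rule uniform_limit_theorem)
    show "uniform_limit UNIV (\<lambda>n t. \<Sum>k<n. w i k t) (\<lambda>t. \<Sum>k. w i k t) sequentially"
    proof (rule Weierstrass_m_test)
      show "norm (w i k t) \<le> (1/2) ^ Suc k" for k t
        using schoenberg_wave_bounds[of "3 ^ (d * k + idx i) * t"]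
        by (simp add: w_def power_one_over divide_right_mono field_simps)
      show "summable (\<lambda>k. (1/2 :: real) ^ Suc k)"
        by (subst summable_Suc_iff) (simp add: summable_geometric)
    qed
    show "\<forall>\<^sub>F n in sequentially. continuous_on UNIV (\<lambda>t. \<Sum>k<n. w i k t)"
      unfolding w_def
      by (intro always_eventually allI continuous_intros
          continuous_on_compose2[OF continuous_on_schoenberg_wave[of UNIV]]) auto
  qed simp
  then have "continuous_on UNIV P"
    unfolding P_def by (intro continuous_on_vec_lambda)
  moreover have "\<exists>t\<in>{0..1}. P t = x" if x: "\<forall>i. 0 \<le> x $ i \<and> x $ i < 1" for x
  proof -
    have "\<forall>i. \<exists>b. (\<forall>k. b k \<in> {0, 1::nat}) \<and> (\<lambda>k. real (b k) / 2 ^ Suc k) sums (x $ i)"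
      using x binary_expansion by blast
    then obtain b where b: "\<And>i k. b i k \<in> {0, 1::nat}" "\<And>i. (\<lambda>k. real (b i k) / 2 ^ Suc k) sums (x $ i)"
      by metis
    define a where "a n = b (inv_into UNIV idx (n mod d)) (n div d)" for n
    have a01: "a n \<in> {0, 1}" for n
      unfolding a_def by (rule b(1))
    have aN: "a (d * k + idx i) = b i k" for i k
    proof -
      \<comment> \<open>\<open>d\<close> is the dimension and \<open>idx i < d\<close>, so quotient and remainder recover \<open>k\<close> and \<open>i\<close>.\<close>
      have "idx i < d"
        using idx unfolding bij_betw_def by auto
      moreover have "inv_into UNIV idx (idx i) = i"
        using idx unfolding bij_betw_def by (simp add: inv_into_f_f)
      ultimately show ?thesis
        by (simp add: a_def)
    qed
    define t where "t = (\<Sum>n. 2 * real (a n) / 3 ^ Suc n)"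
    have "w i k t = real (b i k) / 2 ^ Suc k" for i k
      using schoenberg_wave_ternary(1)[of a "d * k + idx i"] a01 by (simp add: w_def t_def aN)
    then have "(\<Sum>k. w i k t) = x $ i" for i
      using b(2)[of i] by (simp add: sums_iff)
    then have "P t = x"
      by (simp add: P_def vec_eq_iff)
    moreover have "t \<in> {0..1}"
      using schoenberg_wave_ternary(2,3)[of a] a01 by (simp add: t_def)
    ultimately show ?thesis
      by blast
  qed
  ultimately show ?thesis
    by blast
qed

text \<open>The first parameter at which a curve passes through a point is a lower semicontinuous
  function of the point, because its sublevel sets are images of compact intervals.\<close>

lemma borel_section:
  fixes Q :: "real \<Rightarrow> 'a::t2_space"
  assumes Q: "continuous_on UNIV Q" and surj: "\<And>x. \<exists>t\<in>{0..1}. Q t = x"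
  shows "\<exists>S. S \<in> borel_measurable borel \<and> (\<forall>x. S x \<in> {0..1} \<and> Q (S x) = x)"
proof -
  have ex: "\<exists>s. (s \<in> {0..1} \<and> Q s = x) \<and> (\<forall>t. t \<in> {0..1} \<and> Q t = x \<longrightarrow> s \<le> t)" for x
  proof -
    have "closed (Q -` {x})"
      using Q by (intro closed_vimage) auto
    then have "compact ({0..1} \<inter> Q -` {x})"
      by (intro compact_Int_closed) auto
    moreover have "{0..1} \<inter> Q -` {x} \<noteq> {}"
      using surj[of x] by auto
    ultimately show ?thesis
      using compact_attains_inf[of "{0..1} \<inter> Q -` {x}"] by auto
  qed
  then obtain S where S: "\<And>x. S x \<in> {0..1}" "\<And>x. Q (S x) = x"
    "\<And>x t. t \<in> {0..1} \<Longrightarrow> Q t = x \<Longrightarrow> S x \<le> t"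
    by metis
  have "{x. S x \<le> a} \<in> sets borel" for a
  proof -
    have "{x. S x \<le> a} = Q ` ({0..1} \<inter> {..a})"
    proof safe
      fix x assume "S x \<le> a"
      then show "x \<in> Q ` ({0..1} \<inter> {..a})"
        using S(1,2)[of x] by (intro image_eqI[of _ _ "S x"]) auto
    next
      fix t assume "t \<in> {0..1}" "t \<le> a"
      then show "S (Q t) \<le> a"
        using S(3)[of t "Q t"] by simp
    qed
    moreover have "compact (Q ` ({0..1} \<inter> {..a}))"
      by (intro compact_continuous_image continuous_on_subset[OF Q] compact_Int_closed) auto
    ultimately show ?thesis
      by (simp add: compact_imp_closed)
  qed
  then have "S \<in> borel_measurable borel"
    by (simp add: borel_measurable_iff_le)
  then show ?thesis
    using S(1,2) by blast
qed

section \<open>Weak compactness\<close>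

definition tends_weakly :: "(nat \<Rightarrow> 'a::topological_space measure) \<Rightarrow> 'a measure \<Rightarrow> bool"
  where "tends_weakly M N \<longleftrightarrow> (\<forall>f B. continuous_on UNIV f \<longrightarrow> (\<forall>x. cmod (f x) \<le> B) \<longrightarrow>
    (\<lambda>n. \<integral>x. f x \<partial>M n) \<longlonglongrightarrow> (\<integral>x. f x \<partial>N))"

lemma tends_weaklyD:
  "tends_weakly M N \<Longrightarrow> continuous_on UNIV f \<Longrightarrow> (\<And>x. cmod (f x) \<le> B) \<Longrightarrow>
    (\<lambda>n. \<integral>x. f x \<partial>M n) \<longlonglongrightarrow> (\<integral>x. f x \<partial>N)"
  unfolding tends_weakly_def by blast

lemma tends_weakly_subseq: "tends_weakly M N \<Longrightarrow> strict_mono s \<Longrightarrow> tends_weakly (\<lambda>n. M (s n)) N"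
  unfolding tends_weakly_def
proof (intro allI impI)
  fix f :: "'a \<Rightarrow> complex" and B
  assume "\<forall>f B. continuous_on UNIV f \<longrightarrow> (\<forall>x. cmod (f x) \<le> B) \<longrightarrow> (\<lambda>n. \<integral>x. f x \<partial>M n) \<longlonglongrightarrow> (\<integral>x. f x \<partial>N)"
    and "strict_mono s" "continuous_on UNIV f" "\<forall>x. cmod (f x) \<le> B"
  then show "(\<lambda>n. \<integral>x. f x \<partial>M (s n)) \<longlonglongrightarrow> (\<integral>x. f x \<partial>N)"
    using LIMSEQ_subseq_LIMSEQ[of "\<lambda>n. \<integral>x. f x \<partial>M n" _ s] unfolding o_def by blast
qed

text \<open>The images under the section live on \<open>[0, 1]\<close> and are therefore tight. A weak limit on the line is
  mapped back by \<open>Q\<close>; integrals of \<open>f\<close> become integrals of the continuous function \<open>f \<circ> Q\<close>.\<close>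

lemma prob_measures_subsequence:
  fixes M :: "nat \<Rightarrow> 'a::t2_space measure"
  assumes Q: "continuous_on UNIV Q" "\<And>x::'a. \<exists>t\<in>{0..1::real}. Q t = x"
    and M: "\<And>n. prob_space (M n)" "\<And>n. sets (M n) = sets borel"
  shows "\<exists>r N. strict_mono (r :: nat \<Rightarrow> nat) \<and> prob_space N \<and> sets N = sets borel \<and>
    tends_weakly (\<lambda>n. M (r n)) N"
proof -
  note [measurable_cong] = M(2)
  obtain S where S [measurable]: "S \<in> borel_measurable borel"
    and S01: "\<And>x. S x \<in> {0..1}" and QS: "\<And>x. Q (S x) = x"
    using borel_section[OF Q] by blast
  have Qm [measurable]: "Q \<in> borel_measurable borel"
    using Q(1) by (rule borel_measurable_continuous_onI)
  define \<mu> where "\<mu> n = distr (M n) borel S" for n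
  have rd: "real_distribution (\<mu> n)" for n
    unfolding \<mu>_def by (rule prob_space.real_distribution_distr[OF M(1)]) measurable
  have "measure (\<mu> n) {-1<..1} = 1" for n
  proof -
    have "S -` {-1<..1} \<inter> space (M n) = space (M n)"
    proof -
      have "-1 < S x" "S x \<le> 1" for x
        using S01[of x] by auto
      then show ?thesis
        by auto
    qed
    then show ?thesis
      unfolding \<mu>_def by (simp add: measure_distr prob_space.prob_space[OF M(1)])
  qed
  then have "tight \<mu>"
    unfolding tight_def using rd by (intro conjI allI impI exI[of _ "-1"] exI[of _ 1]) auto
  then obtain r K where r: "strict_mono (r :: nat \<Rightarrow> nat)" and K: "real_distribution K"
    and conv: "weak_conv_m (\<lambda>n. \<mu> (r n)) K"
    using tight_imp_convergent_subsubsequence[of \<mu> id] by (auto simp: strict_mono_def o_def)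
  interpret K: real_distribution K by fact
  have "(\<lambda>n. \<integral>x. f x \<partial>M (r n)) \<longlonglongrightarrow> (\<integral>x. f x \<partial>distr K borel Q)"
    if f: "continuous_on UNIV f" "\<And>x. cmod (f x) \<le> B" for f B
  proof -
    have fm [measurable]: "f \<in> borel_measurable borel"
      using f(1) by (rule borel_measurable_continuous_onI)
    have "continuous_on UNIV (\<lambda>t. f (Q t))"
      by (rule continuous_on_compose2[OF f(1) Q(1)]) auto
    then have "(\<lambda>n. \<integral>t. f (Q t) \<partial>\<mu> (r n)) \<longlonglongrightarrow> (\<integral>t. f (Q t) \<partial>K)"
      using rd K conv f(2)
      by (intro weak_conv_imp_integral_bdd_continuous_conv[where B = B])
        (auto simp: continuous_on_eq_continuous_at)
    moreover have "(\<integral>t. f (Q t) \<partial>\<mu> (r n)) = (\<integral>x. f x \<partial>M (r n))" for n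
      unfolding \<mu>_def by (simp add: integral_distr QS)
    moreover have "(\<integral>x. f x \<partial>distr K borel Q) = (\<integral>t. f (Q t) \<partial>K)"
      by (rule integral_distr) measurable
    ultimately show ?thesis
      by simp
  qed
  then have "tends_weakly (\<lambda>n. M (r n)) (distr K borel Q)"
    unfolding tends_weakly_def by blast
  moreover have "prob_space (distr K borel Q)"
    by (rule K.prob_space_distr) measurable
  ultimately show ?thesis
    using r by (intro exI[of _ r] exI[of _ "distr K borel Q"]) auto
qed

text \<open>Normalize to probability measures and extract a subsequence along which the total masses
  converge as well.\<close>

lemma finite_measures_subsequence:
  fixes M :: "nat \<Rightarrow> 'a::t2_space measure"
  assumes Q: "continuous_on UNIV Q" "\<And>x::'a. \<exists>t\<in>{0..1::real}. Q t = x"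
    and M: "\<And>n. finite_measure (M n)" "\<And>n. sets (M n) = sets borel"
    and C: "\<And>n. measure (M n) UNIV \<le> C"
  shows "\<exists>r N. strict_mono (r :: nat \<Rightarrow> nat) \<and> finite_measure N \<and> sets N = sets borel \<and>
    tends_weakly (\<lambda>n. M (r n)) N"
proof -
  note [measurable_cong] = M(2)
  have sp: "space (M n) = UNIV" for n
    using sets_eq_imp_space_eq[OF M(2)] by simp
  define c where "c n = measure (M n) UNIV" for n
  have c: "c n \<in> {0..C}" for n
    using C by (simp add: c_def)
  \<comment> \<open>For zero mass any probability measure will do, as it gets multiplied by \<open>c n = 0\<close>.\<close>
  define P where "P n = (if c n = 0 then return borel undefined
    else density (M n) (\<lambda>_. ennreal (1 / c n)))" for n
  have sP: "sets (P n) = sets borel" for n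
    by (simp add: P_def M(2))
  have pP: "prob_space (P n)" for n
  proof (cases "c n = 0")
    case True
    then show ?thesis
      by (simp add: P_def prob_space_return)
  next
    case False
    have "emeasure (M n) (space (M n)) = ennreal (c n)"
      by (simp add: sp c_def finite_measure.emeasure_eq_measure[OF M(1)])
    then have "(\<integral>\<^sup>+x. ennreal (1 / c n) \<partial>M n) = 1"
      using False c[of n] by (simp add: nn_integral_const flip: ennreal_mult)
    then show ?thesis
      using False by (intro prob_spaceI) (simp add: P_def emeasure_density sp)
  qed
  have int: "(\<integral>x. f x \<partial>M n) = c n *\<^sub>R (\<integral>x. f x \<partial>P n)"
    if f: "continuous_on UNIV f" "\<And>x. cmod (f x) \<le> B" for f B n
  proof -
    have fm [measurable]: "f \<in> borel_measurable borel"
      using f(1) by (rule borel_measurable_continuous_onI)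
    show ?thesis
    proof (cases "c n = 0")
      case True
      then show ?thesis
        using norm_integral_le_measure[OF M fm f(2), of n] by (simp add: c_def)
    next
      case False
      then have "(\<integral>x. f x \<partial>P n) = (\<integral>x. (1 / c n) *\<^sub>R f x \<partial>M n)"
        using c[of n] unfolding P_def by (simp add: integral_density)
      then show ?thesis
        using False by simp
    qed
  qed
  obtain r N where r: "strict_mono (r :: nat \<Rightarrow> nat)" and N: "prob_space N" "sets N = sets borel"
    and conv: "tends_weakly (\<lambda>n. P (r n)) N"
    using prob_measures_subsequence[OF Q, of P] pP sP by blast
  obtain a s where a: "a \<in> {0..C}" and s: "strict_mono (s :: nat \<Rightarrow> nat)"
    and cs: "((\<lambda>n. c (r n)) \<circ> s) \<longlonglongrightarrow> a"
    using seq_compactE[OF compact_imp_seq_compact[OF compact_Icc[of 0 C]], of "\<lambda>n. c (r n)"] c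
    by blast
  note [measurable_cong] = N(2)
  define N' where "N' = density N (\<lambda>_. ennreal a)"
  have "finite_measure N'"
    using sets_eq_imp_space_eq[OF N(2)] prob_space.emeasure_space_1[OF N(1)]
    by (intro finite_measureI) (simp add: N'_def emeasure_density ennreal_mult_eq_top_iff)
  moreover have "sets N' = sets borel"
    by (simp add: N'_def N(2))
  moreover have "(\<lambda>n. \<integral>x. f x \<partial>M ((r \<circ> s) n)) \<longlonglongrightarrow> (\<integral>x. f x \<partial>N')"
    if f: "continuous_on UNIV f" "\<And>x. cmod (f x) \<le> B" for f B
  proof -
    have fm [measurable]: "f \<in> borel_measurable borel"
      using f(1) by (rule borel_measurable_continuous_onI)
    have "(\<lambda>n. c (r (s n)) *\<^sub>R (\<integral>x. f x \<partial>P (r (s n)))) \<longlonglongrightarrow> a *\<^sub>R (\<integral>x. f x \<partial>N)"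
      using tends_weaklyD[OF tends_weakly_subseq[OF conv s] f] cs by (intro tendsto_scaleR) (auto simp: o_def)
    moreover have "(\<integral>x. f x \<partial>N') = a *\<^sub>R (\<integral>x. f x \<partial>N)"
      using a unfolding N'_def by (simp add: integral_density)
    ultimately show ?thesis
      by (simp add: int[OF f])
  qed
  then have "tends_weakly (\<lambda>n. M ((r \<circ> s) n)) N'"
    unfolding tends_weakly_def by blast
  ultimately show ?thesis
    using strict_mono_o[OF r s] by blast
qed

lemma finite_measure_families_subsequence:
  fixes M :: "nat \<Rightarrow> nat \<Rightarrow> 'a::t2_space measure"
  assumes Q: "continuous_on UNIV Q" "\<And>x::'a. \<exists>t\<in>{0..1::real}. Q t = x"
    and M: "\<And>i n. finite_measure (M i n)" "\<And>i n. sets (M i n) = sets borel"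
    and C: "\<And>i n. measure (M i n) UNIV \<le> C"
  shows "\<exists>r N. strict_mono (r :: nat \<Rightarrow> nat) \<and> (\<forall>i. finite_measure (N i) \<and> sets (N i) = sets borel) \<and>
    (\<forall>i<k. tends_weakly (\<lambda>n. M i (r n)) (N i))"
proof (induction k)
  case 0
  show ?case
    using M by (intro exI[of _ id] exI[of _ "\<lambda>i. M i 0"]) (auto simp: strict_mono_def)
next
  case (Suc k)
  then obtain r N where r: "strict_mono (r :: nat \<Rightarrow> nat)"
    and N: "\<And>i. finite_measure (N i)" "\<And>i. sets (N i) = sets borel"
    and conv: "\<And>i. i < k \<Longrightarrow> tends_weakly (\<lambda>n. M i (r n)) (N i)"
    by blast
  obtain s K where s: "strict_mono (s :: nat \<Rightarrow> nat)" and K: "finite_measure K" "sets K = sets borel"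
    and conv': "tends_weakly (\<lambda>n. M k (r (s n))) K"
    using finite_measures_subsequence[OF Q, of "\<lambda>n. M k (r n)" C] M C by blast
  have "tends_weakly (\<lambda>n. M i ((r \<circ> s) n)) ((N(k := K)) i)" if "i < Suc k" for i
    using that conv' tends_weakly_subseq[OF conv s, of i] by (cases "i = k") auto
  then show ?case
    using N K strict_mono_o[OF r s]
    by (intro exI[of _ "r \<circ> s"] exI[of _ "N(k := K)"] conjI allI impI)
      (auto simp: o_def)
qed

text \<open>The neighbourhoods that contain almost all terms of the subsequence are closed under finite
  intersections and unions, so it suffices to look at the generating sets.\<close>

lemma accumulation_point_weak_starI:
  fixes m :: "nat \<Rightarrow> 'a::topological_space cmeasure"
  assumes r: "strict_mono r"
    and conv: "\<And>\<eta>. continuous_on UNIV \<eta> \<Longrightarrow>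
      (\<lambda>n. cm_integral (m (r n)) \<eta>) \<longlonglongrightarrow> (cm_integral \<mu> \<eta> :: complex)"
  shows "accumulation_point weak_star m \<mu>"
proof -
  let ?S = "{{\<mu>. cm_integral \<mu> \<eta> \<in> U} |\<eta> U. continuous_on UNIV \<eta> \<and> open (U :: complex set)}"
  have ev: "\<mu> \<in> U \<Longrightarrow> \<forall>\<^sub>F n in sequentially. m (r n) \<in> U" if "generate_topology_on ?S U" for U
    using that
  proof induction
    case (Int A B)
    then show ?case
      by (auto intro: eventually_conj)
  next
    case (UN K)
    then obtain A where "A \<in> K" "\<mu> \<in> A"
      by blast
    then have "\<forall>\<^sub>F n in sequentially. m (r n) \<in> A"
      using UN by blast
    then show ?case
      by (rule eventually_mono) (use \<open>A \<in> K\<close> in blast)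
  next
    case (Basis A)
    then obtain \<eta> U where "A = {\<mu>. cm_integral \<mu> \<eta> \<in> U}" "continuous_on UNIV \<eta>" "open (U :: complex set)"
      by blast
    then show ?case
      using topological_tendstoD[OF conv[of \<eta>], of U] Basis by simp
  qed simp
  have "infinite {n. m n \<in> U}" if "openin weak_star U" "\<mu> \<in> U" for U
  proof -
    have "generate_topology_on ?S U"
      using that(1) unfolding weak_star_def by (simp add: openin_topology_generated_by_iff)
    from ev[OF this that(2)] obtain n0 where n0: "\<And>n. n \<ge> n0 \<Longrightarrow> m (r n) \<in> U"
      unfolding eventually_sequentially by blast
    have "r ` {n0..} \<subseteq> {n. m n \<in> U}"
      using n0 by auto
    moreover have "infinite (r ` {n0..})"
      using r by (simp add: finite_image_iff strict_mono_imp_inj_on inj_on_subset infinite_Ici)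
    ultimately show ?thesis
      using finite_subset by blast
  qed
  moreover have "\<mu> \<in> topspace weak_star"
  proof -
    have "UNIV \<in> ?S"
      by (auto intro!: exI[of _ "\<lambda>_. 0"] exI[of _ UNIV])
    then show ?thesis
      unfolding weak_star_def topology_generated_by_topspace by blast
  qed
  ultimately show ?thesis
    unfolding accumulation_point_def by blast
qed

text \<open>Only finitely many test functions can be controlled at the same time. Two are enough for lower
  semicontinuity: one for the total variation and one for the quadratic term.\<close>

lemma accumulation_pointD:
  fixes m :: "nat \<Rightarrow> 'a::topological_space cmeasure"
  assumes "accumulation_point weak_star m \<mu>" "continuous_on UNIV \<eta>\<^sub>1" "continuous_on UNIV \<eta>\<^sub>2" "e > 0"
  shows "\<exists>n\<ge>n0. cmod (cm_integral (m n) \<eta>\<^sub>1 - cm_integral \<mu> \<eta>\<^sub>1) < e \<and>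
    cmod (cm_integral (m n) \<eta>\<^sub>2 - cm_integral \<mu> \<eta>\<^sub>2) < e"
proof -
  define V where "V \<eta> = {\<nu>. cm_integral \<nu> \<eta> \<in> ball (cm_integral \<mu> \<eta>) e}" for \<eta> :: "'a \<Rightarrow> complex"
  have "openin weak_star (V \<eta>)" if "continuous_on UNIV \<eta>" for \<eta>
    unfolding weak_star_def V_def
    by (rule topology_generated_by_Basis) (use that open_ball in blast)
  then have "openin weak_star (V \<eta>\<^sub>1 \<inter> V \<eta>\<^sub>2)"
    using assms by (intro openin_Int) auto
  moreover have "\<mu> \<in> V \<eta>\<^sub>1 \<inter> V \<eta>\<^sub>2"
    using assms(4) by (simp add: V_def)
  ultimately have "infinite {n. m n \<in> V \<eta>\<^sub>1 \<inter> V \<eta>\<^sub>2}"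
    using assms(1) unfolding accumulation_point_def by blast
  then obtain n where "n \<ge> n0" "m n \<in> V \<eta>\<^sub>1 \<inter> V \<eta>\<^sub>2"
    unfolding infinite_nat_iff_unbounded_le by blast
  then show ?thesis
    by (intro exI[of _ n]) (auto simp: V_def dist_norm norm_minus_commute)
qed

lemma torus_curve:
  "\<exists>Q. continuous_on UNIV Q \<and> (\<forall>x::'d::finite torus. \<exists>t\<in>{0..1::real}. Q t = x)"
proof -
  obtain P :: "real \<Rightarrow> (real, 'd) vec" where P: "continuous_on UNIV P"
    "\<And>x. (\<forall>i. 0 \<le> x $ i \<and> x $ i < 1) \<Longrightarrow> \<exists>t\<in>{0..1}. P t = x"
    using space_filling_curve by blast
  have "\<exists>t\<in>{0..1}. torus_proj (P t) = x" for x :: "'d torus"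
  proof -
    obtain t where "t \<in> {0..1}" "P t = torus_rep x"
      using P(2)[of "torus_rep x"] circle_coord_bounds by (auto simp: torus_rep_def)
    then show ?thesis
      by (intro bexI[of _ t]) auto
  qed
  moreover have "continuous_on UNIV (\<lambda>t. torus_proj (P t))"
    by (rule continuous_on_compose2[OF continuous_on_torus_proj P(1)]) auto
  ultimately show ?thesis
    by blast
qed

lemma bounded_on_torus:
  fixes f :: "'d::finite torus \<Rightarrow> 'a::real_normed_vector"
  assumes "continuous_on UNIV f"
  obtains B where "B > 0" "\<And>x. norm (f x) \<le> B"
proof -
  have "bounded (range f)"
    using compact_continuous_image[OF assms compact_UNIV_torus] compact_imp_bounded by blast
  then show thesis
    using that unfolding bounded_pos by blast
qed

proposition weak_star_accumulation_point_exists: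
  fixes m :: "nat \<Rightarrow> 'd::finite torus cmeasure"
  assumes C: "\<And>n. total_variation (m n) \<le> C"
  shows "\<exists>\<mu>. accumulation_point weak_star m \<mu>"
proof -
  obtain Q where Q: "continuous_on UNIV Q" "\<And>x::'d torus. \<exists>t\<in>{0..1::real}. Q t = x"
    using torus_curve by blast
  define \<nu> where "\<nu> i n A = (if i = 0 then Re (cm_value (m n) A) else if i = 1 then - Re (cm_value (m n) A)
    else if i = 2 then Im (cm_value (m n) A) else - Im (cm_value (m n) A))" for i n :: nat and A
  have \<nu>_eq: "\<nu> 0 n = (\<lambda>A. Re (cm_value (m n) A))" "\<nu> 1 n = (\<lambda>A. - Re (cm_value (m n) A))"
    "\<nu> 2 n = (\<lambda>A. Im (cm_value (m n) A))" "\<nu> 3 n = (\<lambda>A. - Im (cm_value (m n) A))" for n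
    by (auto simp: \<nu>_def)
  have \<nu>_cases: "\<nu> i n \<in> {\<nu> 0 n, \<nu> 1 n, \<nu> 2 n, \<nu> 3 n}" for i n
    by (auto simp: \<nu>_def fun_eq_iff)
  have \<nu>: "signed_additive (\<nu> i n)" for i n
    using \<nu>_cases[of i n] signed_additive_cmeasure[of "m n"] unfolding \<nu>_eq by auto
  have "measure (jordan_pos (\<nu> i n)) UNIV \<le> 4 * C" for i n
  proof -
    have "measure (jordan_pos (\<nu> i n)) UNIV \<le> jordan_mass (m n)"
      using \<nu>_cases[of i n] unfolding \<nu>_eq jordan_mass_def by (elim insertE emptyE) simp_all
    then show ?thesis
      using jordan_mass_le_total_variation[of "m n"] C[of n] by simp
  qed
  then obtain r N where r: "strict_mono (r :: nat \<Rightarrow> nat)"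
    and N: "\<And>i. finite_measure (N i)" "\<And>i. sets (N i) = sets borel"
    and conv: "\<And>i. i < 4 \<Longrightarrow> tends_weakly (\<lambda>n. jordan_pos (\<nu> i (r n))) (N i)"
    using finite_measure_families_subsequence[OF Q, of "\<lambda>i n. jordan_pos (\<nu> i n)" "4 * C" 4]
      finite_measure_jordan_pos[OF \<nu>] sets_jordan_pos by blast
  from cmeasure_of_measures[of N, OF N] obtain \<mu> :: "'d torus cmeasure"
    where \<mu>: "\<forall>\<eta>::'d torus \<Rightarrow> complex. bounded_borel \<eta> \<longrightarrow> cm_integral \<mu> \<eta> =
      ((\<integral>x. \<eta> x \<partial>N 0) - (\<integral>x. \<eta> x \<partial>N 1)) + \<i> * ((\<integral>x. \<eta> x \<partial>N 2) - (\<integral>x. \<eta> x \<partial>N 3))"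
    by (elim exE)
  have "(\<lambda>n. cm_integral (m (r n)) \<eta>) \<longlonglongrightarrow> cm_integral \<mu> \<eta>"
    if \<eta>: "continuous_on UNIV \<eta>" for \<eta> :: "'d torus \<Rightarrow> complex"
  proof -
    obtain B where B: "B > 0" "\<And>x. cmod (\<eta> x) \<le> B"
      by (rule bounded_on_torus[OF \<eta>]) (rule that)
    have split: "cm_integral (m (r n)) \<eta> =
      ((\<integral>x. \<eta> x \<partial>jordan_pos (\<nu> 0 (r n))) - (\<integral>x. \<eta> x \<partial>jordan_pos (\<nu> 1 (r n))))
      + \<i> * ((\<integral>x. \<eta> x \<partial>jordan_pos (\<nu> 2 (r n))) - (\<integral>x. \<eta> x \<partial>jordan_pos (\<nu> 3 (r n))))" for n
      by (simp only: cm_integral_def \<nu>_eq scaleC_complex_def)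
    show ?thesis
      unfolding split \<mu>[rule_format, OF bounded_borelI[OF \<eta> B(2)]]
      by (intro tendsto_add tendsto_diff tendsto_mult tendsto_const tends_weaklyD[OF conv \<eta> B(2)]) simp_all
  qed
  then show ?thesis
    using accumulation_point_weak_starI[OF r, of m \<mu>] by blast
qed

section \<open>Integration on the torus\<close>

text \<open>Passing from the half-open cube to the closed one, which differs from it by a null set, gives
  access to the Henstock--Kurzweil integral with its translation and Fubini theorems.\<close>

lemma
  fixes h :: "'d::finite torus \<Rightarrow> complex"
  shows finite_measure_torus_lebesgue: "finite_measure (torus_lebesgue :: 'd torus measure)"
    and sets_torus_lebesgue [simp, measurable_cong]: "sets (torus_lebesgue :: 'd torus measure) = sets borel"
    and integral_torus_lebesgue: "continuous_on UNIV h \<Longrightarrow>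
      integral\<^sup>L torus_lebesgue h = integral (cbox 0 1) (h \<circ> torus_proj)"
proof -
  show "sets (torus_lebesgue :: 'd torus measure) = sets borel"
    by (simp add: torus_lebesgue_def)
  define S where "S = {x :: (real, 'd) vec. \<forall>i. 0 \<le> x $ i \<and> x $ i < 1}"
  have S [measurable]: "S \<in> sets borel"
  proof -
    have "S = (\<Inter>i\<in>UNIV. {x. 0 \<le> x $ i} \<inter> {x. x $ i < 1})"
      by (auto simp: S_def)
    also have "\<dots> \<in> sets borel"
      by (intro sets.finite_INT sets.Int borel_closed borel_open closed_Collect_le open_Collect_less
          continuous_intros) auto
    finally show ?thesis .
  qed
  have sub: "S \<subseteq> cbox 0 1" "box 0 1 \<subseteq> S"
    by (auto simp: S_def mem_box_cart less_imp_le)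
  have pm: "torus_proj \<in> measurable (restrict_space lborel S) (borel :: 'd torus measure)"
    using borel_measurable_continuous_onI[OF continuous_on_torus_proj]
    by (intro measurable_restrict_space1) auto
  have "emeasure lborel S \<le> emeasure lborel (cbox 0 1 :: (real, 'd) vec set)"
    using sub(1) by (intro emeasure_mono) auto
  also have "\<dots> < \<infinity>"
    using emeasure_bounded_finite[OF bounded_cbox] by blast
  finally have "emeasure lborel S < \<infinity>" .
  then show "finite_measure (torus_lebesgue :: 'd torus measure)"
    unfolding torus_lebesgue_def S_def[symmetric]
    by (intro finite_measure.finite_measure_distr pm finite_measureI)
      (auto simp: space_restrict_space emeasure_restrict_space)
  show "integral\<^sup>L torus_lebesgue h = integral (cbox 0 1) (h \<circ> torus_proj)" if h: "continuous_on UNIV h"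
  proof -
    have c: "continuous_on UNIV (h \<circ> torus_proj)"
      using h by (simp add: continuous_on_torus_iff)
    have "integral\<^sup>L torus_lebesgue h = (\<integral>x. (h \<circ> torus_proj) x \<partial>restrict_space lborel S)"
      unfolding torus_lebesgue_def S_def[symmetric]
      using borel_measurable_continuous_onI[OF h] pm by (simp add: integral_distr)
    also have "\<dots> = (LINT x : S | lborel. (h \<circ> torus_proj) x)"
      unfolding set_lebesgue_integral_def by (rule integral_restrict_space) simp
    also have "\<dots> = integral S (h \<circ> torus_proj)"
    proof (rule set_borel_integral_eq_integral)
      have "set_integrable lborel (cbox 0 1) (h \<circ> torus_proj)"
        unfolding set_integrable_def
        using c by (intro borel_integrable_compact) (auto intro: continuous_on_subset)
      then show "set_integrable lborel S (h \<circ> torus_proj)"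
        by (rule set_integrable_subset) (use sub(1) in auto)
    qed
    also have "\<dots> = integral (cbox 0 1) (h \<circ> torus_proj)"
      using sub by (intro integral_subset_negligible negligible_subset[OF negligible_frontier_interval[of 0 1]]) auto
    finally show ?thesis .
  qed
qed

lemma integrable_torus:
  fixes h :: "'d::finite torus \<Rightarrow> 'b::{banach, second_countable_topology}"
  assumes "continuous_on UNIV h"
  shows "integrable torus_lebesgue h"
proof -
  obtain B where "B > 0" "\<And>x. norm (h x) \<le> B"
    by (rule bounded_on_torus[OF assms]) (rule that)
  then show ?thesis
    using assms by (intro integrable_bounded_borel finite_measure_torus_lebesgue bounded_borelI) auto
qed

lemma content_unit_cube: "measure lborel (cbox 0 1 :: (real, 'd::finite) vec set) = 1"
proof -
  have "(0 :: (real, 'd) vec) \<in> cbox 0 1"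
    by (simp add: mem_box_cart)
  then have "cbox 0 1 \<noteq> ({} :: (real, 'd) vec set)"
    by blast
  then show ?thesis
    by (simp add: content_cbox_cart)
qed

lemma norm_integral_torus_le:
  fixes h :: "'d::finite torus \<Rightarrow> complex"
  assumes h: "continuous_on UNIV h" and B: "\<And>x. cmod (h x) \<le> B"
  shows "cmod (integral\<^sup>L torus_lebesgue h) \<le> B"
proof -
  have c: "continuous_on (cbox 0 1) (h \<circ> torus_proj)"
    using h continuous_on_torus_iff[of h] continuous_on_subset by blast
  have "0 \<le> B"
    using B order_trans norm_ge_zero by blast
  then show ?thesis
    unfolding integral_torus_lebesgue[OF h]
    using integrable_bound[of B "h \<circ> torus_proj" 0 1] integrable_continuous[OF c] B
    by (simp add: content_unit_cube)
qed

lemma integral_split_coordinate: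
  fixes f :: "(real, 'd::finite) vec \<Rightarrow> complex"
  assumes f: "continuous_on UNIV f" and c: "a $ i \<le> c" "c \<le> b $ i"
  shows "integral (cbox a b) f =
    integral (cbox a (\<chi> j. if j = i then c else b $ j)) f + integral (cbox (\<chi> j. if j = i then c else a $ j) b) f"
proof -
  have int: "f integrable_on cbox u v" for u v
    by (rule integrable_continuous[OF continuous_on_subset[OF f]]) simp
  have "cbox a b \<inter> {x. x \<bullet> axis i 1 \<le> c} = cbox a (\<chi> j. if j = i then c else b $ j)"
    using c by (auto simp: mem_box_cart inner_axis split: if_splits) (metis order_trans)+
  moreover have "cbox a b \<inter> {x. x \<bullet> axis i 1 \<ge> c} = cbox (\<chi> j. if j = i then c else a $ j) b"
    using c by (auto simp: mem_box_cart inner_axis split: if_splits) (metis order_trans)+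
  ultimately have "(f has_integral (integral (cbox a (\<chi> j. if j = i then c else b $ j)) f
      + integral (cbox (\<chi> j. if j = i then c else a $ j) b) f)) (cbox a b)"
    using integrable_integral[OF int]
    by (intro has_integral_split[where k = "axis i 1" and c = c]) (auto simp: axis_in_Basis_iff)
  then show ?thesis
    by (rule integral_unique)
qed

text \<open>Translating the unit cube by \<open>t\<close> in one direction moves the slab of width \<open>t\<close> by one period.\<close>

lemma integral_periodic_translate:
  fixes f :: "(real, 'd::finite) vec \<Rightarrow> complex"
  assumes f: "continuous_on UNIV f" and per: "\<And>x. f (x + axis i 1) = f x" and t: "0 \<le> t" "t \<le> 1"
  shows "integral (cbox 0 1) (\<lambda>x. f (x + t *\<^sub>R axis i 1)) = integral (cbox 0 1) f"
proof -
  let ?e = "axis i 1 :: (real, 'd) vec"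
  have 1: "integral (cbox 0 1) (\<lambda>x. f (x + t *\<^sub>R ?e)) = integral (cbox (t *\<^sub>R ?e) (1 + t *\<^sub>R ?e)) f"
    using integral_shift_cbox[of "t *\<^sub>R ?e" "t *\<^sub>R ?e" "1 + t *\<^sub>R ?e" f] by simp
  have 2: "integral (cbox (t *\<^sub>R ?e) (1 + t *\<^sub>R ?e)) f =
      integral (cbox (t *\<^sub>R ?e) 1) f + integral (cbox ?e (1 + t *\<^sub>R ?e)) f"
  proof -
    have "(\<chi> j. if j = i then 1 else (1 + t *\<^sub>R ?e) $ j) = 1"
      "(\<chi> j. if j = i then 1 else (t *\<^sub>R ?e) $ j) = ?e"
      by (auto simp: vec_eq_iff axis_def)
    then show ?thesis
      using integral_split_coordinate[OF f, of "t *\<^sub>R ?e" i 1 "1 + t *\<^sub>R ?e"] t by simp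
  qed
  have 3: "integral (cbox ?e (1 + t *\<^sub>R ?e)) f = integral (cbox 0 (1 + t *\<^sub>R ?e - ?e)) f"
    using integral_shift_cbox[of ?e ?e "1 + t *\<^sub>R ?e" f] per by simp
  have 4: "integral (cbox 0 1) f = integral (cbox 0 (1 + t *\<^sub>R ?e - ?e)) f + integral (cbox (t *\<^sub>R ?e) 1) f"
  proof -
    have "(\<chi> j. if j = i then t else (1 :: (real, 'd) vec) $ j) = 1 + t *\<^sub>R ?e - ?e"
      "(\<chi> j. if j = i then t else (0 :: (real, 'd) vec) $ j) = t *\<^sub>R ?e"
      by (auto simp: vec_eq_iff axis_def)
    then show ?thesis
      using integral_split_coordinate[OF f, of 0 i t 1] t by simp
  qed
  show ?thesis
    unfolding 1 2 3 4 by (rule add.commute)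
qed

lemma torus_proj_translate:
  assumes "torus_proj x = torus_proj x'"
  shows "torus_proj (u + (x' - x)) = torus_proj u"
proof -
  have "x' $ i - x $ i \<in> \<int>" for i
    using assms by (metis abs_circle_eq_iff torus_proj_def vec_lambda_beta)
  then show ?thesis
    by (simp add: torus_proj_def vec_eq_iff abs_circle_eq_iff)
qed

lemma torus_proj_period: "torus_proj (x + axis i 1) = torus_proj x"
  by (simp add: torus_proj_def vec_eq_iff abs_circle_eq_iff axis_def)

text \<open>Average the fundamental theorem of calculus along closed coordinate lines, exchange the order of
  integration and use translation invariance.\<close>

lemma integral_torus_derivative:
  fixes h g :: "'d::finite torus \<Rightarrow> complex"
  assumes h: "\<And>x. ((h \<circ> torus_proj) has_derivative h' x) (at x)"
    and g: "continuous_on UNIV g" "\<And>x. h' x (axis i 1) = g (torus_proj x)"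
  shows "integral\<^sup>L torus_lebesgue g = 0"
proof -
  define G where "G = g \<circ> torus_proj"
  let ?e = "axis i 1 :: (real, 'd) vec"
  have G: "continuous_on UNIV G"
    using g(1) unfolding G_def by (simp add: continuous_on_torus_iff)
  have perG: "G (x + ?e) = G x" for x
    by (simp add: G_def torus_proj_period)
  have line: "integral (cbox 0 1) (\<lambda>t. G (x + t *\<^sub>R ?e)) = 0" for x
  proof -
    have "((\<lambda>t. G (x + t *\<^sub>R ?e)) has_integral
        (h \<circ> torus_proj) (x + 1 *\<^sub>R ?e) - (h \<circ> torus_proj) (x + 0 *\<^sub>R ?e)) {0..1}"
    proof (rule fundamental_theorem_of_calculus)
      fix t :: real
      have "((\<lambda>t. x + t *\<^sub>R ?e) has_derivative (\<lambda>s. s *\<^sub>R ?e)) (at t within {0..1})"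
        by (auto intro!: derivative_eq_intros)
      from has_derivative_compose[OF this h]
      have "((\<lambda>t. (h \<circ> torus_proj) (x + t *\<^sub>R ?e)) has_derivative (\<lambda>s. h' (x + t *\<^sub>R ?e) (s *\<^sub>R ?e)))
          (at t within {0..1})"
        by simp
      moreover have "h' (x + t *\<^sub>R ?e) (s *\<^sub>R ?e) = s *\<^sub>R G (x + t *\<^sub>R ?e)" for s
        using linear_scale[OF has_derivative_linear[OF h]] g(2) by (simp add: G_def)
      ultimately show "((\<lambda>t. (h \<circ> torus_proj) (x + t *\<^sub>R ?e)) has_vector_derivative G (x + t *\<^sub>R ?e))
          (at t within {0..1})"
        unfolding has_vector_derivative_def by simp
    qed simp
    then have "((\<lambda>t. G (x + t *\<^sub>R ?e)) has_integral 0) (cbox 0 1)"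
      by (simp add: torus_proj_period)
    then show ?thesis
      by (rule integral_unique)
  qed
  have "continuous_on UNIV (\<lambda>(x, t). G (x + t *\<^sub>R ?e))"
    unfolding split_beta
    by (intro continuous_on_compose2[OF G] continuous_intros) auto
  then have "integral (cbox 0 1) (\<lambda>x. integral (cbox 0 (1::real)) (\<lambda>t. G (x + t *\<^sub>R ?e)))
      = integral (cbox 0 1) (\<lambda>t. integral (cbox 0 1) (\<lambda>x. G (x + t *\<^sub>R ?e)))"
    by (intro integral_swap_continuous) (auto intro: continuous_on_subset)
  also have "\<dots> = integral (cbox 0 (1::real)) (\<lambda>t. integral (cbox 0 1) G)"
    by (intro integral_cong integral_periodic_translate[OF G perG]) auto
  finally have "integral (cbox 0 1) G = 0"
    by (simp add: line[simplified])
  then show ?thesis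
    by (simp add: integral_torus_lebesgue[OF g(1)] G_def)
qed

section \<open>Characters\<close>

definition torus_char :: "(int, 'd::finite) vec \<Rightarrow> 'd torus \<Rightarrow> complex"
  where "torus_char k x = exp (2 * \<i> * of_real pi * of_real (torus_pairing k x))"

lemma torus_pairing_minus: "torus_pairing (- k) x = - torus_pairing k x"
  by (simp add: torus_pairing_def sum_negf)

lemma torus_pairing_add: "torus_pairing (k + l) x = torus_pairing k x + torus_pairing l x"
  by (simp add: torus_pairing_def distrib_right sum.distrib)

lemma torus_char_zero [simp]: "torus_char 0 x = 1"
  by (simp add: torus_char_def torus_pairing_def)

lemma torus_char_add: "torus_char (k + l) x = torus_char k x * torus_char l x"
  by (simp add: torus_char_def torus_pairing_add distrib_left flip: exp_add)

lemma torus_char_minus: "torus_char (- k) x = cnj (torus_char k x)"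
  by (simp add: torus_char_def torus_pairing_minus exp_cnj)

lemma norm_torus_char [simp]: "cmod (torus_char k x) = 1"
  by (simp add: torus_char_def norm_exp_eq_Re)

text \<open>The sum and the pairing differ by an integer.\<close>

lemma torus_char_proj:
  "torus_char k (torus_proj x) = exp (2 * \<i> * of_real pi * of_real (\<Sum>i\<in>UNIV. of_int (k $ i) * x $ i))"
proof -
  define n where "n = (\<Sum>i\<in>UNIV. k $ i * \<lfloor>x $ i\<rfloor>)"
  have "torus_pairing k (torus_proj x) = (\<Sum>i\<in>UNIV. of_int (k $ i) * x $ i) - of_int n"
    by (simp add: torus_pairing_def torus_proj_def circle_coord.abs_eq frac_def n_def
        right_diff_distrib sum_subtractf)
  then have "(\<Sum>i\<in>UNIV. of_int (k $ i) * x $ i) = torus_pairing k (torus_proj x) + of_int n"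
    by simp
  moreover have "exp (2 * \<i> * of_real pi * of_int n) = 1"
    unfolding exp_eq_1 by (auto intro!: exI[of _ n])
  ultimately show ?thesis
    by (simp add: torus_char_def distrib_left exp_add)
qed

lemma torus_char_has_derivative:
  "((torus_char k \<circ> torus_proj) has_derivative
     (\<lambda>v. 2 * \<i> * of_real pi * of_real (\<Sum>i\<in>UNIV. of_int (k $ i) * v $ i) * torus_char k (torus_proj x))) (at x)"
proof -
  have L: "bounded_linear (\<lambda>v::(real, 'a) vec. 2 * \<i> * of_real pi * of_real (\<Sum>i\<in>UNIV. of_int (k $ i) * v $ i))"
    by (intro bounded_linear_const_mult bounded_linear_compose[OF bounded_linear_of_real]
        bounded_linear_sum bounded_linear_vec_nth)
  have "((\<lambda>y. exp (2 * \<i> * of_real pi * of_real (\<Sum>i\<in>UNIV. of_int (k $ i) * y $ i))) has_derivative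
     (\<lambda>v. exp (2 * \<i> * of_real pi * of_real (\<Sum>i\<in>UNIV. of_int (k $ i) * x $ i))
        * (2 * \<i> * of_real pi * of_real (\<Sum>i\<in>UNIV. of_int (k $ i) * v $ i)))) (at x)"
    using has_derivative_compose[OF bounded_linear_imp_has_derivative[OF L]
        DERIV_exp[unfolded has_field_derivative_def]] by simp
  then show ?thesis
    by (simp add: o_def torus_char_proj mult.commute)
qed

lemma continuous_on_torus_char: "continuous_on A (torus_char k)"
proof -
  have "continuous_on UNIV (torus_char k)"
    unfolding continuous_on_torus_iff
    by (rule has_derivative_continuous_on)
      (rule has_derivative_at_withinI, rule torus_char_has_derivative)
  then show ?thesis
    using continuous_on_subset by blast
qed

lemma fourier_coeff_eq:
  "fourier_coeff h k = (\<integral>x. torus_char (- k) x *\<^sub>C h x \<partial>torus_lebesgue)"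
  unfolding fourier_coeff_def torus_char_def by (simp add: torus_pairing_minus)

lemma fourier_coeff_complex:
  fixes h :: "'d::finite torus \<Rightarrow> complex"
  shows "fourier_coeff h k = (\<integral>x. torus_char (- k) x * h x \<partial>torus_lebesgue)"
  by (simp add: fourier_coeff_eq scaleC_complex_def)

text \<open>For \<open>k\<close> with \<open>k $ i \<noteq> 0\<close> the character is a multiple of its derivative in direction \<open>i\<close>.\<close>

lemma integral_torus_char: "(\<integral>x. torus_char k x \<partial>torus_lebesgue) = (if k = 0 then 1 else 0)"
proof (cases "k = 0")
  case True
  have "(\<integral>x. torus_char k x \<partial>torus_lebesgue) = integral (cbox 0 1) (\<lambda>_::(real, 'a) vec. 1 :: complex)"
    unfolding integral_torus_lebesgue[OF continuous_on_torus_char] by (simp add: o_def True)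
  then show ?thesis
    by (simp add: True content_unit_cube)
next
  case False
  then obtain i where i: "k $ i \<noteq> 0"
    by (auto simp: vec_eq_iff)
  define c where "c = 2 * \<i> * of_real pi * of_int (k $ i)"
  have "(\<integral>x. c * torus_char k x \<partial>torus_lebesgue) = 0"
  proof (rule integral_torus_derivative[OF torus_char_has_derivative])
    show "2 * \<i> * of_real pi * of_real (\<Sum>j\<in>UNIV. of_int (k $ j) * axis i 1 $ j) * torus_char k (torus_proj x)
        = c * torus_char k (torus_proj x)" for x
      by (simp add: c_def axis_def if_distrib cong: if_cong)
  qed (intro continuous_intros continuous_on_torus_char)
  then show ?thesis
    using False i by (simp add: c_def)
qed

section \<open>Derivatives on the torus and Fourier coefficients\<close>

text \<open>The partial derivative of the periodic lift, read at an arbitrary representative; as a function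
  on the torus it can be iterated and has Fourier coefficients.\<close>

definition torus_deriv :: "'d::finite \<Rightarrow> ('d torus \<Rightarrow> 'a::real_normed_vector) \<Rightarrow> 'd torus \<Rightarrow> 'a"
  where "torus_deriv i h x = frechet_derivative (h \<circ> torus_proj) (at (torus_rep x)) (axis i 1)"

text \<open>The lift is invariant under the translation that takes one representative to the other.\<close>

lemma frechet_derivative_torus_proj:
  assumes "(h \<circ> torus_proj) differentiable (at x')" "torus_proj x = torus_proj x'"
  shows "frechet_derivative (h \<circ> torus_proj) (at x) = frechet_derivative (h \<circ> torus_proj) (at x')"
proof -
  let ?D = "frechet_derivative (h \<circ> torus_proj) (at x')"
  have D: "((h \<circ> torus_proj) has_derivative ?D) (at (x + (x' - x)))"
    using assms(1) by (simp add: frechet_derivative_works)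
  have "((\<lambda>u. u + (x' - x)) has_derivative (\<lambda>v. v)) (at x)"
    by (auto intro!: derivative_eq_intros)
  from has_derivative_compose[OF this D]
  have "((\<lambda>u. (h \<circ> torus_proj) (u + (x' - x))) has_derivative ?D) (at x)"
    by simp
  moreover have "(\<lambda>u. (h \<circ> torus_proj) (u + (x' - x))) = h \<circ> torus_proj"
    using torus_proj_translate[OF assms(2)] by (simp add: fun_eq_iff)
  ultimately show ?thesis
    using frechet_derivative_at by metis
qed

lemma torus_deriv_lift:
  assumes "\<And>x. (h \<circ> torus_proj) differentiable (at x)"
  shows "torus_deriv i h \<circ> torus_proj = (\<lambda>x. frechet_derivative (h \<circ> torus_proj) (at x) (axis i 1))"
proof
  fix x
  have "frechet_derivative (h \<circ> torus_proj) (at (torus_rep (torus_proj x))) =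
      frechet_derivative (h \<circ> torus_proj) (at x)"
    by (rule frechet_derivative_torus_proj[OF assms]) simp
  then show "(torus_deriv i h \<circ> torus_proj) x = frechet_derivative (h \<circ> torus_proj) (at x) (axis i 1)"
    by (simp add: torus_deriv_def)
qed

lemma C_class_Suc_imp: "C_class (Suc j) f \<Longrightarrow> C_class j f"
proof (induction j arbitrary: f)
  case 0
  then show ?case
    by (auto intro!: continuous_at_imp_continuous_on differentiable_imp_continuous_within)
next
  case (Suc j)
  then have "C_class j (\<lambda>x. frechet_derivative f (at x) (axis i 1))" for i
    unfolding C_class.simps(2)[of "Suc j"] by blast
  then show ?case
    using Suc.prems unfolding C_class.simps(2)[of "Suc j"] C_class.simps(2)[of j] by blast
qed

lemma C_class_mono: "i \<le> j \<Longrightarrow> C_class j f \<Longrightarrow> C_class i f"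
  by (induction j rule: dec_induct) (auto dest: C_class_Suc_imp simp del: C_class.simps)

lemma torus_C_class_mono: "i \<le> j \<Longrightarrow> torus_C_class j h \<Longrightarrow> torus_C_class i h"
  unfolding torus_C_class_def by (rule C_class_mono)

lemma torus_C_class_continuous: "torus_C_class j h \<Longrightarrow> continuous_on UNIV h"
  using C_class_mono[of 0 j "h \<circ> torus_proj"]
  by (simp add: torus_C_class_def continuous_on_torus_iff)

lemma torus_C_class_differentiable: "torus_C_class (Suc j) h \<Longrightarrow> (h \<circ> torus_proj) differentiable (at x)"
  unfolding torus_C_class_def by simp

lemma torus_C_class_deriv: "torus_C_class (Suc j) h \<Longrightarrow> torus_C_class j (torus_deriv i h)"
  using torus_deriv_lift[of h i] unfolding torus_C_class_def by simp

lemma torus_C_class_deriv_funpow: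
  "torus_C_class (j + n) h \<Longrightarrow> torus_C_class j ((torus_deriv i ^^ n) h)"
proof (induction n arbitrary: j)
  case (Suc n)
  then have "torus_C_class (Suc j) ((torus_deriv i ^^ n) h)"
    by simp
  then show ?case
    by (simp add: torus_C_class_deriv)
qed simp

lemma frechet_derivative_bounded_linear:
  assumes L: "bounded_linear L" and f: "f differentiable (at x)"
  shows "(\<lambda>x. L (f x)) differentiable (at x)"
    "frechet_derivative (\<lambda>x. L (f x)) (at x) v = L (frechet_derivative f (at x) v)"
proof -
  have d: "((\<lambda>x. L (f x)) has_derivative (\<lambda>v. L (frechet_derivative f (at x) v))) (at x)"
    using f by (intro bounded_linear.has_derivative[OF L]) (simp add: frechet_derivative_works)
  then show "(\<lambda>x. L (f x)) differentiable (at x)"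
    unfolding differentiable_def by blast
  show "frechet_derivative (\<lambda>x. L (f x)) (at x) v = L (frechet_derivative f (at x) v)"
    using frechet_derivative_at[OF d] by metis
qed

lemma C_class_bounded_linear:
  assumes L: "bounded_linear L"
  shows "C_class j f \<Longrightarrow> C_class j (\<lambda>x. L (f x))"
proof (induction j arbitrary: f)
  case 0
  then show ?case
    using bounded_linear.continuous_on[OF L] by simp
next
  case (Suc j)
  then show ?case
    by (simp add: frechet_derivative_bounded_linear[OF L])
qed

lemma torus_C_class_bounded_linear:
  "bounded_linear L \<Longrightarrow> torus_C_class j h \<Longrightarrow> torus_C_class j (\<lambda>x. L (h x))"
  using C_class_bounded_linear[of L j "h \<circ> torus_proj"] by (simp add: torus_C_class_def o_def)

lemma torus_deriv_funpow_bounded_linear: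
  assumes L: "bounded_linear L"
  shows "torus_C_class n h \<Longrightarrow> (torus_deriv i ^^ n) (\<lambda>x. L (h x)) = (\<lambda>x. L ((torus_deriv i ^^ n) h x))"
proof (induction n arbitrary: h)
  case (Suc n)
  have "torus_deriv i (\<lambda>x. L (h x)) = (\<lambda>x. L (torus_deriv i h x))"
    using frechet_derivative_bounded_linear(2)[OF L torus_C_class_differentiable[OF Suc.prems]]
    by (simp add: torus_deriv_def fun_eq_iff o_def)
  then show ?case
    using Suc.IH[OF torus_C_class_deriv[OF Suc.prems]] by (simp only: funpow_Suc_right comp_apply)
qed simp

text \<open>Integration by parts: the derivative of the product with a character has integral zero.\<close>

lemma fourier_coeff_deriv:
  fixes h :: "'d::finite torus \<Rightarrow> complex"
  assumes h: "torus_C_class (Suc 0) h"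
  shows "fourier_coeff (torus_deriv i h) k = 2 * \<i> * of_real pi * of_int (k $ i) * fourier_coeff h k"
proof -
  define c where "c = 2 * \<i> * of_real pi * of_int (k $ i)"
  have hc: "continuous_on UNIV h"
    by (rule torus_C_class_continuous[OF h])
  have dc: "continuous_on UNIV (torus_deriv i h)"
    by (rule torus_C_class_continuous[OF torus_C_class_deriv[OF h]])
  let ?D = "\<lambda>x. frechet_derivative (h \<circ> torus_proj) (at x)"
  let ?C = "\<lambda>x v. 2 * \<i> * of_real pi * of_real (\<Sum>i\<in>UNIV. of_int ((- k) $ i) * v $ i) * torus_char (- k) (torus_proj x)"
  have dh: "((h \<circ> torus_proj) has_derivative ?D x) (at x)" for x
    using torus_C_class_differentiable[OF h] by (simp add: frechet_derivative_works)
  have "(\<integral>x. torus_char (- k) x * torus_deriv i h x + (- c) * (torus_char (- k) x * h x) \<partial>torus_lebesgue) = 0"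
  proof (rule integral_torus_derivative)
    show "(((\<lambda>x. torus_char (- k) x * h x) \<circ> torus_proj) has_derivative
      (\<lambda>v. (torus_char (- k) \<circ> torus_proj) x * ?D x v + ?C x v * (h \<circ> torus_proj) x)) (at x)" for x
      using has_derivative_mult[OF torus_char_has_derivative[of "- k" x] dh] by (simp add: o_def)
    show "(torus_char (- k) \<circ> torus_proj) x * ?D x (axis i 1) + ?C x (axis i 1) * (h \<circ> torus_proj) x =
      torus_char (- k) (torus_proj x) * torus_deriv i h (torus_proj x)
        + (- c) * (torus_char (- k) (torus_proj x) * h (torus_proj x))" for x
    proof -
      have "?D x (axis i 1) = torus_deriv i h (torus_proj x)"
        using torus_deriv_lift[OF torus_C_class_differentiable[OF h], of i, THEN fun_cong, of x] by simp
      then show ?thesis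
        by (simp add: c_def axis_def if_distrib cong: if_cong)
    qed
  qed (intro continuous_intros continuous_on_torus_char hc dc)
  moreover have "integrable torus_lebesgue (\<lambda>x. torus_char (- k) x * torus_deriv i h x)"
    "integrable torus_lebesgue (\<lambda>x. torus_char (- k) x * h x)"
    by (intro integrable_torus continuous_intros continuous_on_torus_char hc dc)+
  ultimately show ?thesis
    unfolding fourier_coeff_complex c_def[symmetric] by simp
qed

lemma fourier_coeff_deriv_funpow:
  fixes h :: "'d::finite torus \<Rightarrow> complex"
  shows "torus_C_class n h \<Longrightarrow>
    fourier_coeff ((torus_deriv i ^^ n) h) k = (2 * \<i> * of_real pi * of_int (k $ i)) ^ n * fourier_coeff h k"
proof (induction n arbitrary: h)
  case (Suc n)
  have "fourier_coeff ((torus_deriv i ^^ Suc n) h) k = fourier_coeff ((torus_deriv i ^^ n) (torus_deriv i h)) k"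
    by (simp only: funpow_Suc_right comp_apply)
  also have "\<dots> = (2 * \<i> * of_real pi * of_int (k $ i)) ^ n * fourier_coeff (torus_deriv i h) k"
    by (rule Suc.IH[OF torus_C_class_deriv[OF Suc.prems]])
  also have "fourier_coeff (torus_deriv i h) k = 2 * \<i> * of_real pi * of_int (k $ i) * fourier_coeff h k"
    using Suc.prems by (intro fourier_coeff_deriv torus_C_class_mono[of "Suc 0" "Suc n"]) auto
  finally show ?case
    by (simp add: mult_ac)
qed simp

text \<open>Integrate the squared modulus of \<open>h - p\<close>, where \<open>p\<close> is the partial Fourier series over \<open>F\<close>.\<close>

lemma bessel:
  fixes h :: "'d::finite torus \<Rightarrow> complex"
  assumes h: "continuous_on UNIV h" and B: "\<And>x. cmod (h x) \<le> B" and F: "finite F"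
  shows "(\<Sum>k\<in>F. (cmod (fourier_coeff h k))\<^sup>2) \<le> B\<^sup>2"
proof -
  let ?T = "\<lambda>f. integral\<^sup>L torus_lebesgue f :: complex"
  define c where "c = fourier_coeff h"
  define p where "p x = (\<Sum>k\<in>F. c k * torus_char k x)" for x
  define S where "S = (\<Sum>k\<in>F. complex_of_real ((cmod (c k))\<^sup>2))"
  have pc: "continuous_on UNIV p"
    unfolding p_def by (intro continuous_intros continuous_on_torus_char)
  note int = integrable_torus
  have hp: "?T (\<lambda>x. h x * cnj (p x)) = S"
  proof -
    have "?T (\<lambda>x. h x * cnj (p x)) = ?T (\<lambda>x. \<Sum>k\<in>F. cnj (c k) * (torus_char (- k) x * h x))"
      by (simp add: p_def torus_char_minus sum_distrib_left mult_ac)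
    also have "\<dots> = (\<Sum>k\<in>F. cnj (c k) * c k)"
      by (subst Bochner_Integration.integral_sum)
        (auto simp: c_def fourier_coeff_complex intro!: int continuous_intros continuous_on_torus_char h)
    finally show ?thesis
      unfolding S_def complex_norm_square by (simp add: mult.commute)
  qed
  have ph: "?T (\<lambda>x. cnj (h x) * p x) = S"
  proof -
    have "?T (\<lambda>x. cnj (h x) * p x) = ?T (\<lambda>x. cnj (h x * cnj (p x)))"
      by simp
    also have "\<dots> = cnj S"
      unfolding Bochner_Integration.integral_cnj hp ..
    finally show ?thesis
      by (simp add: S_def)
  qed
  have pp: "?T (\<lambda>x. p x * cnj (p x)) = S"
  proof -
    have "p x * cnj (p x) = (\<Sum>k\<in>F. \<Sum>l\<in>F. c k * cnj (c l) * torus_char (k + - l) x)" for x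
      unfolding p_def torus_char_add torus_char_minus by (simp add: sum_product mult_ac)
    then have "?T (\<lambda>x. p x * cnj (p x)) = (\<Sum>k\<in>F. \<Sum>l\<in>F. c k * cnj (c l) * ?T (torus_char (k + - l)))"
      by (simp add: Bochner_Integration.integral_sum int continuous_on_sum continuous_on_mult_left
          continuous_on_torus_char)
    also have "\<dots> = (\<Sum>k\<in>F. \<Sum>l\<in>F. if k = l then c k * cnj (c l) else 0)"
      by (intro sum.cong refl) (auto simp: integral_torus_char)
    finally show ?thesis
      unfolding S_def complex_norm_square using F by simp
  qed
  have "?T (\<lambda>x. complex_of_real ((cmod (h x - p x))\<^sup>2)) = ?T (\<lambda>x. h x * cnj (h x)) - S"
  proof -
    have "complex_of_real ((cmod (h x - p x))\<^sup>2)
        = h x * cnj (h x) - h x * cnj (p x) - cnj (h x) * p x + p x * cnj (p x)" for x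
      unfolding complex_norm_square by (simp add: algebra_simps)
    then show ?thesis
      by (simp add: int continuous_intros h pc hp ph pp)
  qed
  then have eq: "complex_of_real (\<integral>x. (cmod (h x - p x))\<^sup>2 \<partial>torus_lebesgue) + S = ?T (\<lambda>x. h x * cnj (h x))"
    by (simp only: integral_complex_of_real diff_add_cancel)
  have "cmod (?T (\<lambda>x. h x * cnj (h x))) \<le> B\<^sup>2"
  proof (rule norm_integral_torus_le)
    show "cmod (h x * cnj (h x)) \<le> B\<^sup>2" for x
      using B[of x] by (simp add: norm_mult power2_eq_square mult_mono')
  qed (intro continuous_intros h)
  then have "cmod (complex_of_real ((\<integral>x. (cmod (h x - p x))\<^sup>2 \<partial>torus_lebesgue) + (\<Sum>k\<in>F. (cmod (c k))\<^sup>2))) \<le> B\<^sup>2"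
    unfolding eq[symmetric] S_def of_real_add of_real_sum .
  then have "\<bar>(\<integral>x. (cmod (h x - p x))\<^sup>2 \<partial>torus_lebesgue) + (\<Sum>k\<in>F. (cmod (c k))\<^sup>2)\<bar> \<le> B\<^sup>2"
    by (simp only: norm_of_real)
  moreover have "0 \<le> (\<integral>x. (cmod (h x - p x))\<^sup>2 \<partial>torus_lebesgue)"
    by simp
  ultimately show ?thesis
    unfolding c_def by linarith
qed

lemma torus_char_separates:
  assumes "x \<noteq> y"
  shows "\<exists>k. torus_char k x \<noteq> torus_char k y"
proof -
  obtain i where i: "x $ i \<noteq> y $ i"
    using assms by (auto simp: vec_eq_iff)
  have p: "torus_pairing (axis i 1) z = circle_coord (z $ i)" for z
    by (simp add: torus_pairing_def axis_def if_distrib if_distribR cong: if_cong)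
  have "torus_char (axis i 1) x \<noteq> torus_char (axis i 1) y"
  proof
    assume "torus_char (axis i 1) x = torus_char (axis i 1) y"
    then obtain n where "2 * pi * circle_coord (x $ i) = 2 * pi * circle_coord (y $ i) + of_int (2 * n) * pi"
      unfolding torus_char_def p exp_eq by (auto simp: complex_eq_iff)
    then have "pi * (circle_coord (x $ i)) = pi * (circle_coord (y $ i) + of_int n)"
      by (simp add: algebra_simps)
    then have "circle_coord (x $ i) - circle_coord (y $ i) \<in> \<int>"
      by (subst (asm) mult_cancel_left) auto
    then show False
      using i abs_circle_eq_iff[of "circle_coord (x $ i)" "circle_coord (y $ i)"] by simp
  qed
  then show ?thesis ..
qed

text \<open>The continuous real functions \<open>p\<close> such that multiplication by \<open>p\<close> preserves the functions
  without nonzero Fourier coefficients form an algebra. It contains the real and imaginary parts of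
  the characters, which shift coefficients, and is therefore dense by the Stone--Weierstrass theorem.\<close>

lemma fourier_coeff_unique:
  fixes h :: "'d::finite torus \<Rightarrow> complex"
  assumes h: "continuous_on UNIV h" and zero: "\<And>k. fourier_coeff h k = 0"
  shows "h x = 0"
proof -
  define Z where "Z h \<longleftrightarrow> continuous_on UNIV h \<and> (\<forall>k. fourier_coeff h k = 0)" for h :: "'d torus \<Rightarrow> complex"
  define R where "R = {p. continuous_on UNIV p \<and> (\<forall>h. Z h \<longrightarrow> Z (\<lambda>x. h x * complex_of_real (p x)))}"
  have Z_add: "Z (\<lambda>x. a * f x + b * g x)" if "Z f" "Z g" for f g a b
  proof -
    have c: "continuous_on UNIV f" "continuous_on UNIV g"
      using that by (auto simp: Z_def)
    have "fourier_coeff (\<lambda>x. a * f x + b * g x) k = a * fourier_coeff f k + b * fourier_coeff g k" for k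
      unfolding fourier_coeff_complex
      by (simp add: distrib_left mult.left_commute integrable_torus continuous_intros continuous_on_torus_char c)
    then show ?thesis
      using that by (auto simp: Z_def intro!: continuous_intros)
  qed
  have Z_char: "Z (\<lambda>x. f x * torus_char k x)" if "Z f" for f k
  proof -
    have "fourier_coeff (\<lambda>x. f x * torus_char k x) l = fourier_coeff f (l - k)" for l
      unfolding fourier_coeff_complex using torus_char_add[of "- l" k] by (simp add: mult_ac)
    then show ?thesis
      using that by (auto simp: Z_def intro!: continuous_intros continuous_on_torus_char)
  qed
  interpret function_ring_on R UNIV
  proof
    show "compact (UNIV :: 'd torus set)"
      by (rule compact_UNIV_torus)
    show "continuous_on UNIV f" if "f \<in> R" for f
      using that by (simp add: R_def)
    show "(\<lambda>x. f x + g x) \<in> R" if "f \<in> R" "g \<in> R" for f g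
    proof -
      have "Z (\<lambda>x. h x * complex_of_real (f x + g x))" if "Z h" for h
      proof -
        have "Z (\<lambda>x. 1 * (h x * complex_of_real (f x)) + 1 * (h x * complex_of_real (g x)))"
          using \<open>f \<in> R\<close> \<open>g \<in> R\<close> that by (intro Z_add) (auto simp: R_def)
        then show ?thesis
          by (simp add: distrib_left)
      qed
      then show ?thesis
        using that by (auto simp: R_def intro!: continuous_intros)
    qed
    show "(\<lambda>x. f x * g x) \<in> R" if "f \<in> R" "g \<in> R" for f g
    proof -
      have "Z (\<lambda>x. h x * complex_of_real (f x * g x))" if "Z h" for h
      proof -
        have "Z (\<lambda>x. (h x * complex_of_real (f x)) * complex_of_real (g x))"
          using \<open>f \<in> R\<close> \<open>g \<in> R\<close> that by (auto simp: R_def)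
        then show ?thesis
          by (simp add: mult.assoc)
      qed
      then show ?thesis
        using that by (auto simp: R_def intro!: continuous_intros)
    qed
    show "(\<lambda>_. c) \<in> R" for c
      using Z_add[of _ _ "complex_of_real c" 0] by (auto simp: R_def mult.commute)
    show "\<exists>f\<in>R. f x \<noteq> f y" if xy: "x \<noteq> y" for x y
    proof -
      obtain k where k: "torus_char k x \<noteq> torus_char k y"
        using torus_char_separates[OF xy] by blast
      have "Z (\<lambda>x. h x * complex_of_real (Re (torus_char k x)))" if "Z h" for h
      proof -
        have "h x * complex_of_real (Re (torus_char k x))
            = 1/2 * (h x * torus_char k x) + 1/2 * (h x * torus_char (- k) x)" for x
          by (simp add: torus_char_minus complex_eq_iff field_simps)
        then show ?thesis
          using Z_add[OF Z_char[OF that] Z_char[OF that], of "1/2" k "1/2" "- k"] by simp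
      qed
      then have "(\<lambda>x. Re (torus_char k x)) \<in> R"
        by (auto simp: R_def intro!: continuous_intros continuous_on_torus_char)
      moreover have "Z (\<lambda>x. h x * complex_of_real (Im (torus_char k x)))" if "Z h" for h
      proof -
        have "h x * complex_of_real (Im (torus_char k x))
            = (- \<i>/2) * (h x * torus_char k x) + (\<i>/2) * (h x * torus_char (- k) x)" for x
          by (simp add: torus_char_minus complex_eq_iff field_simps)
        then show ?thesis
          using Z_add[OF Z_char[OF that] Z_char[OF that], of "- \<i>/2" k "\<i>/2" "- k"] by simp
      qed
      then have "(\<lambda>x. Im (torus_char k x)) \<in> R"
        by (auto simp: R_def intro!: continuous_intros continuous_on_torus_char)
      ultimately show ?thesis
        using k unfolding complex_eq_iff by (metis (lifting))
    qed
  qed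
  obtain B where B: "B > 0" "\<And>x. cmod (h x) \<le> B"
    by (rule bounded_on_torus[OF h]) (rule that)
  have Zh: "Z h"
    using h zero by (simp add: Z_def)
  have orth: "(\<integral>x. h x * complex_of_real (q x) \<partial>torus_lebesgue) = 0" if q: "continuous_on UNIV q" for q
  proof -
    have "cmod (\<integral>x. h x * complex_of_real (q x) \<partial>torus_lebesgue) \<le> 0 + e" if e: "e > 0" for e
    proof -
      obtain p where p: "p \<in> R" "\<And>x. \<bar>q x - p x\<bar> < e / B"
        using Stone_Weierstrass_basic[OF q, of "e / B"] e B(1) by auto
      have pc: "continuous_on UNIV p" and "Z (\<lambda>x. h x * complex_of_real (p x))"
        using p(1) Zh by (auto simp: R_def)
      then have "(\<integral>x. h x * complex_of_real (p x) \<partial>torus_lebesgue) = 0"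
        unfolding Z_def fourier_coeff_complex by (auto dest: spec[of _ 0])
      then have "(\<integral>x. h x * complex_of_real (q x) \<partial>torus_lebesgue)
          = (\<integral>x. h x * complex_of_real (q x - p x) \<partial>torus_lebesgue)"
        by (simp add: right_diff_distrib integrable_torus continuous_intros h q pc)
      also have "cmod \<dots> \<le> e"
      proof (rule norm_integral_torus_le)
        fix x
        have "cmod (h x * complex_of_real (q x - p x)) \<le> B * (e / B)"
          unfolding norm_mult using B p(2)[of x] by (intro mult_mono) (auto simp flip: of_real_diff)
        then show "cmod (h x * complex_of_real (q x - p x)) \<le> e"
          using B(1) by simp
      qed (intro continuous_intros h q pc)
      finally show ?thesis by simp
    qed
    then have "cmod (\<integral>x. h x * complex_of_real (q x) \<partial>torus_lebesgue) \<le> 0"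
      by (rule field_le_epsilon)
    then show ?thesis
      by simp
  qed
  have vanish: "P (h x) = 0"
    if P: "bounded_linear P" and PP: "\<And>z r. P (z * complex_of_real r) = P z * r" for P :: "complex \<Rightarrow> real"
  proof -
    have Pc: "continuous_on UNIV (\<lambda>x. P (h x))"
      by (rule bounded_linear.continuous_on[OF P h])
    have "P (\<integral>x. h x * complex_of_real (P (h x)) \<partial>torus_lebesgue) = 0"
      by (simp add: orth[OF Pc] linear_0 bounded_linear.linear[OF P])
    then have "(\<integral>x. P (h x * complex_of_real (P (h x))) \<partial>torus_lebesgue) = 0"
      by (subst integral_bounded_linear[OF P]) (intro integrable_torus continuous_intros h Pc)
    then have "(\<integral>x. complex_of_real (P (h x) * P (h x)) \<partial>torus_lebesgue) = 0"
      unfolding PP integral_complex_of_real by simp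
    then have "integral (cbox 0 1) ((\<lambda>x. complex_of_real (P (h x) * P (h x))) \<circ> torus_proj) = 0"
      by (subst (asm) integral_torus_lebesgue) (intro continuous_intros Pc)
    moreover have c: "continuous_on UNIV (\<lambda>y. P (h (torus_proj y)) * P (h (torus_proj y)))"
      by (intro continuous_intros continuous_on_compose2[OF Pc continuous_on_torus_proj]) auto
    moreover have "integral (cbox 0 1) (\<lambda>y. complex_of_real (P (h (torus_proj y)) * P (h (torus_proj y))))
        = complex_of_real (integral (cbox 0 1) (\<lambda>y. P (h (torus_proj y)) * P (h (torus_proj y))))"
      using has_integral_of_real[OF integrable_integral[OF integrable_continuous[OF continuous_on_subset[OF c]]]]
      by (intro integral_unique) auto
    ultimately have "integral (cbox 0 1) (\<lambda>y. P (h (torus_proj y)) * P (h (torus_proj y))) = 0"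
      by (simp add: o_def)
    then have "\<forall>y\<in>cbox 0 1. P (h (torus_proj y)) * P (h (torus_proj y)) = 0"
    proof (subst (asm) integral_cbox_eq_0_iff)
      have "(\<chi> i. 1/2) \<in> box 0 (1 :: (real, 'd) vec)"
        by (simp add: mem_box_cart)
      then show "box 0 (1 :: (real, 'd) vec) \<noteq> {}"
        by blast
    qed (auto intro: continuous_on_subset[OF c])
    moreover have "torus_rep x \<in> cbox 0 1"
      using circle_coord_bounds less_imp_le by (auto simp: mem_box_cart torus_rep_def)
    ultimately show ?thesis
      by force
  qed
  show ?thesis
    using vanish[OF bounded_linear_Re] vanish[OF bounded_linear_Im] by (simp add: complex_eq_iff)
qed

section \<open>Uniform convergence of Fourier series\<close>

text \<open>The sum over \<open>i\<close> of the squared moduli of the Fourier multipliers of the derivatives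
  \<open>\<partial>\<^sub>i\<^sup>s\<close>.\<close>

definition freq_weight :: "nat \<Rightarrow> (int, 'd::finite) vec \<Rightarrow> real"
  where "freq_weight s k = (\<Sum>i\<in>UNIV. (2 * pi * \<bar>of_int (k $ i)\<bar>) ^ (2 * s))"

lemma sum_freq_weight_fourier_coeff_le:
  fixes h :: "'d::finite torus \<Rightarrow> complex"
  assumes h: "torus_C_class s h" and B: "\<And>i x. cmod ((torus_deriv i ^^ s) h x) \<le> B" and F: "finite F"
  shows "(\<Sum>k\<in>F. freq_weight s k * (cmod (fourier_coeff h k))\<^sup>2) \<le> of_nat CARD('d) * B\<^sup>2"
proof -
  have c: "(2 * pi * \<bar>of_int (k $ i)\<bar>) ^ (2 * s) * (cmod (fourier_coeff h k))\<^sup>2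
      = (cmod (fourier_coeff ((torus_deriv i ^^ s) h) k))\<^sup>2" for i k
    by (simp add: fourier_coeff_deriv_funpow[OF h] norm_mult norm_power power_mult_distrib mult.commute[of s 2]
        flip: power_mult)
  have "continuous_on UNIV ((torus_deriv i ^^ s) h)" for i
    using h by (intro torus_C_class_continuous[of 0] torus_C_class_deriv_funpow) simp
  then have "(\<Sum>k\<in>F. (cmod (fourier_coeff ((torus_deriv i ^^ s) h) k))\<^sup>2) \<le> B\<^sup>2" for i
    using B by (intro bessel F)
  then have "(\<Sum>i\<in>(UNIV::'d set). \<Sum>k\<in>F. (cmod (fourier_coeff ((torus_deriv i ^^ s) h) k))\<^sup>2)
      \<le> (\<Sum>i\<in>(UNIV::'d set). B\<^sup>2)"
    by (intro sum_mono)
  then show ?thesis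
    unfolding freq_weight_def sum_distrib_right c by (subst sum.swap) simp
qed

lemma freq_cube_PiE:
  "sum f (freq_cube N) = (\<Sum>g\<in>PiE (UNIV :: 'd::finite set) (\<lambda>_. {- int N..int N}). f (\<chi> i. g i))"
  by (rule sum.reindex_bij_witness[where i = "\<lambda>g. \<chi> i. g i" and j = "\<lambda>k i. k $ i"])
    (auto simp: freq_cube_def PiE_iff)

lemma finite_freq_cube: "finite (freq_cube N :: (int, 'd::finite) vec set)"
proof -
  have "freq_cube N = (\<lambda>g. \<chi> i. g i) ` PiE (UNIV :: 'd set) (\<lambda>_. {- int N..int N})"
  proof (intro equalityI subsetI)
    fix k :: "(int, 'd) vec" assume "k \<in> freq_cube N"
    then show "k \<in> (\<lambda>g. \<chi> i. g i) ` PiE (UNIV :: 'd set) (\<lambda>_. {- int N..int N})"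
      by (intro image_eqI[of _ _ "\<lambda>i. k $ i"]) (auto simp: freq_cube_def PiE_iff)
  qed (auto simp: freq_cube_def PiE_iff)
  then show ?thesis
    by (simp add: finite_PiE)
qed

lemma freq_cube_mono: "m \<le> n \<Longrightarrow> freq_cube m \<subseteq> freq_cube n"
  unfolding freq_cube_def by (auto intro: order_trans) (smt (verit) of_nat_mono)+

lemma zero_in_freq_cube: "0 \<in> freq_cube N"
  by (simp add: freq_cube_def)

lemma freq_cube_exhausts: "\<exists>N. k \<in> freq_cube N"
proof -
  define N where "N = nat (Max (range (\<lambda>i. \<bar>k $ i\<bar>)))"
  have "\<bar>k $ i\<bar> \<le> int N" for i
  proof -
    have "\<bar>k $ i\<bar> \<le> Max (range (\<lambda>i. \<bar>k $ i\<bar>))"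
      by (rule Max_ge) auto
    then show ?thesis
      unfolding N_def by linarith
  qed
  then have "k \<in> freq_cube N"
    by (auto simp: freq_cube_def abs_le_iff minus_le_iff)
  then show ?thesis ..
qed

text \<open>The largest coordinate dominates the geometric mean of all of them. The resulting product form of
  the bound makes its sum over a cube factorize, and each factor is a convergent sum because the
  exponent \<open>2 s / d\<close> exceeds 1.\<close>

lemma inverse_freq_weight_le:
  fixes k :: "(int, 'd::finite) vec"
  assumes k: "k \<noteq> 0"
  shows "0 < freq_weight s k"
    "inverse (freq_weight s k) \<le> 4 ^ s * (\<Prod>i\<in>UNIV. (1 + \<bar>of_int (k $ i)\<bar>) powr (- (real (2 * s) / real CARD('d))))"
proof -
  define m where "m = Max (range (\<lambda>i. \<bar>of_int (k $ i) :: real\<bar>))"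
  have le: "\<bar>of_int (k $ i)\<bar> \<le> m" for i
    unfolding m_def by (intro Max_ge) auto
  have "m \<in> range (\<lambda>i. \<bar>of_int (k $ i) :: real\<bar>)"
    unfolding m_def by (intro Max_in) auto
  then obtain i where i: "m = \<bar>of_int (k $ i)\<bar>"
    by blast
  obtain j where "k $ j \<noteq> 0"
    using k by (auto simp: vec_eq_iff)
  then have "1 \<le> \<bar>of_int (k $ j) :: real\<bar>"
    by linarith
  then have m1: "1 \<le> m"
    using le[of j] by simp
  have "1 \<le> 2 * pi"
    using pi_ge_two by simp
  then have "m \<le> 2 * pi * m"
    using m1 by (simp add: mult_le_cancel_right1)
  then have "m ^ (2 * s) \<le> (2 * pi * m) ^ (2 * s)"
    using m1 by (intro power_mono) auto
  also have "\<dots> \<le> freq_weight s k"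
    unfolding freq_weight_def i by (rule member_le_sum) auto
  finally have w: "m ^ (2 * s) \<le> freq_weight s k" .
  have pos: "0 < m ^ (2 * s)"
    using m1 by simp
  then show "0 < freq_weight s k"
    using w by linarith
  have "(1 + m) ^ (2 * s) \<le> (2 * m) ^ (2 * s)"
    using m1 by (intro power_mono) auto
  also have "\<dots> = 4 ^ s * m ^ (2 * s)"
    by (simp add: power_mult_distrib power_mult)
  finally have m2: "inverse (m ^ (2 * s)) \<le> 4 ^ s * inverse ((1 + m) ^ (2 * s))"
    using pos m1 by (simp add: field_simps)
  have "inverse ((1 + m) ^ (2 * s)) = (1 + m) powr (- real (2 * s))"
    using m1 powr_realpow[of "1 + m" "2 * s"] by (simp only: powr_minus)
  also have "\<dots> = ((1 + m) powr (- (real (2 * s) / real CARD('d)))) ^ CARD('d)"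
    using m1 by (simp add: powr_power)
  also have "\<dots> = (\<Prod>i\<in>(UNIV::'d set). (1 + m) powr (- (real (2 * s) / real CARD('d))))"
    by simp
  also have "\<dots> \<le> (\<Prod>i\<in>UNIV. (1 + \<bar>of_int (k $ i)\<bar>) powr (- (real (2 * s) / real CARD('d))))"
  proof (rule prod_mono)
    fix i
    show "0 \<le> (1 + m) powr (- (real (2 * s) / real CARD('d))) \<and>
      (1 + m) powr (- (real (2 * s) / real CARD('d))) \<le> (1 + \<bar>of_int (k $ i)\<bar>) powr (- (real (2 * s) / real CARD('d)))"
      using le[of i] by (auto intro!: powr_mono2')
  qed
  finally have "4 ^ s * inverse ((1 + m) ^ (2 * s))
      \<le> 4 ^ s * (\<Prod>i\<in>UNIV. (1 + \<bar>of_int (k $ i)\<bar>) powr (- (real (2 * s) / real CARD('d))))"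
    by (rule mult_left_mono) simp
  moreover have "inverse (freq_weight s k) \<le> inverse (m ^ (2 * s))"
    by (rule le_imp_inverse_le[OF w pos])
  ultimately show "inverse (freq_weight s k) \<le> 4 ^ s * (\<Prod>i\<in>UNIV. (1 + \<bar>of_int (k $ i)\<bar>) powr (- (real (2 * s) / real CARD('d))))"
    using m2 by linarith
qed

lemma sum_inverse_freq_weight_bounded:
  assumes s: "2 * s > CARD('d::finite)"
  shows "\<exists>A. \<forall>N. (\<Sum>k\<in>freq_cube N - {0 :: (int, 'd) vec}. inverse (freq_weight s k)) \<le> A"
proof -
  define p where "p = real (2 * s) / real CARD('d)"
  have p: "p > 1"
    using s by (simp add: p_def)
  define q where "q n = (1 + \<bar>of_int n\<bar>) powr (- p)" for n :: int
  define u where "u n = (1 + real n) powr (- p)" for n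
  have u: "summable u" "\<And>n. 0 \<le> u n"
  proof -
    have "summable (\<lambda>n. real n powr (- p))"
      using p by (simp add: summable_real_powr_iff)
    then have "summable (\<lambda>n. real (Suc n) powr (- p))"
      by (subst summable_Suc_iff)
    then show "summable u"
      unfolding u_def by (simp add: add.commute)
  qed (simp add: u_def)
  have q_le: "(\<Sum>n\<in>{- int N..int N}. q n) \<le> 2 * suminf u" for N
  proof -
    have "(\<Sum>n\<in>{- int N..int N}. q n) \<le> (\<Sum>n\<in>int ` {..N} \<union> (\<lambda>n. - int n) ` {..N}. q n)"
    proof (rule sum_mono2)
      show "{- int N..int N} \<subseteq> int ` {..N} \<union> (\<lambda>n. - int n) ` {..N}"
      proof
        fix n assume n: "n \<in> {- int N..int N}"
        show "n \<in> int ` {..N} \<union> (\<lambda>n. - int n) ` {..N}"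
        proof (cases "0 \<le> n")
          case True
          then show ?thesis
            using n by (intro UnI1 image_eqI[of _ _ "nat n"]) auto
        next
          case False
          then show ?thesis
            using n by (intro UnI2 image_eqI[of _ _ "nat (- n)"]) auto
        qed
      qed
    qed (auto simp: q_def)
    also have "\<dots> \<le> (\<Sum>n\<in>int ` {..N}. q n) + (\<Sum>n\<in>(\<lambda>n. - int n) ` {..N}. q n)"
      by (subst sum_Un) (auto simp: q_def intro!: sum_nonneg)
    also have "\<dots> = 2 * (\<Sum>n\<le>N. u n)"
      by (simp add: sum.reindex inj_on_def q_def u_def)
    also have "\<dots> \<le> 2 * suminf u"
      using sum_le_suminf[OF u(1), of "{..N}"] u(2) by simp
    finally show ?thesis .
  qed
  have "(\<Sum>k\<in>freq_cube N - {0 :: (int, 'd) vec}. inverse (freq_weight s k)) \<le> 4 ^ s * (2 * suminf u) ^ CARD('d)" for N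
  proof -
    have "(\<Sum>k\<in>freq_cube N - {0 :: (int, 'd) vec}. inverse (freq_weight s k))
        \<le> (\<Sum>k\<in>freq_cube N - {0 :: (int, 'd) vec}. 4 ^ s * (\<Prod>i\<in>UNIV. q (k $ i)))"
      unfolding q_def p_def using inverse_freq_weight_le(2) by (intro sum_mono) auto
    also have "\<dots> \<le> (\<Sum>k\<in>(freq_cube N :: (int, 'd) vec set). 4 ^ s * (\<Prod>i\<in>UNIV. q (k $ i)))"
      by (intro sum_mono2 finite_freq_cube) (auto simp: q_def intro!: prod_nonneg)
    also have "\<dots> = 4 ^ s * (\<Sum>k\<in>(freq_cube N :: (int, 'd) vec set). \<Prod>i\<in>UNIV. q (k $ i))"
      by (simp add: sum_distrib_left)
    also have "(\<Sum>k\<in>(freq_cube N :: (int, 'd) vec set). \<Prod>i\<in>UNIV. q (k $ i))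
        = (\<Prod>i\<in>(UNIV :: 'd set). \<Sum>n\<in>{- int N..int N}. q n)"
      unfolding freq_cube_PiE by (subst prod_sum_PiE) auto
    also have "\<dots> = (\<Sum>n\<in>{- int N..int N}. q n) ^ CARD('d)"
      by simp
    also have "4 ^ s * \<dots> \<le> 4 ^ s * (2 * suminf u) ^ CARD('d)"
      using q_le by (intro mult_left_mono power_mono) (auto simp: q_def intro!: sum_nonneg)
    finally show ?thesis .
  qed
  then show ?thesis
    by blast
qed

lemma spectral_kernel_eq: "spectral_kernel n h x = (\<Sum>k\<in>freq_cube n. torus_char k x *\<^sub>C fourier_coeff h k)"
  by (simp add: spectral_kernel_def torus_char_def)

lemma continuous_on_spectral_kernel: "continuous_on UNIV (spectral_kernel n h)"
  unfolding spectral_kernel_eq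
  by (intro continuous_on_sum bounded_linear.continuous_on[OF bounded_linear_scaleC_left] continuous_on_torus_char)

lemma fourier_coeff_spectral_kernel:
  fixes h :: "'d::finite torus \<Rightarrow> complex"
  assumes "k \<in> freq_cube n"
  shows "fourier_coeff (spectral_kernel n h) k = fourier_coeff h k"
proof -
  have "torus_char (- k) x * spectral_kernel n h x = (\<Sum>l\<in>freq_cube n. fourier_coeff h l * torus_char (l - k) x)" for x
    unfolding spectral_kernel_eq scaleC_complex_def
    using torus_char_add[of "- k" _ x] by (simp add: sum_distrib_left mult_ac)
  then have "fourier_coeff (spectral_kernel n h) k
      = (\<Sum>l\<in>freq_cube n. fourier_coeff h l * (\<integral>x. torus_char (l - k) x \<partial>torus_lebesgue))"
    unfolding fourier_coeff_complex[of "spectral_kernel n h"]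
    by (simp add: Bochner_Integration.integral_sum integrable_torus continuous_on_mult_left continuous_on_torus_char)
  also have "\<dots> = (\<Sum>l\<in>freq_cube n. if l = k then fourier_coeff h l else 0)"
    by (intro sum.cong refl) (auto simp: integral_torus_char)
  finally show ?thesis
    using assms by (simp add: finite_freq_cube)
qed

text \<open>The tails of the Fourier series are estimated by the Cauchy--Schwarz inequality, applied to
  \<open>w\<^sub>k\<^sup>-\<^sup>1\<^sup>/\<^sup>2\<close> and \<open>w\<^sub>k\<^sup>1\<^sup>/\<^sup>2 |c\<^sub>k|\<close>. The rate \<open>\<delta>\<close> is chosen before \<open>h\<close>, so that it serves all
  scalar functions \<open>\<langle>\<phi>, v\<rangle>\<close> with \<open>\<parallel>v\<parallel> \<le> 1\<close> simultaneously.\<close>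

lemma scalar_fourier_uniform:
  assumes s: "2 * s > CARD('d::finite)"
  shows "\<exists>\<delta>. \<delta> \<longlonglongrightarrow> 0 \<and> (\<forall>(h :: 'd torus \<Rightarrow> complex) B. torus_C_class s h \<longrightarrow>
      (\<forall>i x. cmod ((torus_deriv i ^^ s) h x) \<le> B) \<longrightarrow>
      (\<forall>n x. cmod (spectral_kernel n h x - h x) \<le> B * \<delta> n))"
proof -
  define \<kappa> where "\<kappa> n = (\<Sum>k\<in>freq_cube n - {0 :: (int, 'd) vec}. inverse (freq_weight s k))" for n
  have wpos: "0 \<le> inverse (freq_weight s k)" if "k \<noteq> 0" for k :: "(int, 'd) vec"
    using inverse_freq_weight_le(1)[OF that, of s] by simp
  have \<kappa>_mono: "incseq \<kappa>"
    unfolding incseq_def \<kappa>_def using freq_cube_mono wpos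
    by (auto intro!: sum_mono2 finite_Diff finite_freq_cube)
  obtain A where "\<And>n. \<kappa> n \<le> A"
    using sum_inverse_freq_weight_bounded[OF s] unfolding \<kappa>_def by blast
  then obtain L where L: "\<kappa> \<longlonglongrightarrow> L" "\<And>n. \<kappa> n \<le> L"
    using incseq_convergent[OF \<kappa>_mono] by blast
  define \<delta> where "\<delta> n = sqrt (of_nat CARD('d)) * sqrt (L - \<kappa> n)" for n
  have "\<delta> \<longlonglongrightarrow> sqrt (of_nat CARD('d)) * sqrt (L - L)"
    unfolding \<delta>_def by (intro tendsto_intros L(1))
  then have \<delta>: "\<delta> \<longlonglongrightarrow> 0"
    by simp
  have "cmod (spectral_kernel n h x - h x) \<le> B * \<delta> n"
    if h: "torus_C_class s h" and B: "\<And>i x. cmod ((torus_deriv i ^^ s) h x) \<le> B"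
    for h :: "'d torus \<Rightarrow> complex" and B n x
  proof -
    have hc: "continuous_on UNIV h"
      by (rule torus_C_class_continuous[OF h])
    have B0: "0 \<le> B"
      using B order_trans norm_ge_zero by blast
    have cauchy: "cmod (spectral_kernel N h x - spectral_kernel n h x) \<le> B * \<delta> n" if "n \<le> N" for n N x
    proof -
      define F where "F = freq_cube N - (freq_cube n :: (int, 'd) vec set)"
      have F: "finite F" "0 \<notin> F"
        using zero_in_freq_cube by (auto simp: F_def finite_freq_cube)
      have w: "0 < freq_weight s k" if "k \<in> F" for k
        using that F(2) by (intro inverse_freq_weight_le(1)) auto
      have w': "0 \<le> freq_weight s k" if "k \<in> F" for k
        using w[OF that] by simp
      have split: "freq_cube N = freq_cube n \<union> F" "freq_cube n \<inter> F = {}"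
        using freq_cube_mono[OF \<open>n \<le> N\<close>] by (auto simp: F_def)
      have "spectral_kernel N h x - spectral_kernel n h x = (\<Sum>k\<in>F. torus_char k x * fourier_coeff h k)"
        unfolding spectral_kernel_eq split(1) scaleC_complex_def
        using F(1) split(2) by (simp add: sum.union_disjoint finite_freq_cube)
      also have "cmod \<dots> \<le> (\<Sum>k\<in>F. cmod (fourier_coeff h k))"
        by (rule sum_norm_le) (simp add: norm_mult)
      also have "\<dots> = (\<Sum>k\<in>F. sqrt (inverse (freq_weight s k)) * (sqrt (freq_weight s k) * cmod (fourier_coeff h k)))"
      proof (rule sum.cong)
        fix k assume "k \<in> F"
        then have "sqrt (inverse (freq_weight s k)) * sqrt (freq_weight s k) = 1"
          using w[of k] by (simp flip: real_sqrt_mult)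
        then show "cmod (fourier_coeff h k)
            = sqrt (inverse (freq_weight s k)) * (sqrt (freq_weight s k) * cmod (fourier_coeff h k))"
          by (metis mult.assoc mult_1)
      qed simp
      also have "\<dots> \<le> sqrt ((L - \<kappa> n) * (of_nat CARD('d) * B\<^sup>2))"
      proof (rule real_le_rsqrt)
        have "(\<Sum>k\<in>F. sqrt (inverse (freq_weight s k)) * (sqrt (freq_weight s k) * cmod (fourier_coeff h k)))\<^sup>2
            \<le> (\<Sum>k\<in>F. (sqrt (inverse (freq_weight s k)))\<^sup>2)
              * (\<Sum>k\<in>F. (sqrt (freq_weight s k) * cmod (fourier_coeff h k))\<^sup>2)"
          by (rule Cauchy_Schwarz_ineq_sum)
        also have "\<dots> = (\<Sum>k\<in>F. inverse (freq_weight s k)) * (\<Sum>k\<in>F. freq_weight s k * (cmod (fourier_coeff h k))\<^sup>2)"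
          using w' by (intro arg_cong2[where f = "(*)"] sum.cong refl) (simp_all add: power_mult_distrib)
        also have "\<dots> \<le> (L - \<kappa> n) * (of_nat CARD('d) * B\<^sup>2)"
        proof (rule mult_mono)
          have "freq_cube N - {0} = (freq_cube n - {0}) \<union> F" "(freq_cube n - {0}) \<inter> F = {}"
            using split F(2) by auto
          then have "\<kappa> N = \<kappa> n + (\<Sum>k\<in>F. inverse (freq_weight s k))"
            unfolding \<kappa>_def using F(1) by (simp add: sum.union_disjoint finite_freq_cube)
          then show "(\<Sum>k\<in>F. inverse (freq_weight s k)) \<le> L - \<kappa> n"
            using L(2)[of N] by simp
          show "(\<Sum>k\<in>F. freq_weight s k * (cmod (fourier_coeff h k))\<^sup>2) \<le> of_nat CARD('d) * B\<^sup>2"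
            by (rule sum_freq_weight_fourier_coeff_le[OF h B F(1)])
          show "0 \<le> L - \<kappa> n"
            using L(2) by simp
          show "0 \<le> (\<Sum>k\<in>F. freq_weight s k * (cmod (fourier_coeff h k))\<^sup>2)"
            using w' by (intro sum_nonneg mult_nonneg_nonneg) auto
        qed
        finally show "(\<Sum>k\<in>F. sqrt (inverse (freq_weight s k)) * (sqrt (freq_weight s k) * cmod (fourier_coeff h k)))\<^sup>2
            \<le> (L - \<kappa> n) * (of_nat CARD('d) * B\<^sup>2)" .
      qed
      also have "\<dots> = B * \<delta> n"
        using B0 by (simp add: \<delta>_def real_sqrt_mult)
      finally show ?thesis .
    qed
    have "Cauchy (\<lambda>n. spectral_kernel n h x)" for x
    proof (rule CauchyI')
      fix e :: real assume "e > 0"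
      have "(\<lambda>n. B * \<delta> n) \<longlonglongrightarrow> 0"
        using tendsto_mult_right_zero[OF \<delta>] by simp
      then obtain M where M: "\<And>n. n \<ge> M \<Longrightarrow> B * \<delta> n < e"
        using order_tendstoD(2)[of _ 0 sequentially e] \<open>e > 0\<close> unfolding eventually_sequentially by blast
      have "cmod (spectral_kernel m h x - spectral_kernel n h x) < e" if "m \<ge> M" "n > m" for m n
        using cauchy[of m n x] M[OF that(1)] that(2) by (simp add: norm_minus_commute)
      then show "\<exists>M. \<forall>m\<ge>M. \<forall>n>m. dist (spectral_kernel m h x) (spectral_kernel n h x) < e"
        unfolding dist_norm
        by blast
    qed
    then obtain g where g: "\<And>x. (\<lambda>n. spectral_kernel n h x) \<longlonglongrightarrow> g x"
      unfolding Cauchy_convergent_iff convergent_def by metis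
    have g_le: "cmod (g x - spectral_kernel n h x) \<le> B * \<delta> n" for n x
    proof (rule tendsto_upperbound)
      show "(\<lambda>N. cmod (spectral_kernel N h x - spectral_kernel n h x)) \<longlonglongrightarrow> cmod (g x - spectral_kernel n h x)"
        by (intro tendsto_intros g)
      show "\<forall>\<^sub>F N in sequentially. cmod (spectral_kernel N h x - spectral_kernel n h x) \<le> B * \<delta> n"
        using cauchy unfolding eventually_sequentially by blast
    qed simp
    have unif: "uniform_limit UNIV (\<lambda>n. spectral_kernel n h) g sequentially"
    proof (rule uniform_limitI)
      fix e :: real assume "e > 0"
      have "(\<lambda>n. B * \<delta> n) \<longlonglongrightarrow> 0"
        using tendsto_mult_right_zero[OF \<delta>] by simp
      then have "\<forall>\<^sub>F n in sequentially. B * \<delta> n < e"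
        using order_tendstoD(2) \<open>e > 0\<close> by blast
      then show "\<forall>\<^sub>F n in sequentially. \<forall>x\<in>UNIV. dist (spectral_kernel n h x) (g x) < e"
        by eventually_elim (use g_le in \<open>auto simp: dist_norm norm_minus_commute intro: le_less_trans\<close>)
    qed
    have gc: "continuous_on UNIV g"
      by (rule uniform_limit_theorem[OF _ unif]) (simp_all add: continuous_on_spectral_kernel)
    \<comment> \<open>It remains to identify the sum \<open>g\<close> of the series with \<open>h\<close>.\<close>
    have "fourier_coeff (\<lambda>x. g x - h x) k = 0" for k
    proof -
      obtain n0 where n0: "k \<in> freq_cube n0"
        using freq_cube_exhausts by blast
      have "cmod (fourier_coeff (\<lambda>x. g x - h x) k) \<le> B * \<delta> n" if "n \<ge> n0" for n
      proof -
        have "k \<in> freq_cube n"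
          using n0 freq_cube_mono[OF that] by blast
        then have "(\<integral>x. torus_char (- k) x * spectral_kernel n h x \<partial>torus_lebesgue)
            = (\<integral>x. torus_char (- k) x * h x \<partial>torus_lebesgue)"
          using fourier_coeff_spectral_kernel[of k n h] unfolding fourier_coeff_complex by blast
        then have "fourier_coeff (\<lambda>x. g x - h x) k
            = (\<integral>x. torus_char (- k) x * (g x - spectral_kernel n h x) \<partial>torus_lebesgue)"
          unfolding fourier_coeff_complex
          by (simp add: right_diff_distrib integrable_torus continuous_on_mult continuous_on_torus_char gc hc
              continuous_on_spectral_kernel)
        also have "cmod \<dots> \<le> B * \<delta> n"
          by (rule norm_integral_torus_le)
            (auto simp: norm_mult g_le intro!: continuous_intros continuous_on_torus_char gc continuous_on_spectral_kernel)
        finally show ?thesis .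
      qed
      then have "\<forall>\<^sub>F n in sequentially. cmod (fourier_coeff (\<lambda>x. g x - h x) k) \<le> B * \<delta> n"
        unfolding eventually_sequentially by blast
      then have "cmod (fourier_coeff (\<lambda>x. g x - h x) k) \<le> 0"
        using tendsto_mult_right_zero[OF \<delta>, of B] by (intro tendsto_lowerbound[of "\<lambda>n. B * \<delta> n" 0 sequentially]) auto
      then show ?thesis
        by simp
    qed
    then have "g x = h x" for x
      using fourier_coeff_unique[of "\<lambda>x. g x - h x" x] gc hc by (simp add: continuous_on_diff)
    then show ?thesis
      using g_le[of x n] by (simp add: norm_minus_commute)
  qed
  then show ?thesis
    using \<delta> by (intro exI[of _ \<delta>]) blast
qed

lemma cinner_spectral_kernel:
  fixes \<phi> :: "'d::finite torus \<Rightarrow> 'h::separable_complex_hilbert"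
  assumes \<phi>: "continuous_on UNIV \<phi>"
  shows "cinner (spectral_kernel n \<phi> x) v = spectral_kernel n (\<lambda>x. cinner (\<phi> x) v) x"
proof -
  have c: "continuous_on UNIV (\<lambda>x. torus_char k x *\<^sub>C \<phi> x)" for k
    by (rule bounded_bilinear.continuous_on[OF bounded_bilinear_scaleC continuous_on_torus_char \<phi>])
  have "cinner (fourier_coeff \<phi> k) v = fourier_coeff (\<lambda>x. cinner (\<phi> x) v) k" for k
    unfolding fourier_coeff_eq
    by (subst integral_bounded_linear[OF bounded_linear_cinner_left integrable_torus[OF c], symmetric])
      (simp add: cinner_scaleC_left scaleC_complex_def)
  then show ?thesis
    unfolding spectral_kernel_eq
    by (simp add: linear_sum[OF bounded_linear.linear[OF bounded_linear_cinner_left]] cinner_scaleC_left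
        scaleC_complex_def)
qed

text \<open>Apply the scalar estimate to \<open>\<langle>\<phi>, v\<rangle>\<close>, whose derivatives are bounded by \<open>B \<parallel>v\<parallel>\<close>.\<close>

proposition spectral_kernel_uniform_limit:
  fixes \<phi> :: "'d::finite torus \<Rightarrow> 'h::separable_complex_hilbert"
  assumes \<phi>: "torus_C_class s \<phi>" and s: "2 * s > CARD('d)"
  shows "\<exists>\<epsilon>. \<epsilon> \<longlonglongrightarrow> 0 \<and> (\<forall>n x. norm (spectral_kernel n \<phi> x - \<phi> x) \<le> \<epsilon> n)"
proof -
  obtain \<delta> where \<delta>: "\<delta> \<longlonglongrightarrow> 0"
    and bound: "\<And>(h :: 'd torus \<Rightarrow> complex) B n x. torus_C_class s h \<Longrightarrow>
      (\<And>i x. cmod ((torus_deriv i ^^ s) h x) \<le> B) \<Longrightarrow> cmod (spectral_kernel n h x - h x) \<le> B * \<delta> n"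
    using scalar_fourier_uniform[OF s] by blast
  have "\<exists>b. \<forall>x. norm ((torus_deriv i ^^ s) \<phi> x) \<le> b" for i
  proof -
    have "continuous_on UNIV ((torus_deriv i ^^ s) \<phi>)"
      using \<phi> by (intro torus_C_class_continuous[of 0] torus_C_class_deriv_funpow) simp
    then show ?thesis
      using bounded_on_torus by metis
  qed
  then obtain b where b: "\<And>i x. norm ((torus_deriv i ^^ s) \<phi> x) \<le> b i"
    by metis
  define B where "B = (\<Sum>i\<in>UNIV. \<bar>b i\<bar>)"
  have B: "norm ((torus_deriv i ^^ s) \<phi> x) \<le> B" for i x
  proof -
    have "b i \<le> \<bar>b i\<bar>"
      by simp
    also have "\<dots> \<le> B"
      unfolding B_def by (rule member_le_sum) auto
    finally show ?thesis
      using b[of i x] by simp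
  qed
  have "norm (spectral_kernel n \<phi> x - \<phi> x) \<le> B * \<bar>\<delta> n\<bar>" for n x
  proof (rule norm_le_of_cinner)
    show "0 \<le> B * \<bar>\<delta> n\<bar>"
      unfolding B_def by (intro mult_nonneg_nonneg sum_nonneg) auto
    fix v :: 'h
    let ?h = "\<lambda>x. cinner (\<phi> x) v"
    have "cmod ((torus_deriv i ^^ s) ?h x) \<le> B * norm v" for i x
      unfolding torus_deriv_funpow_bounded_linear[OF bounded_linear_cinner_left \<phi>]
      by (rule order_trans[OF cinner_Cauchy_Schwarz mult_right_mono[OF B norm_ge_zero]])
    then have "cmod (spectral_kernel n ?h x - ?h x) \<le> (B * norm v) * \<delta> n"
      by (intro bound torus_C_class_bounded_linear[OF bounded_linear_cinner_left \<phi>])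
    also have "\<dots> \<le> (B * norm v) * \<bar>\<delta> n\<bar>"
      unfolding B_def by (intro mult_left_mono mult_nonneg_nonneg sum_nonneg) auto
    finally show "cmod (cinner (spectral_kernel n \<phi> x - \<phi> x) v) \<le> B * \<bar>\<delta> n\<bar> * norm v"
      by (simp add: cinner_diff_left cinner_spectral_kernel torus_C_class_continuous[OF \<phi>] mult_ac)
  qed
  moreover have "(\<lambda>n. B * \<bar>\<delta> n\<bar>) \<longlonglongrightarrow> 0"
    using tendsto_mult_right_zero[OF tendsto_rabs_zero[OF \<delta>]] by blast
  ultimately show ?thesis
    by (intro exI[of _ "\<lambda>n. B * \<bar>\<delta> n\<bar>"]) blast
qed

section \<open>Convergence of minimizers\<close>

lemma kernel_operator_diff_le:
  fixes \<phi> \<psi> :: "'d::finite torus \<Rightarrow> 'h::separable_complex_hilbert"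
  assumes c: "continuous_on UNIV \<phi>" "continuous_on UNIV \<psi>"
    and le: "\<And>x. norm (\<psi> x - \<phi> x) \<le> e" and e: "e > 0"
  shows "norm (kernel_operator \<psi> \<mu> - kernel_operator \<phi> \<mu>) \<le> e * total_variation \<mu>"
proof -
  have "bounded_borel \<phi>" "bounded_borel \<psi>"
    using c bounded_on_torus by (metis bounded_borelI)+
  then have "kernel_operator \<psi> \<mu> - kernel_operator \<phi> \<mu> = cm_integral \<mu> (\<lambda>x. \<psi> x - \<phi> x)"
    by (simp add: kernel_operator_def cm_integral_diff)
  then show ?thesis
    using norm_cm_integral_le[of "\<lambda>x. \<psi> x - \<phi> x" e \<mu>] c le e by (simp add: continuous_on_diff)
qed

text \<open>The quadratic term is convex, hence bounded below by its affine approximation.\<close>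

lemma norm_square_ge_tangent:
  fixes u v :: "'h::complex_hilbert"
  shows "(norm v)\<^sup>2 + 2 * Re (cinner (u - v) v) \<le> (norm u)\<^sup>2"
  using norm_diff_cinner[of u v] zero_le_power2[of "norm (u - v)"]
  by (simp add: cinner_diff_left cinner_self)

theorem proposition1:
  fixes \<phi> :: "'d::finite torus \<Rightarrow> 'h::separable_complex_hilbert"
    and y :: 'h and lam :: real and j :: nat
    and m :: "nat \<Rightarrow> 'd torus cmeasure"
  assumes "j \<ge> CARD('d) div 2 + 1"
    and "torus_C_class j \<phi>"
    and "lam > 0"
    and "\<And>fc. is_arg_min (blasso_energy lam y (kernel_operator (spectral_kernel fc \<phi>)))
           (\<lambda>\<mu>. True) (m fc)"
  shows "(\<exists>\<mu>. accumulation_point weak_star m \<mu>) \<and>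
    (\<forall>\<mu>. accumulation_point weak_star m \<mu> \<longrightarrow>
       is_arg_min (blasso_energy lam y (kernel_operator \<phi>)) (\<lambda>\<nu>. True) \<mu>)"
proof -
  define E where "E = blasso_energy lam y (kernel_operator \<phi>)"
  define Ec where "Ec n = blasso_energy lam y (kernel_operator (spectral_kernel n \<phi>))" for n
  have minimal: "Ec n (m n) \<le> Ec n \<nu>" for n \<nu>
    using assms(4)[of n] by (simp add: Ec_def is_arg_min_def not_less)
  have \<phi>: "continuous_on UNIV \<phi>"
    by (rule torus_C_class_continuous[OF assms(2)])
  obtain \<epsilon>\<^sub>0 where \<epsilon>\<^sub>0: "\<epsilon>\<^sub>0 \<longlonglongrightarrow> 0" "\<And>n x. norm (spectral_kernel n \<phi> x - \<phi> x) \<le> \<epsilon>\<^sub>0 n"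
  proof -
    have "torus_C_class (CARD('d) div 2 + 1) \<phi>"
      by (rule torus_C_class_mono[OF assms(1,2)])
    moreover have "2 * (CARD('d) div 2 + 1) > CARD('d)"
      by presburger
    ultimately show thesis
      using spectral_kernel_uniform_limit[of "CARD('d) div 2 + 1" \<phi>] that by blast
  qed
  \<comment> \<open>The second summand makes the rate positive, so that it can serve as a divisor in the bound for
    integrals.\<close>
  define \<epsilon> where "\<epsilon> n = \<bar>\<epsilon>\<^sub>0 n\<bar> + 1 / real (Suc n)" for n
  have \<epsilon>: "\<epsilon> \<longlonglongrightarrow> 0"
    unfolding \<epsilon>_def using tendsto_add[OF tendsto_rabs_zero[OF \<epsilon>\<^sub>0(1)] LIMSEQ_Suc[OF lim_1_over_n]] by simp
  have op: "norm (kernel_operator (spectral_kernel n \<phi>) \<nu> - kernel_operator \<phi> \<nu>) \<le> \<epsilon> n * total_variation \<nu>" for n \<nu>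
  proof (rule kernel_operator_diff_le[OF \<phi> continuous_on_spectral_kernel])
    show "norm (spectral_kernel n \<phi> x - \<phi> x) \<le> \<epsilon> n" for x
      using \<epsilon>\<^sub>0(2)[of n x] by (simp add: \<epsilon>_def add_increasing2)
  qed (simp add: \<epsilon>_def add_nonneg_pos)
  have Ec_lim: "(\<lambda>n. Ec n \<nu>) \<longlonglongrightarrow> E \<nu>" for \<nu>
  proof -
    have "(\<lambda>n. kernel_operator (spectral_kernel n \<phi>) \<nu> - kernel_operator \<phi> \<nu>) \<longlonglongrightarrow> 0"
      by (rule Lim_null_comparison[OF always_eventually[OF allI[OF op]] tendsto_mult_left_zero[OF \<epsilon>]])
    then have "(\<lambda>n. kernel_operator (spectral_kernel n \<phi>) \<nu>) \<longlonglongrightarrow> kernel_operator \<phi> \<nu>"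
      by (simp add: LIM_zero_iff)
    then show ?thesis
      unfolding Ec_def E_def blasso_energy_def by (intro tendsto_intros)
  qed
  have "Bseq (\<lambda>n. Ec n (m 0))"
    using Ec_lim by (intro convergent_imp_Bseq convergentI)
  then obtain C where C: "C > 0" "\<And>n. \<bar>Ec n (m 0)\<bar> \<le> C"
    by (auto elim!: BseqE)
  have TV: "total_variation (m n) \<le> C" for n
  proof -
    have "total_variation (m n) \<le> Ec n (m n)"
      using assms(3) by (simp add: Ec_def blasso_energy_def)
    then show ?thesis
      using minimal[of n "m 0"] C(2)[of n] by linarith
  qed
  have "E \<mu> \<le> E \<nu>" if acc: "accumulation_point weak_star m \<mu>" for \<mu> \<nu>
  proof (rule field_le_epsilon)
    fix r :: real assume r: "r > 0"
    \<comment> \<open>The errors add up to \<open>2 e\<close> in the total variation, \<open>4 e\<close> in the squared norm, which is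
      divided by \<open>2 lam\<close>, and \<open>e\<close> for the competitor.\<close>
    define e where "e = r / (3 + 2 / lam)"
    have lam': "0 < 3 + 2 / lam"
      using assms(3) by (simp add: add_pos_pos)
    have e: "e > 0"
      using r lam' by (simp add: e_def)
    define v where "v = kernel_operator \<phi> \<mu> - y"
    obtain \<eta> where \<eta>: "continuous_on UNIV \<eta>" "\<And>x. norm (\<eta> x) \<le> 1"
      "total_variation \<mu> - e < Re (cm_integral \<mu> \<eta>)"
      using total_variation_approx[OF e] by blast
    have \<phi>v: "continuous_on UNIV (\<lambda>x. cinner (\<phi> x) v)"
      by (rule bounded_linear.continuous_on[OF bounded_linear_cinner_left \<phi>])
    have weak: "cm_integral \<kappa> (\<lambda>x. cinner (\<phi> x) v) = cinner (kernel_operator \<phi> \<kappa>) v" for \<kappa>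
    proof -
      obtain B where "B > 0" "\<And>x. norm (\<phi> x) \<le> B"
        by (rule bounded_on_torus[OF \<phi>]) (rule that)
      then show ?thesis
        unfolding kernel_operator_def by (intro cm_integral_cinner bounded_borelI[OF \<phi>])
    qed
    have "\<forall>\<^sub>F n in sequentially. Ec n \<nu> < E \<nu> + e"
      using e by (intro order_tendstoD(2)[OF Ec_lim]) simp
    moreover have "\<forall>\<^sub>F n in sequentially. \<epsilon> n * (C * norm v) < e"
      using e by (intro order_tendstoD(2)[OF tendsto_mult_left_zero[OF \<epsilon>]]) simp
    ultimately have "\<forall>\<^sub>F n in sequentially. Ec n \<nu> < E \<nu> + e \<and> \<epsilon> n * (C * norm v) < e"
      by (rule eventually_conj)
    then obtain n0 where n0: "\<And>n. n \<ge> n0 \<Longrightarrow> Ec n \<nu> < E \<nu> + e \<and> \<epsilon> n * (C * norm v) < e"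
      unfolding eventually_sequentially by blast
    obtain n where n: "n \<ge> n0" "cmod (cm_integral (m n) \<eta> - cm_integral \<mu> \<eta>) < e"
      "cmod (cinner (kernel_operator \<phi> (m n)) v - cinner (kernel_operator \<phi> \<mu>) v) < e"
      using accumulation_pointD[OF acc \<eta>(1) \<phi>v e, of n0] unfolding weak by blast
    define u where "u = kernel_operator (spectral_kernel n \<phi>) (m n) - y"
    have "total_variation \<mu> - 2 * e \<le> total_variation (m n)"
    proof -
      have "\<bar>Re (cm_integral (m n) \<eta> - cm_integral \<mu> \<eta>)\<bar> < e"
        using n(2) abs_Re_le_cmod by (rule le_less_trans[rotated])
      then show ?thesis
        using \<eta>(3) Re_cm_integral_le_total_variation[OF \<eta>(1,2), of "m n"] by simp
    qed
    moreover have "- (2 * e) \<le> Re (cinner (u - v) v)"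
    proof -
      let ?d = "kernel_operator (spectral_kernel n \<phi>) (m n) - kernel_operator \<phi> (m n)"
      have "u - v = ?d + (kernel_operator \<phi> (m n) - kernel_operator \<phi> \<mu>)"
        by (simp add: u_def v_def)
      then have "cinner (u - v) v = cinner ?d v
          + (cinner (kernel_operator \<phi> (m n)) v - cinner (kernel_operator \<phi> \<mu>) v)"
        by (simp only: cinner_add_left cinner_diff_left)
      moreover have "cmod (cinner ?d v) < e"
      proof -
        have "cmod (cinner ?d v) \<le> norm ?d * norm v"
          by (rule cinner_Cauchy_Schwarz)
        also have "\<dots> \<le> (\<epsilon> n * C) * norm v"
        proof (intro mult_right_mono norm_ge_zero order_trans[OF op] mult_left_mono TV)
          show "0 \<le> \<epsilon> n"
            by (simp add: \<epsilon>_def)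
        qed
        also have "\<dots> < e"
          using n0[OF n(1)] by (simp add: mult.assoc)
        finally show ?thesis .
      qed
      ultimately have "cmod (cinner (u - v) v) < e + e"
        using n(3) by (simp only:) (rule norm_add_less)
      then have "\<bar>Re (cinner (u - v) v)\<bar> < e + e"
        using abs_Re_le_cmod by (rule le_less_trans[rotated])
      then show ?thesis
        by linarith
    qed
    then have "1 / (2 * lam) * ((norm v)\<^sup>2 - 4 * e) \<le> 1 / (2 * lam) * (norm u)\<^sup>2"
      using norm_square_ge_tangent[of v u] assms(3) by (intro mult_left_mono) auto
    moreover have "1 / (2 * lam) * ((norm v)\<^sup>2 - 4 * e) = 1 / (2 * lam) * (norm v)\<^sup>2 - 2 * e / lam"
      by (simp add: right_diff_distrib)
    ultimately have "E \<mu> - 2 * e / lam - 2 * e \<le> Ec n (m n)"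
      unfolding E_def Ec_def blasso_energy_def u_def v_def by linarith
    also have "\<dots> \<le> E \<nu> + e"
      using minimal[of n \<nu>] n0[OF n(1)] by simp
    finally have "E \<mu> \<le> E \<nu> + e * (3 + 2 / lam)"
      by (simp add: distrib_left mult.commute)
    then show "E \<mu> \<le> E \<nu> + r"
      using lam' by (simp add: e_def)
  qed
  then show ?thesis
    using weak_star_accumulation_point_exists[of m C] TV
    by (auto simp: is_arg_min_def E_def[symmetric] not_less)
qed

end
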